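(* Let $\mathcal M$ be a Riemannian manifold, let $\mathcal C\subset\mathcal M$ be strongly convex, let $F\colon\mathcal C\to\overline{\mathbb R}$ be a proper function and let $m,p\in\mathcal C$. Let $f_m\colon T_m\mathcal M\to\overline{\mathbb R}$ be given by $f_m(X)=F(\exp_m X)$ for $X\in\mathcal L_{\mathcal C,m}$ and $f_m(X)=+\infty$ for $X\notin\mathcal L_{\mathcal C,m}$. If $f_m$ is convex and lower semicontinuous on $T_m\mathcal M$, then for every $\xi_p\in T_p^*\mathcal M$ $$\mathcal P_{p\to m}\xi_p\in\partial f_m(\log_m p)\quad\Longleftrightarrow\quad \log_m p\in\partial F_m^*(\mathcal P_{p\to m}\xi_p).$$
   Context: $\mathcal M$ is a connected, finite-dimensional smooth Riemannian manifold with tangent spaces $T_p\mathcal M$, cotangent spaces $T_p^*\mathcal M$, duality pairing $\langle\cdot,\cdot\rangle$ between $T_p^*\mathcal M$ and $T_p\mathcal M$, norm $\|\cdot\|_p$ induced by the metric, Riemannian distance $d$ and exponential map $\exp_p$. $\overline{\mathbb R}=\mathbb R\cup\{\pm\infty\}$. A set $\mathcal C\subset\mathcal M$ is strongly convex if for any $p,q\in\mathcal C$ there is a unique shortest geodesic of $\mathcal M$ connecting $p$ to $q$, and that geodesic lies completely in $\mathcal C$. For $m\in\mathcal C$ let $\mathcal L_{\mathcal C,m}=\{X\in T_m\mathcal M:\exp_m X\in\mathcal C \text{ and } \|X\|_m=d(\exp_m X,m)\}$. If $\mathcal C$ is strongly convex, $\exp_m\colon\mathcal L_{\mathcal C,m}\to\mathcal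 C$ is a bijection, and $\log_m\colon\mathcal C\to\mathcal L_{\mathcal C,m}$ denotes its inverse. A function is proper if it is not identically $+\infty$ and never takes the value $-\infty$. The $m$-Fenchel conjugate of $F$ is $F_m^*\colon T_m^*\mathcal M\to\overline{\mathbb R}$, $F_m^*(\xi_m)=\sup_{X\in\mathcal L_{\mathcal C,m}}\{\langle\xi_m,X\rangle-F(\exp_m X)\}$. $\mathcal P_{p\to m}\xi_p\in T_m^*\mathcal M$ is the parallel transport of the cotangent vector $\xi_p$ along the unique shortest geodesic from $p$ to $m$, defined by $\mathcal P_{p\to m}\xi_p=(\mathcal P_{p\to m}\xi_p^\sharp)^\flat$, where $\sharp,\flat$ are the musical isomorphisms and $\mathcal P_{p\to m}$ on the right is the parallel transport of tangent vectors. Subdifferentials are the classical ones on vector spaces: $\partial f_m(X)=\{\xi\in T_m^*\mathcal M: f_m(Y)\ge f_m(X)+\langle\xi,Y-X\rangle\ \forall Y\in T_m\mathcal M\}$ and, identifying the dual of $T_m^*\mathcal M$ with $T_m\mathcal M$, $\partial F_m^*(\xi_m)=\{X\in T_m\mathcal M: F_m^*(\eta_m)\ge F_m^*(\xi_m)+\langle\eta_m-\xi_m,X\rangle\ \forall\eta_m\in T_m^*\mathcal M\}$. *)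

theory Defs
  imports "HOL-Analysis.Analysis" "HOL-Library.Function_Algebras"
begin

text \<open>Functions into a real vector space, with the pointwise operations.\<close>

instantiation "fun" :: (type, real_vector) real_vector
begin

definition scaleR_fun :: "real \<Rightarrow> ('a \<Rightarrow> 'b) \<Rightarrow> 'a \<Rightarrow> 'b"
  where "scaleR_fun r f = (\<lambda>x. r *\<^sub>R f x)"

instance
  by standard (auto simp: scaleR_fun_def fun_eq_iff algebra_simps)

end


section \<open>Smooth manifolds\<close>

text \<open>Meant for open \<open>S\<close>, where it is the usual notion of a map of class \<open>C\<^sup>k\<close>.\<close>

primrec Ck_on :: "nat \<Rightarrow> ('e::real_normed_vector \<Rightarrow> 'f::real_normed_vector) \<Rightarrow> 'e set \<Rightarrow> bool" where
  "Ck_on 0 f S \<longleftrightarrow> continuous_on S f"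
| "Ck_on (Suc k) f S \<longleftrightarrow>
     (\<forall>x\<in>S. f differentiable (at x)) \<and> (\<forall>v. Ck_on k (\<lambda>x. frechet_derivative f (at x) v) S)"

definition smooth_on :: "('e::real_normed_vector \<Rightarrow> 'f::real_normed_vector) \<Rightarrow> 'e set \<Rightarrow> bool"
  where "smooth_on f S \<longleftrightarrow> (\<forall>k. Ck_on k f S)"

text \<open>A chart is a pair of its domain and its coordinate map; the latter is relevant on the
  domain only. The model space \<open>'e\<close> will be of sort \<open>{real_inner, heine_borel}\<close>: a real inner
  product space in which closed bounded sets are compact, that is, one of finite dimension. Unlike
  \<open>euclidean_space\<close> this sort does not exclude dimension 0.\<close>

type_synonym ('a, 'e) chart = "'a set \<times> ('a \<Rightarrow> 'e)"

text \<open>A tangent vector at \<open>p\<close> is represented by the family of its coordinate vectors in all charts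
  of the atlas around \<open>p\<close>. The value is fixed to 0 at all other pairs, so that the vector space
  operations are the pointwise ones. The point \<open>p\<close> is not part of the representation.\<close>

type_synonym ('a, 'e) tvec = "('a, 'e) chart \<Rightarrow> 'e"

type_synonym ('a, 'e) covec = "('a, 'e) tvec \<Rightarrow> real"

record ('a, 'e) rmfd =
  mtop :: "'a topology"
  atlas :: "('a, 'e) chart set"
  metric :: "'a \<Rightarrow> ('a, 'e) tvec \<Rightarrow> ('a, 'e) tvec \<Rightarrow> real"

definition chart_inv :: "('a, 'e) chart \<Rightarrow> 'e \<Rightarrow> 'a"
  where "chart_inv c = inv_into (fst c) (snd c)"

definition is_chart :: "'a topology \<Rightarrow> ('a, 'e::real_normed_vector) chart \<Rightarrow> bool" where
  "is_chart T c \<longleftrightarrow> openin T (fst c) \<and> open (snd c ` fst c) \<and>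
     homeomorphic_map (subtopology T (fst c)) (top_of_set (snd c ` fst c)) (snd c)"

definition charts_at :: "('a, 'e) rmfd \<Rightarrow> 'a \<Rightarrow> ('a, 'e) chart set"
  where "charts_at M p = {c \<in> atlas M. p \<in> fst c}"

definition smooth_manifold :: "('a, 'e::{real_inner,heine_borel}) rmfd \<Rightarrow> bool" where
  "smooth_manifold M \<longleftrightarrow>
     Hausdorff_space (mtop M) \<and> second_countable (mtop M) \<and>
     (\<forall>c\<in>atlas M. is_chart (mtop M) c) \<and>
     (\<forall>p\<in>topspace (mtop M). charts_at M p \<noteq> {}) \<and>
     (\<forall>c\<in>atlas M. \<forall>d\<in>atlas M. smooth_on (snd d \<circ> chart_inv c) (snd c ` (fst c \<inter> fst d)))"

text \<open>Differential of the transition map from \<open>c\<close> to \<open>d\<close> at the point with coordinates \<open>x\<close> in \<open>c\<close>.\<close>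

definition dtrans :: "('a, 'e::real_normed_vector) chart \<Rightarrow> ('a, 'e) chart \<Rightarrow> 'e \<Rightarrow> 'e \<Rightarrow> 'e"
  where "dtrans c d x = frechet_derivative (snd d \<circ> chart_inv c) (at x)"

definition tangent_space :: "('a, 'e::real_normed_vector) rmfd \<Rightarrow> 'a \<Rightarrow> ('a, 'e) tvec set" where
  "tangent_space M p =
     {X. (\<forall>c\<in>charts_at M p. \<forall>d\<in>charts_at M p. X d = dtrans c d (snd c p) (X c)) \<and>
         (\<forall>c. c \<notin> charts_at M p \<longrightarrow> X c = 0)}"

text \<open>The tangent vector at \<open>p\<close> with coordinate vector \<open>u\<close> in the chart \<open>c\<close>.\<close>

definition coord_vec :: "('a, 'e::real_normed_vector) rmfd \<Rightarrow> ('a, 'e) chart \<Rightarrow> 'a \<Rightarrow> 'e \<Rightarrow> ('a, 'e) tvec" where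
  "coord_vec M c p u = (\<lambda>d. if d \<in> charts_at M p then dtrans c d (snd c p) u else 0)"


section \<open>Riemannian metric and distance\<close>

text \<open>The metric in the chart \<open>c\<close>, as a bilinear form at the coordinates \<open>x\<close>.\<close>

definition metric_coord :: "('a, 'e::real_normed_vector) rmfd \<Rightarrow> ('a, 'e) chart \<Rightarrow> 'e \<Rightarrow> 'e \<Rightarrow> 'e \<Rightarrow> real" where
  "metric_coord M c x u v =
     (let p = chart_inv c x in metric M p (coord_vec M c p u) (coord_vec M c p v))"

definition riemannian_metric :: "('a, 'e::real_normed_vector) rmfd \<Rightarrow> bool" where
  "riemannian_metric M \<longleftrightarrow>
     (\<forall>p\<in>topspace (mtop M).
        (\<forall>X\<in>tangent_space M p. \<forall>Y\<in>tangent_space M p. metric M p X Y = metric M p Y X) \<and>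
        (\<forall>X\<in>tangent_space M p. \<forall>Y\<in>tangent_space M p. \<forall>Z\<in>tangent_space M p. \<forall>a b.
           metric M p (a *\<^sub>R X + b *\<^sub>R Y) Z = a * metric M p X Z + b * metric M p Y Z) \<and>
        (\<forall>X\<in>tangent_space M p. X \<noteq> 0 \<longrightarrow> metric M p X X > 0)) \<and>
     (\<forall>c\<in>atlas M. \<forall>u v. smooth_on (\<lambda>x. metric_coord M c x u v) (snd c ` fst c))"

definition riemannian_manifold :: "('a, 'e::{real_inner,heine_borel}) rmfd \<Rightarrow> bool" where
  "riemannian_manifold M \<longleftrightarrow>
     smooth_manifold M \<and> connected_space (mtop M) \<and> riemannian_metric M"

definition tnorm :: "('a, 'e) rmfd \<Rightarrow> 'a \<Rightarrow> ('a, 'e) tvec \<Rightarrow> real"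
  where "tnorm M p X = sqrt (metric M p X X)"

text \<open>Curves are parametrized over \<open>[0,1]\<close>, with one-sided derivatives at the end points.\<close>

definition velocity :: "('a, 'e::real_normed_vector) rmfd \<Rightarrow> (real \<Rightarrow> 'a) \<Rightarrow> real \<Rightarrow> ('a, 'e) tvec" where
  "velocity M \<gamma> t = (\<lambda>c. if c \<in> charts_at M (\<gamma> t)
     then vector_derivative (snd c \<circ> \<gamma>) (at t within {0..1}) else 0)"

definition continuous_curve :: "('a, 'e) rmfd \<Rightarrow> (real \<Rightarrow> 'a) \<Rightarrow> bool"
  where "continuous_curve M \<gamma> \<longleftrightarrow> continuous_map (top_of_set {0..1}) (mtop M) \<gamma>"

definition C1_piece :: "('a, 'e::real_normed_vector) rmfd \<Rightarrow> (real \<Rightarrow> 'a) \<Rightarrow> real \<Rightarrow> real \<Rightarrow> bool" where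
  "C1_piece M \<gamma> a b \<longleftrightarrow>
     (\<forall>c\<in>atlas M. let J = {t \<in> {a..b}. \<gamma> t \<in> fst c} in
        (\<forall>t\<in>J. (snd c \<circ> \<gamma>) differentiable (at t within {a..b})) \<and>
        continuous_on J (\<lambda>t. vector_derivative (snd c \<circ> \<gamma>) (at t within {a..b})))"

definition piecewise_C1_curve :: "('a, 'e::real_normed_vector) rmfd \<Rightarrow> (real \<Rightarrow> 'a) \<Rightarrow> bool" where
  "piecewise_C1_curve M \<gamma> \<longleftrightarrow> continuous_curve M \<gamma> \<and>
     (\<exists>S. finite S \<and> {0, 1} \<subseteq> S \<and> S \<subseteq> {0..1} \<and>
        (\<forall>a\<in>S. \<forall>b\<in>S. a < b \<and> S \<inter> {a<..<b} = {} \<longrightarrow> C1_piece M \<gamma> a b))"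

text \<open>At the finitely many break points \<open>velocity\<close> may be meaningless; this does not affect the
  integral.\<close>

definition curve_length :: "('a, 'e::real_normed_vector) rmfd \<Rightarrow> (real \<Rightarrow> 'a) \<Rightarrow> real"
  where "curve_length M \<gamma> = integral {0..1} (\<lambda>t. tnorm M (\<gamma> t) (velocity M \<gamma> t))"

definition riem_dist :: "('a, 'e::real_normed_vector) rmfd \<Rightarrow> 'a \<Rightarrow> 'a \<Rightarrow> real" where
  "riem_dist M p q = Inf {curve_length M \<gamma> | \<gamma>. piecewise_C1_curve M \<gamma> \<and> \<gamma> 0 = p \<and> \<gamma> 1 = q}"


section \<open>Levi-Civita connection along curves, geodesics\<close>

text \<open>Coordinate expression \<open>\<Gamma>\<^sup>k\<^sub>i\<^sub>j u\<^sup>i v\<^sup>j\<close> of the Levi-Civita connection, given by the Koszul formula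
  for constant coordinate fields.\<close>

definition christoffel :: "('a, 'e::real_normed_vector) rmfd \<Rightarrow> ('a, 'e) chart \<Rightarrow> 'e \<Rightarrow> 'e \<Rightarrow> 'e \<Rightarrow> 'e" where
  "christoffel M c x u v =
     (let D = (\<lambda>w y z. frechet_derivative (\<lambda>x'. metric_coord M c x' y z) (at x) w)
      in THE w. \<forall>z. 2 * metric_coord M c x w z = D u v z + D v u z - D z u v)"

text \<open>In each chart, the equation \<open>V' + \<Gamma>(\<gamma>', V) = 0\<close>. Around \<open>t\<close> the curve stays in the chart
  domain, so that the derivative only sees genuine coordinates of \<open>V\<close>.\<close>

definition parallel_field ::
  "('a, 'e::real_normed_vector) rmfd \<Rightarrow> (real \<Rightarrow> 'a) \<Rightarrow> (real \<Rightarrow> ('a, 'e) tvec) \<Rightarrow> bool" where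
  "parallel_field M \<gamma> V \<longleftrightarrow>
     (\<forall>t\<in>{0..1}. V t \<in> tangent_space M (\<gamma> t) \<and>
        (\<forall>c\<in>charts_at M (\<gamma> t).
           ((\<lambda>s. V s c) has_vector_derivative
              - christoffel M c (snd c (\<gamma> t)) (velocity M \<gamma> t c) (V t c)) (at t within {0..1})))"

definition geodesic :: "('a, 'e::real_normed_vector) rmfd \<Rightarrow> (real \<Rightarrow> 'a) \<Rightarrow> bool" where
  "geodesic M \<gamma> \<longleftrightarrow> continuous_curve M \<gamma> \<and>
     (\<forall>t\<in>{0..1}. \<forall>c\<in>charts_at M (\<gamma> t). (snd c \<circ> \<gamma>) differentiable (at t within {0..1})) \<and>
     parallel_field M \<gamma> (velocity M \<gamma>)"

text \<open>Geodesics have constant speed, so a shortest geodesic has a unique parametrization over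
  \<open>[0,1]\<close>; extensionality makes it unique as a function on the reals.\<close>

definition shortest_geodesic ::
  "('a, 'e::real_normed_vector) rmfd \<Rightarrow> 'a \<Rightarrow> 'a \<Rightarrow> (real \<Rightarrow> 'a) \<Rightarrow> bool" where
  "shortest_geodesic M p q \<gamma> \<longleftrightarrow> geodesic M \<gamma> \<and> \<gamma> \<in> extensional {0..1} \<and>
     \<gamma> 0 = p \<and> \<gamma> 1 = q \<and> curve_length M \<gamma> = riem_dist M p q"

definition strongly_convex :: "('a, 'e::real_normed_vector) rmfd \<Rightarrow> 'a set \<Rightarrow> bool" where
  "strongly_convex M C \<longleftrightarrow> C \<subseteq> topspace (mtop M) \<and>
     (\<forall>p\<in>C. \<forall>q\<in>C. (\<exists>!\<gamma>. shortest_geodesic M p q \<gamma>) \<and>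
        (\<forall>\<gamma>. shortest_geodesic M p q \<gamma> \<longrightarrow> \<gamma> ` {0..1} \<subseteq> C))"

text \<open>The manifold need not be complete, so \<open>exp\<^sub>p\<close> is a partial map: it is defined at \<open>X\<close> if the
  geodesic with initial velocity \<open>X\<close> exists up to time 1.\<close>

definition exp_dom :: "('a, 'e::real_normed_vector) rmfd \<Rightarrow> 'a \<Rightarrow> ('a, 'e) tvec set" where
  "exp_dom M p = {X \<in> tangent_space M p. \<exists>\<gamma>. geodesic M \<gamma> \<and> \<gamma> 0 = p \<and> velocity M \<gamma> 0 = X}"

definition exp_map :: "('a, 'e::real_normed_vector) rmfd \<Rightarrow> 'a \<Rightarrow> ('a, 'e) tvec \<Rightarrow> 'a" where
  "exp_map M p X = (THE q. \<exists>\<gamma>. geodesic M \<gamma> \<and> \<gamma> 0 = p \<and> velocity M \<gamma> 0 = X \<and> \<gamma> 1 = q)"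

definition log_dom :: "('a, 'e::real_normed_vector) rmfd \<Rightarrow> 'a set \<Rightarrow> 'a \<Rightarrow> ('a, 'e) tvec set" where
  "log_dom M C m = {X \<in> exp_dom M m. exp_map M m X \<in> C \<and> tnorm M m X = riem_dist M (exp_map M m X) m}"

definition log_map :: "('a, 'e::real_normed_vector) rmfd \<Rightarrow> 'a set \<Rightarrow> 'a \<Rightarrow> 'a \<Rightarrow> ('a, 'e) tvec"
  where "log_map M C m = the_inv_into (log_dom M C m) (exp_map M m)"


section \<open>Cotangent vectors and parallel transport\<close>

text \<open>Linear functionals on the tangent space, made unique as functions by the value 0 outside it.
  The duality pairing is function application.\<close>

definition cotangent_space :: "('a, 'e::real_normed_vector) rmfd \<Rightarrow> 'a \<Rightarrow> ('a, 'e) covec set" where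
  "cotangent_space M p =
     {\<xi>. (\<forall>X\<in>tangent_space M p. \<forall>Y\<in>tangent_space M p. \<forall>a b.
            \<xi> (a *\<^sub>R X + b *\<^sub>R Y) = a * \<xi> X + b * \<xi> Y) \<and>
         (\<forall>X. X \<notin> tangent_space M p \<longrightarrow> \<xi> X = 0)}"

definition flat :: "('a, 'e::real_normed_vector) rmfd \<Rightarrow> 'a \<Rightarrow> ('a, 'e) tvec \<Rightarrow> ('a, 'e) covec"
  where "flat M p X = (\<lambda>Y. if Y \<in> tangent_space M p then metric M p X Y else 0)"

definition sharp :: "('a, 'e::real_normed_vector) rmfd \<Rightarrow> 'a \<Rightarrow> ('a, 'e) covec \<Rightarrow> ('a, 'e) tvec"
  where "sharp M p = the_inv_into (tangent_space M p) (flat M p)"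

text \<open>Parallel transport along \<open>\<gamma>\<close> from \<open>\<gamma> 0\<close> to \<open>\<gamma> 1\<close>.\<close>

definition transport_along ::
  "('a, 'e::real_normed_vector) rmfd \<Rightarrow> (real \<Rightarrow> 'a) \<Rightarrow> ('a, 'e) tvec \<Rightarrow> ('a, 'e) tvec" where
  "transport_along M \<gamma> X = (THE Y. \<exists>V. parallel_field M \<gamma> V \<and> V 0 = X \<and> V 1 = Y)"

definition transport :: "('a, 'e::real_normed_vector) rmfd \<Rightarrow> 'a \<Rightarrow> 'a \<Rightarrow> ('a, 'e) tvec \<Rightarrow> ('a, 'e) tvec"
  where "transport M p m = transport_along M (THE \<gamma>. shortest_geodesic M p m \<gamma>)"

definition cotransport :: "('a, 'e::real_normed_vector) rmfd \<Rightarrow> 'a \<Rightarrow> 'a \<Rightarrow> ('a, 'e) covec \<Rightarrow> ('a, 'e) covec"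
  where "cotransport M p m \<xi> = flat M m (transport M p m (sharp M p \<xi>))"


section \<open>Convex analysis on tangent spaces\<close>

text \<open>Functions on \<open>C\<close> are total functions of which only the values on \<open>C\<close> matter; likewise for
  functions on \<open>T\<^sub>mM\<close> and \<open>T\<^sub>m\<^sup>*M\<close>.\<close>

definition proper_on :: "'a set \<Rightarrow> ('a \<Rightarrow> ereal) \<Rightarrow> bool"
  where "proper_on C F \<longleftrightarrow> (\<exists>x\<in>C. F x \<noteq> \<infinity>) \<and> (\<forall>x\<in>C. F x \<noteq> -\<infinity>)"

definition pullback ::
  "('a, 'e::real_normed_vector) rmfd \<Rightarrow> 'a set \<Rightarrow> 'a \<Rightarrow> ('a \<Rightarrow> ereal) \<Rightarrow> ('a, 'e) tvec \<Rightarrow> ereal" where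
  "pullback M C m F X = (if X \<in> log_dom M C m then F (exp_map M m X) else \<infinity>)"

text \<open>Used only for functions that do not take the value \<open>-\<infinity>\<close>, so that no sum \<open>\<infinity> - \<infinity>\<close> occurs.\<close>

definition convex_tan ::
  "('a, 'e::real_normed_vector) rmfd \<Rightarrow> 'a \<Rightarrow> (('a, 'e) tvec \<Rightarrow> ereal) \<Rightarrow> bool" where
  "convex_tan M m f \<longleftrightarrow>
     (\<forall>X\<in>tangent_space M m. \<forall>Y\<in>tangent_space M m. \<forall>t. 0 < t \<and> t < 1 \<longrightarrow>
        f ((1 - t) *\<^sub>R X + t *\<^sub>R Y) \<le> ereal (1 - t) * f X + ereal t * f Y)"

definition lsc_tan ::
  "('a, 'e::real_normed_vector) rmfd \<Rightarrow> 'a \<Rightarrow> (('a, 'e) tvec \<Rightarrow> ereal) \<Rightarrow> bool" where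
  "lsc_tan M m f \<longleftrightarrow>
     (\<forall>X\<in>tangent_space M m. \<forall>a. a < f X \<longrightarrow>
        (\<exists>\<delta>>0. \<forall>Y\<in>tangent_space M m. tnorm M m (Y - X) < \<delta> \<longrightarrow> a < f Y))"

definition fenchel_conj ::
  "('a, 'e::real_normed_vector) rmfd \<Rightarrow> 'a set \<Rightarrow> 'a \<Rightarrow> ('a \<Rightarrow> ereal) \<Rightarrow> ('a, 'e) covec \<Rightarrow> ereal" where
  "fenchel_conj M C m F \<xi> = (SUP X\<in>log_dom M C m. ereal (\<xi> X) - F (exp_map M m X))"

definition subdiff ::
  "('a, 'e::real_normed_vector) rmfd \<Rightarrow> 'a \<Rightarrow> (('a, 'e) tvec \<Rightarrow> ereal) \<Rightarrow> ('a, 'e) tvec \<Rightarrow> ('a, 'e) covec set" where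
  "subdiff M m f X =
     {\<xi> \<in> cotangent_space M m. \<forall>Y\<in>tangent_space M m. f Y \<ge> f X + ereal (\<xi> (Y - X))}"

definition subdiff_dual ::
  "('a, 'e::real_normed_vector) rmfd \<Rightarrow> 'a \<Rightarrow> (('a, 'e) covec \<Rightarrow> ereal) \<Rightarrow> ('a, 'e) covec \<Rightarrow> ('a, 'e) tvec set" where
  "subdiff_dual M m G \<xi> =
     {X \<in> tangent_space M m. \<forall>\<eta>\<in>cotangent_space M m. G \<eta> \<ge> G \<xi> + ereal ((\<eta> - \<xi>) X)}"

end

theory Submission
  imports Defs
begin

text \<open>The equivalence is the classical inversion rule \<open>\<xi> \<in> \<partial>f X \<longleftrightarrow> X \<in> \<partial>f\<^sup>* \<xi>\<close> for a proper, convex, lower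
  semicontinuous \<open>f\<close> on a finite-dimensional vector space, applied to the function \<open>f\<^sub>m\<close> on
  \<open>T\<^sub>mM\<close> at the point \<open>X = log\<^sub>m p\<close>. Since \<open>f\<^sub>m\<close> is \<open>\<infinity>\<close> off the domain of the exponential chart, its
  classical conjugate is \<open>F\<^sub>m\<^sup>*\<close>. From left to right the rule needs only the definitions. From right
  to left, \<open>X\<close> minimizes \<open>F\<^sub>m\<^sup>* - X\<close> at \<open>\<xi>\<close>, so the biconjugate of \<open>f\<^sub>m\<close> at \<open>X\<close> equals
  \<open>\<langle>\<xi>, X\<rangle> - F\<^sub>m\<^sup>* \<xi>\<close>. By the Fenchel-Moreau theorem this is \<open>f\<^sub>m X\<close>, which is the subgradient inequality.
  Lemma \<open>conjugate_minimum_imp_subgradient\<close> proves this by separating points from the epigraph.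

  The rule can only be applied if its two arguments live in the right spaces, and this is where the
  geometry enters.

  First, \<open>log\<^sub>m p\<close> has to be a tangent vector in \<open>\<L>\<^sub>C\<^sub>,\<^sub>m\<close>, and \<open>f\<^sub>m\<close> has to be proper; both follow if
  \<open>exp\<^sub>m\<close> maps \<open>\<L>\<^sub>C\<^sub>,\<^sub>m\<close> bijectively onto \<open>C\<close> (\<open>exp_map_bij_betw\<close>). For this, geodesics must be
  determined by their initial velocity (\<open>geodesic_unique\<close>, a Gronwall argument in charts), they must
  have constant speed (\<open>parallel_inner_constant\<close>, metric compatibility), and the distance must be
  symmetric on \<open>C\<close> (\<open>riem_dist_symmetric\<close>, by reversing geodesics).

  Second, the transported covector has to be a covector. The musical isomorphism \<open>\<sharp>\<close> exists by the
  representation of linear forms, and parallel transport exists because the linear parallel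
  transport equation can be solved in each chart (\<open>linear_ode_local_existence\<close>), because a field which
  is parallel in one chart is parallel in all charts (\<open>parallel_chart_change\<close>, from the
  transformation rule \<open>christoffel_change\<close>), and because local solutions can be joined
  (\<open>parallel_existence\<close>).

  The model space has no distinguished basis, but it has a finite orthonormal one, since its unit
  ball is compact. All finite-dimensional arguments are expansions in such a basis.\<close>

section \<open>Finite-dimensional inner product spaces\<close>

text \<open>The closed unit ball is compact, so it lies within distance \<open>1/2\<close> of a finite set \<open>N\<close>. An
  orthonormal basis of the span of \<open>N\<close> is a basis of the whole space: a unit vector orthogonal to the
  span would have distance at least 1 from every point of \<open>N\<close>.\<close>

lemma ex_finite_orthonormal_basis:
  "\<exists>B::'e::{real_inner,heine_borel} set. finite B \<and>
     (\<forall>b\<in>B. \<forall>c\<in>B. b \<bullet> c = (if b = c then 1 else 0)) \<and> (\<forall>x. (\<Sum>b\<in>B. (x \<bullet> b) *\<^sub>R b) = x)"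
proof -
  have "compact (cball (0::'e) 1)" by simp
  then obtain N where N: "finite N" "cball (0::'e) 1 \<subseteq> (\<Union>n\<in>N. ball n (1/2))"
    unfolding compact_eq_totally_bounded by (metis half_gt_zero_iff zero_less_one)
  obtain C where C: "finite C" "span C = span N" "pairwise orthogonal C"
    using basis_orthogonal[OF N(1)] by blast
  define B where "B = (\<lambda>x. x /\<^sub>R norm x) ` (C - {0})"
  have B: "finite B" using C by (simp add: B_def)
  have on: "b \<bullet> c = (if b = c then 1 else 0)" if bc: "b \<in> B" "c \<in> B" for b c
  proof -
    obtain b' c' where b': "b' \<in> C" "c' \<in> C" "b' \<noteq> 0" "c' \<noteq> 0" "b = b' /\<^sub>R norm b'" "c = c' /\<^sub>R norm c'"
      using bc by (auto simp: B_def)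
    show ?thesis
    proof (cases "b' = c'")
      case True
      then show ?thesis using b' by (simp add: dot_square_norm power2_eq_square)
    next
      case False
      then have z: "b' \<bullet> c' = 0" using C(3) b' by (auto simp: pairwise_def orthogonal_def)
      then have "b \<bullet> c = 0" using b' by simp
      moreover have "b \<noteq> c"
      proof
        assume "b = c"
        then have "b \<bullet> b = 0" using \<open>b \<bullet> c = 0\<close> by simp
        then show False using b' by simp
      qed
      ultimately show ?thesis by simp
    qed
  qed
  have "(\<Sum>b\<in>B. (x \<bullet> b) *\<^sub>R b) = x" for x
  proof (rule ccontr)
    define r where "r = x - (\<Sum>b\<in>B. (x \<bullet> b) *\<^sub>R b)"
    assume "(\<Sum>b\<in>B. (x \<bullet> b) *\<^sub>R b) \<noteq> x"
    then have r0: "r \<noteq> 0" by (simp add: r_def)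
    have rb: "r \<bullet> b = 0" if "b \<in> B" for b
    proof -
      have "(\<Sum>c\<in>B. (x \<bullet> c) *\<^sub>R c) \<bullet> b = (\<Sum>c\<in>B. if c = b then x \<bullet> c else 0)"
        unfolding inner_sum_left by (rule sum.cong) (auto simp: on that)
      then show ?thesis using B that by (simp add: r_def inner_diff_left)
    qed
    have rc: "r \<bullet> c = 0" if "c \<in> C" for c
    proof (cases "c = 0")
      case False
      then have "r \<bullet> (c /\<^sub>R norm c) = 0" using that by (intro rb) (auto simp: B_def)
      then show ?thesis using False by simp
    qed simp
    have rn: "r \<bullet> n = 0" if "n \<in> N" for n
    proof -
      have "n \<in> span C" using that C(2) by (simp add: span_base)
      then have "orthogonal r n" by (rule orthogonal_to_span) (simp add: rc orthogonal_def)
      then show ?thesis by (simp add: orthogonal_def)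
    qed
    have "r /\<^sub>R norm r \<in> cball 0 1" using r0 by simp
    then obtain n where n: "n \<in> N" "dist n (r /\<^sub>R norm r) < 1/2" using N(2) by (meson UN_E mem_ball subsetD)
    have "(norm (n - r /\<^sub>R norm r))\<^sup>2 = (norm n)\<^sup>2 + 1"
    proof -
      define e where "e = r /\<^sub>R norm r"
      have "n \<bullet> e = 0" "e \<bullet> e = 1"
        using rn[OF n(1)] r0 by (simp_all add: e_def inner_commute dot_square_norm power2_eq_square)
      then show ?thesis
        unfolding e_def[symmetric] by (simp add: power2_norm_eq_inner inner_diff inner_commute)
    qed
    then have "1 \<le> (norm (n - r /\<^sub>R norm r))\<^sup>2" by simp
    then have "1 \<le> norm (n - r /\<^sub>R norm r)"
      by (metis norm_ge_zero one_le_power power2_nonneg_ge_1_iff abs_norm_cancel abs_square_le_1 linorder_not_le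
          power_less_one_iff zero_less_numeral)
    then show False using n(2) by (simp add: dist_norm)
  qed
  then show ?thesis using B on by blast
qed

definition onb :: "'e::{real_inner,heine_borel} set" where
  "onb = (SOME B. finite B \<and> (\<forall>b\<in>B. \<forall>c\<in>B. b \<bullet> c = (if b = c then 1 else 0)) \<and>
     (\<forall>x. (\<Sum>b\<in>B. (x \<bullet> b) *\<^sub>R b) = x))"

lemma finite_onb [simp]: "finite onb"
  and inner_onb: "b \<in> onb \<Longrightarrow> c \<in> onb \<Longrightarrow> b \<bullet> c = (if b = c then 1 else 0)"
  and onb_expansion: "(\<Sum>b\<in>onb. (x \<bullet> b) *\<^sub>R b) = x"
  using someI_ex[OF ex_finite_orthonormal_basis] unfolding onb_def[symmetric] by blast+

lemma norm_onb [simp]: "b \<in> onb \<Longrightarrow> norm b = 1"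
  by (simp add: norm_eq_sqrt_inner inner_onb)

lemma abs_inner_onb_le: "b \<in> onb \<Longrightarrow> \<bar>x \<bullet> b\<bar> \<le> norm x"
  using Cauchy_Schwarz_ineq2[of x b] by simp

lemma onb_eqI: "(\<And>b. b \<in> onb \<Longrightarrow> x \<bullet> b = y \<bullet> b) \<Longrightarrow> x = y"
  by (metis (no_types, lifting) onb_expansion sum.cong)

lemma sum_onb_inner: "c \<in> onb \<Longrightarrow> (\<Sum>b\<in>onb. k b *\<^sub>R b) \<bullet> c = k c"
proof -
  assume c: "c \<in> onb"
  have "(\<Sum>b\<in>onb. k b *\<^sub>R b) \<bullet> c = (\<Sum>b\<in>onb. if b = c then k b else 0)"
    unfolding inner_sum_left by (rule sum.cong) (auto simp: inner_onb c)
  then show ?thesis using c by simp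
qed

lemma linear_onb_expansion:
  assumes "linear f" shows "f x = (\<Sum>b\<in>onb. (x \<bullet> b) *\<^sub>R f b)"
proof -
  have "f x = f (\<Sum>b\<in>onb. (x \<bullet> b) *\<^sub>R b)" by (simp add: onb_expansion)
  also have "\<dots> = (\<Sum>b\<in>onb. (x \<bullet> b) *\<^sub>R f b)"
    by (simp add: linear_sum[OF assms] linear_scale[OF assms])
  finally show ?thesis .
qed

lemma linear_onb_bound:
  fixes f :: "'e::{real_inner,heine_borel} \<Rightarrow> 'b::real_normed_vector"
  assumes "linear f" "\<And>b. b \<in> onb \<Longrightarrow> norm (f b) \<le> k b"
  shows "norm (f u) \<le> (\<Sum>b\<in>onb. k b) * norm u"
proof -
  have "norm (f u) \<le> (\<Sum>b\<in>onb. norm ((u \<bullet> b) *\<^sub>R f b))"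
    by (subst linear_onb_expansion[OF assms(1)]) (rule norm_sum)
  also have "\<dots> \<le> (\<Sum>b\<in>onb. norm u * k b)"
    by (intro sum_mono) (auto intro!: mult_mono assms(2) abs_inner_onb_le)
  also have "\<dots> = (\<Sum>b\<in>onb. k b) * norm u" by (simp add: sum_distrib_left[symmetric] mult.commute)
  finally show ?thesis .
qed

text \<open>The dimension argument is that of the abstract locale of finite-dimensional vector spaces, which
  only has to be given the basis \<open>onb\<close>.\<close>

lemma linear_injective_imp_surjective_fd:
  fixes f :: "'e::{real_inner,heine_borel} \<Rightarrow> 'e"
  assumes "linear f" "inj f" shows "surj f"
proof -
  have "0 \<notin> (onb::'e set)" using norm_onb by fastforce
  then have ind: "independent (onb::'e set)"
    by (intro pairwise_orthogonal_independent) (auto simp: pairwise_def orthogonal_def inner_onb)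
  have "x \<in> span onb" for x :: 'e
    using span_sum[of onb "\<lambda>b. (x \<bullet> b) *\<^sub>R b" onb] by (simp add: onb_expansion span_base span_scale)
  then have sp: "span (onb::'e set) = UNIV" by auto
  interpret fd: finite_dimensional_vector_space "scaleR :: real \<Rightarrow> 'e \<Rightarrow> 'e" onb
    by unfold_locales (use ind sp in \<open>simp_all add: dependent_raw_def span_raw_def\<close>)
  show ?thesis using fd.linear_inj_imp_surj assms by (simp add: linear_def)
qed

text \<open>Representation of linear forms by a positive definite bilinear form that may differ from the
  inner product. The map sending \<open>w\<close> to the vector with coordinates \<open>g w b\<close> is injective by
  definiteness, hence surjective. The lemma yields the Christoffel symbols, the musical
  isomorphisms and the coordinates of covectors.\<close>

lemma ex1_representing_vector:
  fixes g :: "'e::{real_inner,heine_borel} \<Rightarrow> 'e \<Rightarrow> real"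
  assumes lin1: "\<And>z. linear (\<lambda>w. g w z)" and lin2: "\<And>w. linear (g w)"
    and pos: "\<And>w. w \<noteq> 0 \<Longrightarrow> g w w > 0" and l: "linear l"
  shows "\<exists>!w. \<forall>z. g w z = l z"
proof -
  define T where "T w = (\<Sum>b\<in>onb. g w b *\<^sub>R b)" for w
  have Tb: "T w \<bullet> b = g w b" if "b \<in> onb" for w b by (simp add: T_def sum_onb_inner that)
  have lT: "linear T"
    by (rule linearI; rule onb_eqI)
       (simp_all add: Tb inner_add_left linear_add[OF lin1] linear_scale[OF lin1])
  have key: "g w z = l z" if "\<And>b. b \<in> onb \<Longrightarrow> g w b = l b" for w z
    unfolding linear_onb_expansion[OF lin2, of w z] linear_onb_expansion[OF l, of z]
    by (rule sum.cong) (simp_all add: that)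
  have "w = 0" if "T w = 0" for w
  proof (rule ccontr)
    assume "w \<noteq> 0"
    have "g w b = 0" if "b \<in> onb" for b using Tb[OF that, of w] \<open>T w = 0\<close> by simp
    then have "g w w = 0" by (subst linear_onb_expansion[OF lin2]) simp
    with pos[OF \<open>w \<noteq> 0\<close>] show False by simp
  qed
  then have "inj T" using lT by (simp add: linear_injective_0)
  then have "surj T" by (rule linear_injective_imp_surjective_fd[OF lT])
  then obtain w where "T w = (\<Sum>b\<in>onb. l b *\<^sub>R b)" by (metis surjD)
  then have "g w b = l b" if "b \<in> onb" for b using Tb[OF that, of w] that by (simp add: sum_onb_inner)
  then have ex: "\<forall>z. g w z = l z" using key by blast
  have "w' = w" if "\<forall>z. g w' z = l z" for w'
  proof (rule ccontr)
    assume "w' \<noteq> w"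
    then have "g (w' - w) (w' - w) > 0" by (intro pos) simp
    then show False using linear_diff[OF lin1] that ex by simp
  qed
  with ex show ?thesis by blast
qed

section \<open>Derivatives of families of linear maps\<close>

text \<open>A family of linear maps that is differentiable in its parameter for each fixed argument is jointly
  differentiable, because expanding the argument in the basis turns \<open>A x u\<close> into a finite sum of
  products of functions of \<open>x\<close> and of \<open>u\<close>. This gives the product rule for metrics and for
  differentials of transition maps along curves.\<close>

lemma has_derivative_linear_family:
  fixes A :: "'x::real_normed_vector \<Rightarrow> 'e::{real_inner,heine_borel} \<Rightarrow> 'b::real_normed_vector"
  assumes S: "open S" "f z \<in> S" and z: "z \<in> Z" and lin: "\<And>x. x \<in> S \<Longrightarrow> linear (A x)"
    and D: "\<And>u. ((\<lambda>x. A x u) has_derivative D u) (at (f z))"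
    and f: "(f has_derivative f') (at z within Z)" and g: "(g has_derivative g') (at z within Z)"
  shows "((\<lambda>y. A (f y) (g y)) has_derivative (\<lambda>h. D (g z) (f' h) + A (f z) (g' h))) (at z within Z)"
proof -
  have Dl: "D u k = (\<Sum>b\<in>onb. (u \<bullet> b) *\<^sub>R D b k)" for u k
  proof -
    have "((\<lambda>x. \<Sum>b\<in>onb. (u \<bullet> b) *\<^sub>R A x b) has_derivative (\<lambda>k. \<Sum>b\<in>onb. (u \<bullet> b) *\<^sub>R D b k)) (at (f z))"
      by (intro has_derivative_sum has_derivative_scaleR_right D)
    then have "((\<lambda>x. A x u) has_derivative (\<lambda>k. \<Sum>b\<in>onb. (u \<bullet> b) *\<^sub>R D b k)) (at (f z))"
      by (rule has_derivative_transform_within_open[OF _ S]) (metis lin linear_onb_expansion)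
    then show ?thesis using has_derivative_unique[OF D] by metis
  qed
  have "((\<lambda>y. \<Sum>b\<in>onb. (g y \<bullet> b) *\<^sub>R A (f y) b) has_derivative
     (\<lambda>h. \<Sum>b\<in>onb. (g z \<bullet> b) *\<^sub>R D b (f' h) + (g' h \<bullet> b) *\<^sub>R A (f z) b)) (at z within Z)"
    by (intro has_derivative_sum has_derivative_scaleR has_derivative_inner_left g
        has_derivative_compose[OF f D])
  then have 1: "((\<lambda>y. \<Sum>b\<in>onb. (g y \<bullet> b) *\<^sub>R A (f y) b) has_derivative
     (\<lambda>h. D (g z) (f' h) + A (f z) (g' h))) (at z within Z)"
    by (subst Dl, subst linear_onb_expansion[OF lin[OF S(2)]]) (simp add: sum.distrib)
  have "(f \<longlongrightarrow> f z) (at z within Z)"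
    using has_derivative_continuous[OF f] by (simp add: continuous_within)
  then have "\<forall>\<^sub>F y in at z within Z. f y \<in> S" using S by (rule topological_tendstoD)
  then have "\<forall>\<^sub>F y in at z within Z. A (f y) (g y) = (\<Sum>b\<in>onb. (g y \<bullet> b) *\<^sub>R A (f y) b)"
    by eventually_elim (metis lin linear_onb_expansion)
  then have "\<forall>\<^sub>F y in at z within Z. (\<Sum>b\<in>onb. (g y \<bullet> b) *\<^sub>R A (f y) b) = A (f y) (g y)"
    by eventually_elim simp
  moreover have "(\<Sum>b\<in>onb. (g z \<bullet> b) *\<^sub>R A (f z) b) = A (f z) (g z)"
    by (rule linear_onb_expansion[OF lin[OF S(2)], symmetric])
  ultimately show ?thesis
    using 1 z by (intro has_derivative_transform_eventually[OF 1])
qed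

lemma linear_family_derivative:
  fixes A :: "'x::real_normed_vector \<Rightarrow> 'e::{real_inner,heine_borel} \<Rightarrow> 'b::real_normed_vector"
  assumes S: "open S" "x \<in> S" and lin: "\<And>x. x \<in> S \<Longrightarrow> linear (A x)"
    and D: "\<And>u. ((\<lambda>x. A x u) has_derivative D u) (at x)"
  shows "linear (\<lambda>u. D u k)"
proof (rule linearI)
  fix u v
  have "((\<lambda>x. A x u + A x v) has_derivative (\<lambda>k. D u k + D v k)) (at x)"
    by (intro has_derivative_add D)
  then have "((\<lambda>x. A x (u + v)) has_derivative (\<lambda>k. D u k + D v k)) (at x)"
    by (rule has_derivative_transform_within_open[OF _ S]) (simp add: linear_add[OF lin])
  then show "D (u + v) k = D u k + D v k" using has_derivative_unique[OF D] by metis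
next
  fix c u
  have "((\<lambda>x. c *\<^sub>R A x u) has_derivative (\<lambda>k. c *\<^sub>R D u k)) (at x)"
    by (intro has_derivative_scaleR_right D)
  then have "((\<lambda>x. A x (c *\<^sub>R u)) has_derivative (\<lambda>k. c *\<^sub>R D u k)) (at x)"
    by (rule has_derivative_transform_within_open[OF _ S]) (simp add: linear_scale[OF lin])
  then show "D (c *\<^sub>R u) k = c *\<^sub>R D u k" using has_derivative_unique[OF D] by metis
qed

section \<open>Smooth maps\<close>

lemma smooth_on_has_derivative:
  assumes "smooth_on f S" "x \<in> S" shows "(f has_derivative frechet_derivative f (at x)) (at x)"
proof -
  have "Ck_on (Suc 0) f S" using assms(1) by (simp only: smooth_on_def)
  then show ?thesis using assms(2) by (simp add: frechet_derivative_works)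
qed

lemma smooth_on_frechet_derivative:
  assumes "smooth_on f S" shows "smooth_on (\<lambda>x. frechet_derivative f (at x) v) S"
  unfolding smooth_on_def
proof
  fix k
  have "Ck_on (Suc k) f S" using assms by (simp only: smooth_on_def)
  then show "Ck_on k (\<lambda>x. frechet_derivative f (at x) v) S" by simp
qed

lemma smooth_on_imp_continuous_on: "smooth_on f S \<Longrightarrow> continuous_on S f"
  by (metis smooth_on_def Ck_on.simps(1))

lemma continuous_on_compact_bound:
  fixes f :: "'a::topological_space \<Rightarrow> 'b::real_normed_vector"
  assumes "compact K" "continuous_on K f"
  shows "\<exists>B\<ge>0. \<forall>x\<in>K. norm (f x) \<le> B"
proof -
  have "bounded (f ` K)" using assms by (intro compact_imp_bounded compact_continuous_image)
  then obtain B where "\<forall>y\<in>f ` K. norm y \<le> B" by (auto simp: bounded_iff)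
  then show ?thesis by (intro exI[of _ "max B 0"]) (auto simp: le_max_iff_disj)
qed

text \<open>The partial derivatives are continuous and hence bounded on the compact set; the mean value
  inequality applies because the set is convex.\<close>

lemma smooth_on_lipschitz:
  fixes f :: "'e::{real_inner,heine_borel} \<Rightarrow> 'b::real_normed_vector"
  assumes f: "smooth_on f S" and K: "compact K" "convex K" "K \<subseteq> S"
  shows "\<exists>L\<ge>0. \<forall>x\<in>K. \<forall>y\<in>K. norm (f x - f y) \<le> L * norm (x - y)"
proof -
  have "\<exists>B\<ge>0. \<forall>x\<in>K. norm (frechet_derivative f (at x) b) \<le> B" for b
    using smooth_on_imp_continuous_on[OF smooth_on_frechet_derivative[OF f]] K
    by (intro continuous_on_compact_bound) (auto intro: continuous_on_subset)
  then obtain B where B: "\<And>b. B b \<ge> 0" "\<And>b x. x \<in> K \<Longrightarrow> norm (frechet_derivative f (at x) b) \<le> B b"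
    by metis
  define L where "L = (\<Sum>b\<in>onb. B b)"
  have "L \<ge> 0" by (simp add: L_def sum_nonneg B)
  have on: "onorm (frechet_derivative f (at x)) \<le> L" if x: "x \<in> K" for x
  proof (rule onorm_bound[OF \<open>L \<ge> 0\<close>])
    fix u
    have lin: "linear (frechet_derivative f (at x))"
      using smooth_on_has_derivative[OF f] x K(3) by (meson has_derivative_linear subsetD)
    show "norm (frechet_derivative f (at x) u) \<le> L * norm u"
      unfolding L_def by (rule linear_onb_bound[OF lin B(2)[OF x]])
  qed
  have "norm (f x - f y) \<le> L * norm (x - y)" if "x \<in> K" "y \<in> K" for x y
    by (rule differentiable_bound[OF K(2) _ _ that, where f' = "\<lambda>x. frechet_derivative f (at x)"])
       (use K(3) on in \<open>auto intro!: has_derivative_at_withinI smooth_on_has_derivative[OF f]\<close>)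
  with \<open>L \<ge> 0\<close> show ?thesis by blast
qed

text \<open>Two applications of the mean value theorem, in direction \<open>u\<close> and then in direction \<open>v\<close>. The inner
  product with \<open>z\<close> reduces a vector-valued map to a real function.\<close>

lemma second_difference_mvt:
  fixes f :: "'e::{real_inner,heine_borel} \<Rightarrow> 'b::real_inner"
  assumes f: "smooth_on f S" and S: "ball x r \<subseteq> S" and s: "0 < s" "s * (norm u + norm v) < r"
  obtains y where "dist y x < r" "norm (y - x) \<le> s * (norm u + norm v)"
    "(f (x + s *\<^sub>R u + s *\<^sub>R v) - f (x + s *\<^sub>R u) - f (x + s *\<^sub>R v) + f x) \<bullet> z
     = s * s * (frechet_derivative (\<lambda>x. frechet_derivative f (at x) u) (at y) v \<bullet> z)"
proof -
  define g where "g = (\<lambda>x. frechet_derivative f (at x) u)"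
  have g: "smooth_on g S" unfolding g_def by (rule smooth_on_frechet_derivative[OF f])
  have nb: "norm (a *\<^sub>R u + b *\<^sub>R v) \<le> s * (norm u + norm v)" if "0 \<le> a" "a \<le> s" "0 \<le> b" "b \<le> s" for a b
  proof -
    have "norm (a *\<^sub>R u + b *\<^sub>R v) \<le> a * norm u + b * norm v"
      using norm_triangle_ineq[of "a *\<^sub>R u" "b *\<^sub>R v"] that by simp
    also have "\<dots> \<le> s * norm u + s * norm v" using that by (intro add_mono mult_right_mono) auto
    finally show ?thesis by (simp add: algebra_simps)
  qed
  have inS: "x + a *\<^sub>R u + b *\<^sub>R v \<in> S" if "0 \<le> a" "a \<le> s" "0 \<le> b" "b \<le> s" for a b
  proof -
    have "dist x (x + a *\<^sub>R u + b *\<^sub>R v) < r"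
      using nb[OF that] s(2) by (simp add: dist_norm norm_minus_commute add.assoc add.commute)
    then show ?thesis using S by (auto simp: subset_iff)
  qed
  have lin: "linear (frechet_derivative h (at y))" if "smooth_on h S" "y \<in> S" for h :: "'e \<Rightarrow> 'b" and y
    using smooth_on_has_derivative[OF that] by (rule has_derivative_linear)
  have line: "((\<lambda>a. h (c + a *\<^sub>R w) \<bullet> z) has_real_derivative frechet_derivative h (at (c + a *\<^sub>R w)) w \<bullet> z) (at a)"
    if "smooth_on h S" "c + a *\<^sub>R w \<in> S" for h :: "'e \<Rightarrow> 'b" and c w a
  proof -
    have "((\<lambda>a. h (c + a *\<^sub>R w)) has_derivative (\<lambda>k. frechet_derivative h (at (c + a *\<^sub>R w)) (k *\<^sub>R w))) (at a)"
      by (rule has_derivative_compose[of "\<lambda>a. c + a *\<^sub>R w" "\<lambda>k. k *\<^sub>R w" a UNIV h])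
         (use smooth_on_has_derivative[OF that] in \<open>auto intro!: derivative_eq_intros\<close>)
    then have "((\<lambda>a. h (c + a *\<^sub>R w) \<bullet> z) has_derivative
        (\<lambda>k. frechet_derivative h (at (c + a *\<^sub>R w)) (k *\<^sub>R w) \<bullet> z)) (at a)"
      by (rule has_derivative_inner_left)
    then show ?thesis unfolding has_field_derivative_def
      by (rule has_derivative_eq_rhs) (simp add: fun_eq_iff linear_scale[OF lin[OF that]] mult.commute)
  qed
  define p where "p a = f (x + s *\<^sub>R v + a *\<^sub>R u) \<bullet> z - f (x + a *\<^sub>R u) \<bullet> z" for a
  have "(p has_real_derivative (g (x + s *\<^sub>R v + a *\<^sub>R u) \<bullet> z - g (x + a *\<^sub>R u) \<bullet> z)) (at a)" if "0 \<le> a" "a \<le> s" for a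
    unfolding p_def g_def using inS[OF that, of s] inS[OF that, of 0] s(1)
    by (intro DERIV_diff line f) (auto simp: algebra_simps)
  then obtain a where a: "0 < a" "a < s"
    "p s - p 0 = (s - 0) * (g (x + s *\<^sub>R v + a *\<^sub>R u) \<bullet> z - g (x + a *\<^sub>R u) \<bullet> z)"
    using MVT2[OF s(1), of p "\<lambda>a. g (x + s *\<^sub>R v + a *\<^sub>R u) \<bullet> z - g (x + a *\<^sub>R u) \<bullet> z"] by auto
  define q where "q b = g (x + a *\<^sub>R u + b *\<^sub>R v) \<bullet> z" for b
  have "(q has_real_derivative frechet_derivative g (at (x + a *\<^sub>R u + b *\<^sub>R v)) v \<bullet> z) (at b)"
    if "0 \<le> b" "b \<le> s" for b
    unfolding q_def using inS[of a b] a that by (intro line g) auto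
  then obtain b where b: "0 < b" "b < s"
    "q s - q 0 = (s - 0) * (frechet_derivative g (at (x + a *\<^sub>R u + b *\<^sub>R v)) v \<bullet> z)"
    using MVT2[OF s(1), of q "\<lambda>b. frechet_derivative g (at (x + a *\<^sub>R u + b *\<^sub>R v)) v \<bullet> z"] by auto
  have nn: "norm (x + a *\<^sub>R u + b *\<^sub>R v - x) \<le> s * (norm u + norm v)"
    using nb[of a b] a b by (simp add: algebra_simps)
  have "(f (x + s *\<^sub>R u + s *\<^sub>R v) - f (x + s *\<^sub>R u) - f (x + s *\<^sub>R v) + f x) \<bullet> z = p s - p 0"
    by (simp add: p_def inner_simps algebra_simps)
  also have "\<dots> = s * (q s - q 0)" unfolding a(3) q_def by (simp add: algebra_simps)
  also have "\<dots> = s * s * (frechet_derivative g (at (x + a *\<^sub>R u + b *\<^sub>R v)) v \<bullet> z)" unfolding b(3) by simp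
  finally show thesis
    using nn s(2) by (intro that[of "x + a *\<^sub>R u + b *\<^sub>R v"]) (auto simp: g_def dist_norm)
qed

text \<open>The second difference of \<open>second_difference_mvt\<close> is symmetric in \<open>u\<close> and \<open>v\<close>, so values of the two
  mixed derivatives agree at points arbitrarily close to \<open>x\<close>. By continuity they agree at \<open>x\<close>.\<close>

lemma second_derivative_symmetric:
  fixes f :: "'e::{real_inner,heine_borel} \<Rightarrow> 'b::real_inner"
  assumes f: "smooth_on f S" and S: "open S" "x \<in> S"
  shows "frechet_derivative (\<lambda>x. frechet_derivative f (at x) u) (at x) v =
         frechet_derivative (\<lambda>x. frechet_derivative f (at x) v) (at x) u"
proof (rule ccontr)
  define D where "D u v y = frechet_derivative (\<lambda>x. frechet_derivative f (at x) u) (at y) v" for u v y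
  define z where "z = D u v x - D v u x"
  have cont: "continuous_on S (\<lambda>y. D u v y \<bullet> z)" for u v
    unfolding D_def
    by (intro continuous_intros smooth_on_imp_continuous_on smooth_on_frechet_derivative f)
  assume "\<not> ?thesis"
  then have "z \<noteq> 0" by (simp add: D_def z_def)
  then have "D u v x \<bullet> z \<noteq> D v u x \<bullet> z" by (metis z_def inner_diff_left inner_eq_zero_iff right_minus_eq)
  then have e: "0 < dist (D u v x \<bullet> z) (D v u x \<bullet> z) / 2" (is "0 < ?e") by simp
  obtain r where r: "r > 0" "ball x r \<subseteq> S" using S open_contains_ball by blast
  have "\<exists>d>0. \<forall>y\<in>S. dist y x < d \<longrightarrow> dist (D u' v' y \<bullet> z) (D u' v' x \<bullet> z) < ?e" for u' v'
    using cont[of u' v'] e S(2) unfolding continuous_on_iff by meson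
  then obtain d where d: "\<And>u' v'. d u' v' > 0"
    "\<And>u' v' y. y \<in> S \<Longrightarrow> dist y x < d u' v' \<Longrightarrow> dist (D u' v' y \<bullet> z) (D u' v' x \<bullet> z) < ?e" by metis
  \<comment> \<open>The step \<open>s\<close> is so small that both intermediate points stay within \<open>m\<close> of \<open>x\<close>;
      adding 1 to the denominator covers \<open>u = v = 0\<close>.\<close>
  define m where "m = min r (min (d u v) (d v u))"
  define s where "s = m / (norm u + norm v + 1) / 2"
  have m: "m > 0" using r d by (simp add: m_def)
  have n: "0 < norm u + norm v + 1" by (simp add: add_nonneg_pos)
  have s: "0 < s" using m n by (simp add: s_def)
  have "s * (norm u + norm v) \<le> s * (norm u + norm v + 1)" using s by (intro mult_left_mono) auto
  also have "\<dots> = m / 2" using n by (simp only: s_def) (simp add: divide_simps)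
  finally have sm: "s * (norm u + norm v) < m" using m by linarith
  then have sr: "s * (norm u + norm v) < r" by (simp add: m_def)
  obtain y where y: "dist y x < r" "norm (y - x) \<le> s * (norm u + norm v)"
    "(f (x + s *\<^sub>R u + s *\<^sub>R v) - f (x + s *\<^sub>R u) - f (x + s *\<^sub>R v) + f x) \<bullet> z = s * s * (D u v y \<bullet> z)"
    unfolding D_def by (rule second_difference_mvt[OF f r(2) s sr])
  from sr have sr': "s * (norm v + norm u) < r" by (simp add: add.commute)
  obtain y' where y': "dist y' x < r" "norm (y' - x) \<le> s * (norm v + norm u)"
    "(f (x + s *\<^sub>R v + s *\<^sub>R u) - f (x + s *\<^sub>R v) - f (x + s *\<^sub>R u) + f x) \<bullet> z = s * s * (D v u y' \<bullet> z)"
    unfolding D_def by (rule second_difference_mvt[OF f r(2) s sr'])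
  have "s * s * (D u v y \<bullet> z) = s * s * (D v u y' \<bullet> z)"
    unfolding y(3)[symmetric] y'(3)[symmetric] by (simp add: inner_simps algebra_simps)
  then have eq: "D u v y \<bullet> z = D v u y' \<bullet> z" using s by simp
  have "y \<in> S" "y' \<in> S" using y y' r by (auto simp: dist_commute subset_iff)
  moreover have "dist y x < d u v" "dist y' x < d v u"
    using y(2) y'(2) sm by (auto simp: dist_norm m_def add.commute)
  ultimately have "dist (D u v y \<bullet> z) (D u v x \<bullet> z) < ?e" "dist (D v u y' \<bullet> z) (D v u x \<bullet> z) < ?e"
    using d by auto
  then show False unfolding eq by (simp add: dist_real_def) argo
qed

section \<open>Ordinary differential equations\<close>

text \<open>The function \<open>e\<^sup>-\<^sup>2\<^sup>L\<^sup>t \<parallel>z1 t - z2 t\<parallel>\<^sup>2\<close> is nonincreasing and starts at 0.\<close>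

lemma gronwall_unique:
  fixes z1 z2 :: "real \<Rightarrow> 'z::real_inner"
  assumes 1: "\<And>t. t \<in> {a..b} \<Longrightarrow> (z1 has_vector_derivative f1 t) (at t within {a..b})"
    and 2: "\<And>t. t \<in> {a..b} \<Longrightarrow> (z2 has_vector_derivative f2 t) (at t within {a..b})"
    and L: "\<And>t. t \<in> {a..b} \<Longrightarrow> norm (f1 t - f2 t) \<le> L * norm (z1 t - z2 t)"
    and init: "z1 a = z2 a" and t: "t \<in> {a..b}"
  shows "z1 t = z2 t"
proof -
  define d where "d t = z1 t - z2 t" for t
  define \<psi> where "\<psi> t = exp (- (2 * L) * t) * (d t \<bullet> d t)" for t
  define \<psi>' where "\<psi>' t = exp (- (2 * L) * t) * (2 * (d t \<bullet> (f1 t - f2 t)) - 2 * L * (d t \<bullet> d t))" for t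
  have d: "(d has_vector_derivative (f1 t - f2 t)) (at t within {a..b})" if "t \<in> {a..b}" for t
    unfolding d_def by (intro has_vector_derivative_diff 1 2 that)
  have der: "(\<psi> has_real_derivative \<psi>' t) (at t within {a..b})" if "t \<in> {a..b}" for t
  proof -
    have "((\<lambda>t. d t \<bullet> d t) has_real_derivative 2 * (d t \<bullet> (f1 t - f2 t))) (at t within {a..b})"
      unfolding has_field_derivative_def
      by (rule has_derivative_eq_rhs[OF has_derivative_inner[OF d[OF that, unfolded has_vector_derivative_def]
            d[OF that, unfolded has_vector_derivative_def]]])
         (simp add: fun_eq_iff inner_commute)
    moreover have "((\<lambda>t. exp (- (2 * L) * t)) has_real_derivative exp (- (2 * L) * t) * (- (2 * L)))
        (at t within {a..b})"
      by (auto intro!: derivative_eq_intros)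
    ultimately show ?thesis unfolding \<psi>_def \<psi>'_def
      by (rule_tac DERIV_cong[OF DERIV_mult]) (assumption, assumption, simp add: algebra_simps)
  qed
  have neg: "\<psi>' t \<le> 0" if "t \<in> {a..b}" for t
  proof -
    have "d t \<bullet> (f1 t - f2 t) \<le> norm (d t) * norm (f1 t - f2 t)" by (rule norm_cauchy_schwarz)
    also have "\<dots> \<le> norm (d t) * (L * norm (d t))"
      using L[OF that] by (intro mult_left_mono) (auto simp: d_def)
    also have "\<dots> = L * (d t \<bullet> d t)" by (simp add: dot_square_norm power2_eq_square)
    finally show ?thesis unfolding \<psi>'_def by (intro mult_nonneg_nonpos) auto
  qed
  have "(\<psi> has_derivative (\<lambda>h. \<psi>' s * h)) (at s within {a..t})" if "a \<le> s" "s \<le> t" for s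
    by (rule has_derivative_subset[OF der[unfolded has_field_derivative_def]]) (use that t in auto)
  then obtain s where s: "s \<in> {a..t}" "\<psi> t - \<psi> a = \<psi>' s * (t - a)"
    using mvt_very_simple[of a t \<psi> "\<lambda>s h. \<psi>' s * h"] t by auto
  have "\<psi>' s * (t - a) \<le> 0" using neg[of s] s(1) t by (intro mult_nonpos_nonneg) auto
  then have "\<psi> t \<le> \<psi> a" using s(2) by simp
  also have "\<psi> a = 0" by (simp add: \<psi>_def d_def init)
  finally have "d t \<bullet> d t \<le> 0" by (simp add: \<psi>_def mult_le_0_iff)
  then have "d t = 0" by (metis inner_eq_zero_iff inner_ge_zero order_antisym)
  then show ?thesis by (simp add: d_def)
qed

text \<open>Picard iteration: on an interval as short as required, the integral operator contracts bounded
  continuous functions by the factor \<open>1/2\<close>. Functions on \<open>{a..b}\<close> are extended to the real line by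
  constants, through \<open>cl\<close>, and the integrals are taken coordinate by coordinate.\<close>

lemma linear_ode_local_existence:
  fixes A :: "real \<Rightarrow> 'e \<Rightarrow> 'e::{real_inner,heine_borel}" and a b :: real
  assumes lin: "\<And>t. t \<in> {a..b} \<Longrightarrow> linear (A t)"
    and bd: "\<And>t u. t \<in> {a..b} \<Longrightarrow> norm (A t u) \<le> K * norm u"
    and cont: "\<And>u. continuous_on {a..b} (\<lambda>t. A t u)"
    and ab: "a \<le> b" and small: "card (onb :: 'e set) * (K * (b - a)) \<le> 1 / 2"
  shows "\<exists>U. U a = u0 \<and> (\<forall>t\<in>{a..b}. (U has_vector_derivative A t (U t)) (at t within {a..b}))"
proof -
  define cl where "cl t = max a (min b t)" for t :: real
  have cl: "cl t \<in> {a..b}" for t using ab by (auto simp: cl_def)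
  have cl_id: "cl t = t" if "t \<in> {a..b}" for t using that by (auto simp: cl_def)
  have cont_cl: "continuous_on UNIV cl" unfolding cl_def by (intro continuous_intros)
  have contA: "continuous_on {a..b} (\<lambda>s. A s (v s))" if "continuous_on {a..b} v" for v :: "real \<Rightarrow> 'e"
  proof -
    have "continuous_on {a..b} (\<lambda>s. \<Sum>c\<in>onb. (v s \<bullet> c) *\<^sub>R A s c)"
      by (intro continuous_intros that cont)
    then show ?thesis
      by (rule continuous_on_eq) (metis lin linear_onb_expansion)
  qed
  have int: "(\<lambda>s. A s (v s) \<bullet> c) integrable_on {a..t}"
    if "continuous_on {a..b} v" "t \<in> {a..b}" for v c t
    using that by (intro integrable_continuous_real continuous_intros continuous_on_subset[OF contA]) auto
  define I where "I v c t = integral {a..t} (\<lambda>s. A s (v s) \<bullet> c)" for v c t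
  define P where "P v t = u0 + (\<Sum>c\<in>onb. I v c (cl t) *\<^sub>R c)" for v t
  have derI: "((\<lambda>t. I v c t) has_vector_derivative A t (v t) \<bullet> c) (at t within {a..b})"
    if "continuous_on {a..b} v" "t \<in> {a..b}" for v c t
    unfolding I_def using that by (intro integral_has_vector_derivative continuous_intros contA)
  have derP: "(P v has_vector_derivative A t (v t)) (at t within {a..b})"
    if v: "continuous_on {a..b} v" "t \<in> {a..b}" for v t
  proof -
    have "((\<lambda>t. u0 + (\<Sum>c\<in>onb. I v c t *\<^sub>R c)) has_vector_derivative
        0 + (\<Sum>c\<in>onb. (A t (v t) \<bullet> c) *\<^sub>R c)) (at t within {a..b})"
      using derI[OF v] unfolding has_real_derivative_iff_has_vector_derivative[symmetric]
      by (intro has_vector_derivative_add has_vector_derivative_const has_vector_derivative_sum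
          has_vector_derivative_scaleR[where g' = 0, simplified])
    then show ?thesis unfolding onb_expansion add_0
      by (rule has_vector_derivative_transform[rotated 2]) (use v in \<open>auto simp: P_def cl_id\<close>)
  qed
  have contP: "continuous_on UNIV (P v)" if "continuous_on {a..b} v" for v
  proof -
    have "continuous_on {a..b} (P v)"
      using derP[OF that] by (rule continuous_on_vector_derivative)
    then have "continuous_on UNIV (\<lambda>t. P v (cl t))"
      by (rule continuous_on_compose2[OF _ cont_cl]) (use cl in blast)
    moreover have "P v (cl t) = P v t" for t by (simp add: P_def cl_id[OF cl])
    ultimately show ?thesis by simp
  qed
  have bc: "P v \<in> bcontfun" if "continuous_on {a..b} v" for v
  proof -
    have "compact (P v ` {a..b})"
      using contP[OF that] by (intro compact_continuous_image) (auto intro: continuous_on_subset)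
    moreover have "range (P v) \<subseteq> P v ` {a..b}"
    proof (rule image_subsetI)
      fix t
      have "P v t = P v (cl t)" by (simp add: P_def cl_id[OF cl])
      then show "P v t \<in> P v ` {a..b}" using cl by blast
    qed
    ultimately have "bounded (range (P v))" using bounded_subset compact_imp_bounded by blast
    then show ?thesis using contP[OF that] by (simp add: bcontfun_def)
  qed
  define T where "T v = Bcontfun (P (apply_bcontfun v))" for v :: "real \<Rightarrow>\<^sub>C 'e"
  have T: "apply_bcontfun (T v) = P (apply_bcontfun v)" for v
    unfolding T_def by (intro Bcontfun_inverse bc) simp
  have contr: "dist (T v) (T w) \<le> 1/2 * dist v w" for v w
  proof (rule dist_bound)
    fix t
    define n where "n = dist v w"
    have Ib: "\<bar>I v c (cl t) - I w c (cl t)\<bar> \<le> K * n * (b - a)" if c: "c \<in> onb" for c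
    proof -
      have "I v c (cl t) - I w c (cl t) = integral {a..cl t} (\<lambda>s. (A s (v s) - A s (w s)) \<bullet> c)"
        unfolding I_def inner_diff_left by (rule integral_diff[symmetric]) (intro int cl; simp)+
      also have "norm \<dots> \<le> K * n * (cl t - a)"
      proof (rule integral_bound)
        show "continuous_on {a..cl t} (\<lambda>s. (A s (v s) - A s (w s)) \<bullet> c)"
          using cl[of t] by (intro continuous_intros continuous_on_subset[OF contA]) auto
        fix s assume "s \<in> {a..cl t}"
        then have s: "s \<in> {a..b}" using cl[of t] by auto
        have "norm ((A s (v s) - A s (w s)) \<bullet> c) \<le> norm (A s (v s - w s))"
          using abs_inner_onb_le[OF c] by (simp add: linear_diff[OF lin[OF s]])
        also have "\<dots> \<le> K * norm (v s - w s)" by (rule bd[OF s])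
        also have "\<dots> \<le> K * n"
        proof -
          have "0 \<le> norm (A s c)" by simp
          also have "\<dots> \<le> K * 1" using bd[OF s, of c] c by simp
          finally show ?thesis
            using dist_bounded[of v s w] by (intro mult_left_mono) (auto simp: n_def dist_norm)
        qed
        finally show "norm ((A s (v s) - A s (w s)) \<bullet> c) \<le> K * n" .
      qed (use cl[of t] in auto)
      also have "\<dots> \<le> K * n * (b - a)"
      proof -
        have "0 \<le> norm (A a c)" by simp
        also have "\<dots> \<le> K * 1" using bd[of a c] c ab by simp
        finally show ?thesis using cl[of t] by (intro mult_left_mono) (auto simp: n_def)
      qed
      finally show ?thesis by simp
    qed
    have "dist (T v t) (T w t) = norm (\<Sum>c\<in>onb. (I v c (cl t) - I w c (cl t)) *\<^sub>R c)"
      by (simp add: T P_def dist_norm sum_subtractf scaleR_diff_left)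
    also have "\<dots> \<le> (\<Sum>c\<in>onb. norm ((I v c (cl t) - I w c (cl t)) *\<^sub>R c))" by (rule norm_sum)
    also have "\<dots> \<le> (\<Sum>c\<in>(onb::'e set). K * n * (b - a))" by (rule sum_mono) (simp add: Ib)
    also have "\<dots> = (card (onb :: 'e set) * (K * (b - a))) * n" by simp
    also have "\<dots> \<le> 1/2 * n" by (intro mult_right_mono small) (simp add: n_def)
    finally show "dist (T v t) (T w t) \<le> 1/2 * dist v w" by (simp add: n_def)
  qed
  have "\<exists>!v. T v = v" by (rule banach_fix_type[of "1/2"]) (use contr in auto)
  then obtain v where "T v = v" by blast
  then have v: "P (apply_bcontfun v) = apply_bcontfun v" using T by metis
  have "apply_bcontfun v a = u0"
    using ab by (subst v[symmetric]) (simp add: P_def cl_id I_def)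
  moreover have "(apply_bcontfun v has_vector_derivative A t (apply_bcontfun v t)) (at t within {a..b})"
    if "t \<in> {a..b}" for t
    using derP[OF _ that, of "apply_bcontfun v"] by (simp add: v)
  ultimately show ?thesis by blast
qed

lemma has_derivative_within_Un:
  "(f has_derivative D) (at x within S) \<Longrightarrow> (f has_derivative D) (at x within T) \<Longrightarrow>
   (f has_derivative D) (at x within S \<union> T)"
  by (simp add: has_derivative_within Lim_within_Un)

lemma has_vector_derivative_unique_Icc:
  fixes t :: real
  assumes "(f has_vector_derivative D) (at t within {a..b})" "(f has_vector_derivative D') (at t within {a..b})"
    "a < b" "t \<in> {a..b}"
  shows "D = D'"
  using vector_derivative_within_cbox[of a b t f D] vector_derivative_within_cbox[of a b t f D'] assms
  by auto

section \<open>Convex duality\<close>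

text \<open>The hypothesis on \<open>fc\<close>, which is the convex conjugate of \<open>f\<close>, says that \<open>u0\<close> is a subgradient of
  \<open>fc\<close> at \<open>y\<close>. It suffices to show \<open>f u0 \<le> y \<bullet> u0 - fc y\<close>. If this fails, some point \<open>(u0, a)\<close> with
  \<open>y \<bullet> u0 - fc y < a\<close> lies strictly below the graph and can be separated from the closed convex
  epigraph by a hyperplane. If the hyperplane is not vertical, it is an affine minorant of \<open>f\<close>, that is,
  an upper bound for \<open>fc\<close> at its slope, which contradicts the minimality. If it is vertical, a large
  multiple of its normal is subtracted from the slope \<open>z1\<close> of some affine minorant; along this ray
  \<open>fc\<close> decreases too fast for the minimality.\<close>

lemma conjugate_minimum_imp_subgradient:
  fixes f :: "'e::{real_inner,heine_borel} \<Rightarrow> ereal"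
  assumes conv: "\<And>u v t. 0 < t \<Longrightarrow> t < 1 \<Longrightarrow>
      f ((1 - t) *\<^sub>R u + t *\<^sub>R v) \<le> ereal (1 - t) * f u + ereal t * f v"
    and lsc: "\<And>u a. a < f u \<Longrightarrow> \<exists>\<delta>>0. \<forall>v. norm (v - u) < \<delta> \<longrightarrow> a < f v"
    and proper: "f u1 \<noteq> \<infinity>" "\<And>u. f u \<noteq> -\<infinity>"
    and min: "\<And>z. fc z \<ge> fc y + ereal ((z - y) \<bullet> u0)"
    and fc: "\<And>z. fc z = (SUP u. ereal (z \<bullet> u) - f u)"
  shows "f u \<ge> f u0 + ereal (y \<bullet> (u - u0))"
proof -
  define E where "E = {(u, r). f u \<le> ereal r}"
  have conv_E: "convex E"
  proof (rule convexI)
    fix p q :: "'e \<times> real" and s t :: real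
    assume p: "p \<in> E" and q: "q \<in> E" and st: "0 \<le> s" "0 \<le> t" "s + t = 1"
    obtain u r v r' where pq: "p = (u, r)" "q = (v, r')" by (meson surj_pair)
    have fu: "f u \<le> ereal r" "f v \<le> ereal r'" using p q pq by (auto simp: E_def)
    show "s *\<^sub>R p + t *\<^sub>R q \<in> E"
    proof (cases "t = 0 \<or> t = 1")
      case True
      then show ?thesis using st p q by auto
    next
      case False
      then have t: "0 < t" "t < 1" "s = 1 - t" using st by auto
      have "f (s *\<^sub>R u + t *\<^sub>R v) \<le> ereal s * f u + ereal t * f v" using conv[OF t(1,2)] t(3) by simp
      also have "\<dots> \<le> ereal s * ereal r + ereal t * ereal r'"
        using fu st by (intro add_mono ereal_mult_left_mono) auto
      finally show ?thesis by (simp add: E_def pq)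
    qed
  qed
  have closed_E: "closed E"
  proof -
    have "open (- E)"
      unfolding open_dist
    proof
      fix p assume "p \<in> - E"
      then obtain v r where p: "p = (v, r)" "ereal r < f v" by (cases p) (auto simp: E_def)
      then obtain r' where r': "ereal r < ereal r'" "ereal r' < f v"
        by (metis ereal_dense2 less_ereal.simps(3) ereal_less_PInfty less_ereal.simps(1) order_less_trans
            ereal_cases less_ereal.simps(2) not_less_iff_gr_or_eq)
      then obtain \<delta> where \<delta>: "\<delta> > 0" "\<And>w. norm (w - v) < \<delta> \<Longrightarrow> ereal r' < f w" using lsc by blast
      have "q \<in> - E" if "dist q p < min \<delta> (r' - r)" for q
      proof -
        obtain w t where q: "q = (w, t)" by (meson surj_pair)
        have "norm (w - v) < \<delta>" "\<bar>t - r\<bar> < r' - r"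
          using that dist_fst_le[of q p] dist_snd_le[of q p] by (auto simp: q p dist_norm)
        then have "ereal r' < f w" "ereal t < ereal r'" using \<delta> by auto
        then have "ereal t < f w" by order
        then show ?thesis by (simp add: E_def q)
      qed
      then show "\<exists>e>0. \<forall>q. dist q p < e \<longrightarrow> q \<in> - E" using \<delta> r' by (intro exI[of _ "min \<delta> (r' - r)"]) auto
    qed
    then show ?thesis by (simp add: closed_def)
  qed
  obtain r1 where r1: "f u1 = ereal r1" using proper by (cases "f u1") auto
  have sep: "\<exists>v \<beta> b. 0 \<le> \<beta> \<and> v \<bullet> w + \<beta> * a < b \<and> (\<forall>u r. f u \<le> ereal r \<longrightarrow> b < v \<bullet> u + \<beta> * r)"
    if "ereal a < f w" for w a
  proof -
    have "(w, a) \<notin> E" using that by (auto simp: E_def)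
    then obtain v\<beta> b where "v\<beta> \<bullet> (w, a) < b" "\<forall>x\<in>E. v\<beta> \<bullet> x > b"
      using separating_hyperplane_closed_point[OF conv_E closed_E] by blast
    moreover obtain v \<beta> where "v\<beta> = (v, \<beta>)" by (meson surj_pair)
    ultimately have vb: "v \<bullet> w + \<beta> * a < b" "\<And>u r. f u \<le> ereal r \<Longrightarrow> b < v \<bullet> u + \<beta> * r"
      by (auto simp: E_def inner_prod_def)
    \<comment> \<open>The epigraph is unbounded upwards, so the normal cannot point downwards.\<close>
    have "0 \<le> \<beta>"
    proof (rule ccontr)
      assume "\<not> 0 \<le> \<beta>"
      then have n: "\<beta> < 0" by simp
      define r where "r = max r1 ((b - v \<bullet> u1) / \<beta>)"
      have "f u1 \<le> ereal r" by (simp add: r1 r_def)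
      from vb(2)[OF this] have "(b - v \<bullet> u1) < \<beta> * r" by simp
      moreover have "\<beta> * r \<le> \<beta> * ((b - v \<bullet> u1) / \<beta>)" using n by (intro mult_left_mono_neg) (auto simp: r_def)
      ultimately show False using n by simp
    qed
    then show ?thesis using vb by blast
  qed
  have conj_le: "fc z \<le> ereal c" if "\<And>u r. f u = ereal r \<Longrightarrow> z \<bullet> u - r \<le> c" for z c
    unfolding fc
  proof (rule SUP_least)
    fix u show "ereal (z \<bullet> u) - f u \<le> ereal c"
      using that[of u] proper(2)[of u] by (cases "f u") auto
  qed
  have affine: "fc (- (1 / \<beta>) *\<^sub>R v) \<le> ereal (- (b / \<beta>))"
    if "0 < \<beta>" "\<forall>u r. f u \<le> ereal r \<longrightarrow> b < v \<bullet> u + \<beta> * r" for v \<beta> b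
  proof (rule conj_le)
    fix u r assume "f u = ereal r"
    then have "b < v \<bullet> u + \<beta> * r" using that by simp
    then have "b / \<beta> \<le> (v \<bullet> u + \<beta> * r) / \<beta>" using that by (intro divide_right_mono) auto
    then show "- (1 / \<beta>) *\<^sub>R v \<bullet> u - r \<le> - (b / \<beta>)" using that by (simp add: add_divide_distrib)
  qed
  have conj_ge: "ereal (z \<bullet> u1 - r1) \<le> fc z" for z
    unfolding fc by (rule SUP_upper2[of u1]) (simp_all add: r1)
  \<comment> \<open>Separating the point one unit below the graph at \<open>u1\<close> gives a non-vertical hyperplane,
      since \<open>f u1\<close> is finite.\<close>
  obtain z1 c1 where z1: "fc z1 \<le> ereal c1"
  proof -
    have "ereal (r1 - 1) < f u1" by (simp add: r1)
    then obtain v \<beta> b where vb: "0 \<le> \<beta>" "v \<bullet> u1 + \<beta> * (r1 - 1) < b" "\<forall>u r. f u \<le> ereal r \<longrightarrow> b < v \<bullet> u + \<beta> * r"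
      using sep by blast
    have "b < v \<bullet> u1 + \<beta> * r1" using vb(3) r1 by simp
    with vb(2) have "\<beta> \<noteq> 0" by auto
    with vb(1) have "0 < \<beta>" by simp
    from affine[OF this vb(3)] show thesis by (rule that)
  qed
  have "fc y \<noteq> \<infinity>" using min[of y] min[of z1] z1 by (auto simp: top_unique)
  moreover have "fc y \<noteq> -\<infinity>" using conj_ge[of y] by auto
  ultimately obtain cy where cy: "fc y = ereal cy" by (cases "fc y") auto
  have min': "cy + (z - y) \<bullet> u0 \<le> c" if "fc z \<le> ereal c" for z c
    using order_trans[OF min[of z] that] by (simp add: cy)
  have key: "f u0 \<le> ereal (y \<bullet> u0 - cy)"
  proof (rule ccontr)
    assume "\<not> ?thesis"
    then have "ereal (y \<bullet> u0 - cy) < f u0" by simp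
    then obtain a where a: "y \<bullet> u0 - cy < a" "ereal a < f u0"
      by (metis ereal_dense2 less_ereal.simps(1))
    obtain v \<beta> b where vb: "0 \<le> \<beta>" "v \<bullet> u0 + \<beta> * a < b" "\<forall>u r. f u \<le> ereal r \<longrightarrow> b < v \<bullet> u + \<beta> * r"
      using sep[OF a(2)] by blast
    show False
    proof (cases "\<beta> = 0")
      case False
      then have \<beta>: "0 < \<beta>" using vb by simp
      have "cy + (- (1 / \<beta>) *\<^sub>R v - y) \<bullet> u0 \<le> - (b / \<beta>)" by (rule min'[OF affine[OF \<beta> vb(3)]])
      then have "b / \<beta> - (v \<bullet> u0) / \<beta> \<le> y \<bullet> u0 - cy" by (simp add: inner_diff_left)
      moreover have "a \<le> b / \<beta> - (v \<bullet> u0) / \<beta>"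
        using vb(2) \<beta> by (simp add: diff_divide_distrib[symmetric] pos_le_divide_eq mult.commute)
      ultimately show False using a by simp
    next
      case True
      \<comment> \<open>The minimality would give \<open>k * (b - v \<bullet> u0) \<le> c1 - cy - (z1 - y) \<bullet> u0\<close>, so one more
          than the quotient is a contradiction.\<close>
      define k where "k = max 0 ((c1 - cy - (z1 - y) \<bullet> u0) / (b - v \<bullet> u0) + 1)"
      have gap: "0 < b - v \<bullet> u0" using vb(2) True by simp
      have "fc (z1 - k *\<^sub>R v) \<le> ereal (c1 - k * b)"
      proof (rule conj_le)
        fix u r assume r: "f u = ereal r"
        then have "b < v \<bullet> u" using vb(3)[rule_format, of u r] True by simp
        then have "k * b \<le> k * (v \<bullet> u)" by (intro mult_left_mono) (auto simp: k_def)
        moreover have "ereal (z1 \<bullet> u) - f u \<le> fc z1" unfolding fc by (rule SUP_upper) simp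
        then have "z1 \<bullet> u - r \<le> c1" using order_trans[OF _ z1] r by fastforce
        ultimately show "(z1 - k *\<^sub>R v) \<bullet> u - r \<le> c1 - k * b" by (simp add: inner_diff_left)
      qed
      from min'[OF this] have "k * (b - v \<bullet> u0) \<le> c1 - cy - (z1 - y) \<bullet> u0"
        by (simp add: inner_diff_left algebra_simps)
      then have "k \<le> (c1 - cy - (z1 - y) \<bullet> u0) / (b - v \<bullet> u0)" using gap by (simp add: pos_le_divide_eq)
      then show False by (simp add: k_def)
    qed
  qed
  obtain r0 where r0: "f u0 = ereal r0" using key proper(2)[of u0] by (cases "f u0") auto
  have "ereal (y \<bullet> u) - f u \<le> ereal cy" unfolding cy[symmetric] fc by (rule SUP_upper) simp
  then show ?thesis using key r0 proper(2)[of u] by (cases "f u") (auto simp: inner_diff_right)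
qed

section \<open>Charts and tangent spaces\<close>

locale riemannian =
  fixes M :: "('a, 'e::{real_inner,heine_borel}) rmfd"
  assumes riem: "riemannian_manifold M"
begin

lemma smooth_manifold: "smooth_manifold M" and riemannian_metric: "riemannian_metric M"
  using riem by (auto simp: riemannian_manifold_def)

lemma is_chart: "c \<in> atlas M \<Longrightarrow> is_chart (mtop M) c"
  using smooth_manifold by (auto simp: smooth_manifold_def)

lemma charts_atD: "c \<in> charts_at M p \<Longrightarrow> c \<in> atlas M" "c \<in> charts_at M p \<Longrightarrow> p \<in> fst c"
  by (auto simp: charts_at_def)

lemma chart_domain: "c \<in> atlas M \<Longrightarrow> openin (mtop M) (fst c)" "c \<in> atlas M \<Longrightarrow> fst c \<subseteq> topspace (mtop M)"
  using is_chart[of c] openin_subset by (auto simp: is_chart_def)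

lemma open_chart_image: "c \<in> atlas M \<Longrightarrow> open (snd c ` fst c)"
  using is_chart[of c] by (auto simp: is_chart_def)

lemma chart_homeo:
  "c \<in> atlas M \<Longrightarrow> homeomorphic_map (subtopology (mtop M) (fst c)) (top_of_set (snd c ` fst c)) (snd c)"
  using is_chart[of c] by (auto simp: is_chart_def)

lemma inj_on_chart: "c \<in> atlas M \<Longrightarrow> inj_on (snd c) (fst c)"
  using homeomorphic_imp_injective_map[OF chart_homeo, of c] chart_domain(2)[of c]
  by (simp add: Int_absorb1)

lemma chart_inv_left [simp]: "c \<in> atlas M \<Longrightarrow> p \<in> fst c \<Longrightarrow> chart_inv c (snd c p) = p"
  by (simp add: chart_inv_def inv_into_f_f inj_on_chart)

lemma open_overlap_image:
  assumes "c \<in> atlas M" "d \<in> atlas M" shows "open (snd c ` (fst c \<inter> fst d))"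
proof -
  have "openin (subtopology (mtop M) (fst c)) (fst c \<inter> fst d)"
    using chart_domain[OF assms(2)] by (auto simp: openin_subtopology)
  then have "openin (top_of_set (snd c ` fst c)) (snd c ` (fst c \<inter> fst d))"
    using homeomorphic_imp_open_map[OF chart_homeo[OF assms(1)]] by (simp add: open_map_def)
  then show ?thesis using open_chart_image[OF assms(1)] by (simp add: openin_open_eq)
qed

lemma charts_nonempty: "p \<in> topspace (mtop M) \<Longrightarrow> \<exists>c. c \<in> charts_at M p"
  using smooth_manifold by (auto simp: smooth_manifold_def)

lemma smooth_transition:
  "c \<in> atlas M \<Longrightarrow> d \<in> atlas M \<Longrightarrow> smooth_on (snd d \<circ> chart_inv c) (snd c ` (fst c \<inter> fst d))"
  using smooth_manifold by (auto simp: smooth_manifold_def)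

lemma has_derivative_transition:
  assumes "c \<in> charts_at M p" "d \<in> charts_at M p"
  shows "((snd d \<circ> chart_inv c) has_derivative dtrans c d (snd c p)) (at (snd c p))"
  unfolding dtrans_def using assms
  by (intro smooth_on_has_derivative[OF smooth_transition[of c d]]) (auto simp: charts_at_def)

lemma linear_dtrans: "c \<in> charts_at M p \<Longrightarrow> d \<in> charts_at M p \<Longrightarrow> linear (dtrans c d (snd c p))"
  using has_derivative_transition by (rule has_derivative_linear)

text \<open>The chain rule. The cocycle identity is what makes \<open>coord_vec\<close> a compatible family, so that each
  chart identifies the tangent space with the model space.\<close>

lemma dtrans_cocycle:
  assumes c: "c \<in> charts_at M p" and d: "d \<in> charts_at M p" and e: "e \<in> charts_at M p"
  shows "dtrans d e (snd d p) (dtrans c d (snd c p) u) = dtrans c e (snd c p) u"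
proof -
  have a: "c \<in> atlas M" "d \<in> atlas M" "p \<in> fst c" "p \<in> fst d" using c d by (auto simp: charts_at_def)
  have eq: "(snd d \<circ> chart_inv c) (snd c p) = snd d p" using a by simp
  have "((\<lambda>x. (snd e \<circ> chart_inv d) ((snd d \<circ> chart_inv c) x)) has_derivative
      (\<lambda>u. dtrans d e (snd d p) (dtrans c d (snd c p) u))) (at (snd c p))"
    using has_derivative_transition[OF d e]
    by (intro has_derivative_compose[OF has_derivative_transition[OF c d]]) (simp only: eq)
  then have "((snd e \<circ> chart_inv c) has_derivative
      (\<lambda>u. dtrans d e (snd d p) (dtrans c d (snd c p) u))) (at (snd c p))"
    by (rule has_derivative_transform_within_open[OF _ open_overlap_image[OF a(1,2)]])
       (use a in auto)
  then show ?thesis using has_derivative_unique[OF has_derivative_transition[OF c e]] by metis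
qed

lemma dtrans_self:
  assumes c: "c \<in> charts_at M p" shows "dtrans c c (snd c p) u = u"
proof -
  have a: "c \<in> atlas M" "p \<in> fst c" using c by (auto simp: charts_at_def)
  have "((\<lambda>x. x) has_derivative (\<lambda>u. u)) (at (snd c p))" by simp
  then have "((snd c \<circ> chart_inv c) has_derivative (\<lambda>u. u)) (at (snd c p))"
    by (rule has_derivative_transform_within_open[OF _ open_chart_image[OF a(1)]]) (use a in auto)
  then show ?thesis using has_derivative_unique[OF has_derivative_transition[OF c c]] by metis
qed

lemma coord_vec_apply: "d \<in> charts_at M p \<Longrightarrow> coord_vec M c p u d = dtrans c d (snd c p) u"
  by (simp add: coord_vec_def)

lemma coord_vec_self [simp]: "c \<in> charts_at M p \<Longrightarrow> coord_vec M c p u c = u"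
  by (simp add: coord_vec_def dtrans_self)

lemma coord_vec_tangent: "c \<in> charts_at M p \<Longrightarrow> coord_vec M c p u \<in> tangent_space M p"
  by (simp add: tangent_space_def coord_vec_def dtrans_cocycle)

lemma tangent_transform:
  "X \<in> tangent_space M p \<Longrightarrow> c \<in> charts_at M p \<Longrightarrow> d \<in> charts_at M p \<Longrightarrow> X d = dtrans c d (snd c p) (X c)"
  unfolding tangent_space_def by blast

lemma tangent_outside: "X \<in> tangent_space M p \<Longrightarrow> d \<notin> charts_at M p \<Longrightarrow> X d = 0"
  unfolding tangent_space_def by blast

lemma tangent_eqI:
  assumes "X \<in> tangent_space M p" "Y \<in> tangent_space M p" "c \<in> charts_at M p" "X c = Y c"
  shows "X = Y"
proof
  fix d show "X d = Y d"
    by (cases "d \<in> charts_at M p") (metis assms tangent_transform, metis assms tangent_outside)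
qed

lemma coord_vec_tangent_eq: "X \<in> tangent_space M p \<Longrightarrow> c \<in> charts_at M p \<Longrightarrow> coord_vec M c p (X c) = X"
  by (rule tangent_eqI) (auto simp: coord_vec_tangent)

lemma tangent_linear:
  assumes "X \<in> tangent_space M p" "Y \<in> tangent_space M p"
  shows "a *\<^sub>R X + b *\<^sub>R Y \<in> tangent_space M p"
  unfolding tangent_space_def mem_Collect_eq
proof (intro conjI ballI allI impI)
  fix c d assume cd: "c \<in> charts_at M p" "d \<in> charts_at M p"
  then show "(a *\<^sub>R X + b *\<^sub>R Y) d = dtrans c d (snd c p) ((a *\<^sub>R X + b *\<^sub>R Y) c)"
    using tangent_transform[OF assms(1) cd] tangent_transform[OF assms(2) cd]
    by (simp only: plus_fun_apply scaleR_fun_def linear_add[OF linear_dtrans] linear_scale[OF linear_dtrans])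
qed (simp add: scaleR_fun_def tangent_outside[OF assms(1)] tangent_outside[OF assms(2)])

lemma tangent_scaleR: "X \<in> tangent_space M p \<Longrightarrow> a *\<^sub>R X \<in> tangent_space M p"
  and tangent_diff: "X \<in> tangent_space M p \<Longrightarrow> Y \<in> tangent_space M p \<Longrightarrow> X - Y \<in> tangent_space M p"
  using tangent_linear[of X p X a 0] tangent_linear[of X p Y 1 "-1"] by auto

lemma coord_vec_linear:
  assumes "c \<in> charts_at M p"
  shows "coord_vec M c p (a *\<^sub>R u + b *\<^sub>R v) = a *\<^sub>R coord_vec M c p u + b *\<^sub>R coord_vec M c p v"
  using assms by (intro tangent_eqI[OF _ _ assms] tangent_linear coord_vec_tangent) (auto simp: scaleR_fun_def)

section \<open>The metric and the Levi-Civita connection in a chart\<close>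

lemma metric_symmetric:
  "p \<in> topspace (mtop M) \<Longrightarrow> X \<in> tangent_space M p \<Longrightarrow> Y \<in> tangent_space M p \<Longrightarrow> metric M p X Y = metric M p Y X"
  using riemannian_metric by (auto simp: riemannian_metric_def)

lemma metric_linear_left:
  "p \<in> topspace (mtop M) \<Longrightarrow> X \<in> tangent_space M p \<Longrightarrow> Y \<in> tangent_space M p \<Longrightarrow> Z \<in> tangent_space M p \<Longrightarrow>
   metric M p (a *\<^sub>R X + b *\<^sub>R Y) Z = a * metric M p X Z + b * metric M p Y Z"
  using riemannian_metric by (auto simp: riemannian_metric_def)

lemma metric_pos:
  "p \<in> topspace (mtop M) \<Longrightarrow> X \<in> tangent_space M p \<Longrightarrow> X \<noteq> 0 \<Longrightarrow> metric M p X X > 0"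
  using riemannian_metric by (auto simp: riemannian_metric_def)

lemma smooth_metric_coord:
  "c \<in> atlas M \<Longrightarrow> smooth_on (\<lambda>x. metric_coord M c x u v) (snd c ` fst c)"
  using riemannian_metric by (auto simp: riemannian_metric_def)

lemma metric_eq_coord:
  assumes "c \<in> charts_at M p" "X \<in> tangent_space M p" "Y \<in> tangent_space M p"
  shows "metric M p X Y = metric_coord M c (snd c p) (X c) (Y c)"
  using assms by (simp add: metric_coord_def coord_vec_tangent_eq charts_atD)

lemma metric_coord_eq:
  assumes "c \<in> charts_at M p"
  shows "metric_coord M c (snd c p) u v = metric M p (coord_vec M c p u) (coord_vec M c p v)"
  using assms by (simp add: metric_coord_def charts_atD)

lemma chart_imageE:
  assumes "c \<in> atlas M" "x \<in> snd c ` fst c"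
  obtains p where "c \<in> charts_at M p" "p \<in> topspace (mtop M)" "x = snd c p"
  using assms chart_domain by (fastforce simp: charts_at_def)

lemma metric_coord_symmetric:
  assumes "c \<in> atlas M" "x \<in> snd c ` fst c"
  shows "metric_coord M c x u v = metric_coord M c x v u"
proof -
  obtain p where p: "c \<in> charts_at M p" "p \<in> topspace (mtop M)" "x = snd c p" using chart_imageE[OF assms] .
  then show ?thesis unfolding p(3) metric_coord_eq[OF p(1)]
    by (intro metric_symmetric coord_vec_tangent)
qed

lemma metric_coord_linear_left:
  assumes "c \<in> atlas M" "x \<in> snd c ` fst c"
  shows "linear (\<lambda>u. metric_coord M c x u v)"
proof -
  obtain p where p: "c \<in> charts_at M p" "p \<in> topspace (mtop M)" "x = snd c p" using chart_imageE[OF assms] .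
  have *: "metric_coord M c x (a *\<^sub>R u + b *\<^sub>R w) v = a * metric_coord M c x u v + b * metric_coord M c x w v" for a b u w
    unfolding p(3) metric_coord_eq[OF p(1)] coord_vec_linear[OF p(1)]
    by (intro metric_linear_left coord_vec_tangent p)
  show ?thesis
    using *[of 1 _ 1] *[of _ _ 0 0] by (intro linearI) auto
qed

lemma metric_coord_linear_right:
  assumes "c \<in> atlas M" "x \<in> snd c ` fst c"
  shows "linear (metric_coord M c x u)"
proof -
  have "metric_coord M c x u = (\<lambda>v. metric_coord M c x v u)"
    by (rule ext) (rule metric_coord_symmetric[OF assms])
  then show ?thesis using metric_coord_linear_left[OF assms, of u] by simp
qed

lemma metric_coord_pos:
  assumes "c \<in> atlas M" "x \<in> snd c ` fst c" "u \<noteq> 0"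
  shows "metric_coord M c x u u > 0"
proof -
  obtain p where p: "c \<in> charts_at M p" "p \<in> topspace (mtop M)" "x = snd c p" using chart_imageE[OF assms(1,2)] .
  have "coord_vec M c p u \<noteq> 0"
  proof
    assume "coord_vec M c p u = 0"
    then have "coord_vec M c p u c = 0" by simp
    then show False using assms(3) p(1) by simp
  qed
  then show ?thesis unfolding p(3) metric_coord_eq[OF p(1)] by (intro metric_pos coord_vec_tangent p)
qed

lemma metric_coord_change:
  assumes "c \<in> charts_at M p" "d \<in> charts_at M p"
  shows "metric_coord M c (snd c p) u v =
         metric_coord M d (snd d p) (dtrans c d (snd c p) u) (dtrans c d (snd c p) v)"
  unfolding metric_coord_eq[OF assms(1)]
  by (subst metric_eq_coord[OF assms(2)]) (simp_all add: coord_vec_tangent assms coord_vec_apply)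

definition metric_deriv :: "('a, 'e) chart \<Rightarrow> 'e \<Rightarrow> 'e \<Rightarrow> 'e \<Rightarrow> 'e \<Rightarrow> real" where
  "metric_deriv c x w u v = frechet_derivative (\<lambda>x'. metric_coord M c x' u v) (at x) w"

lemma has_derivative_metric_coord:
  "c \<in> atlas M \<Longrightarrow> x \<in> snd c ` fst c \<Longrightarrow>
   ((\<lambda>x'. metric_coord M c x' u v) has_derivative (\<lambda>w. metric_deriv c x w u v)) (at x)"
  unfolding metric_deriv_def by (rule smooth_on_has_derivative[OF smooth_metric_coord])

lemma smooth_metric_deriv:
  "c \<in> atlas M \<Longrightarrow> smooth_on (\<lambda>x. metric_deriv c x w u v) (snd c ` fst c)"
  unfolding metric_deriv_def by (rule smooth_on_frechet_derivative[OF smooth_metric_coord])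

lemma metric_deriv_linear:
  assumes "c \<in> atlas M" "x \<in> snd c ` fst c"
  shows "linear (\<lambda>w. metric_deriv c x w u v)" "linear (\<lambda>u. metric_deriv c x w u v)"
    "linear (\<lambda>v. metric_deriv c x w u v)"
proof -
  show "linear (\<lambda>w. metric_deriv c x w u v)"
    by (rule has_derivative_linear[OF has_derivative_metric_coord[OF assms]])
  show "linear (\<lambda>u. metric_deriv c x w u v)"
    by (rule linear_family_derivative[OF open_chart_image[OF assms(1)] assms(2) metric_coord_linear_left[OF assms(1)]])
       (use has_derivative_metric_coord[OF assms] in auto)
  show "linear (\<lambda>v. metric_deriv c x w u v)"
    by (rule linear_family_derivative[OF open_chart_image[OF assms(1)] assms(2) metric_coord_linear_right[OF assms(1)]])
       (use has_derivative_metric_coord[OF assms] in auto)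
qed

lemma metric_deriv_symmetric:
  assumes "c \<in> atlas M" "x \<in> snd c ` fst c"
  shows "metric_deriv c x w u v = metric_deriv c x w v u"
proof -
  have "((\<lambda>x'. metric_coord M c x' u v) has_derivative (\<lambda>w. metric_deriv c x w v u)) (at x)"
    by (rule has_derivative_transform_within_open[OF has_derivative_metric_coord[OF assms]
          open_chart_image[OF assms(1)] assms(2)]) (rule metric_coord_symmetric[OF assms(1)])
  then show ?thesis using has_derivative_unique[OF has_derivative_metric_coord[OF assms]] by metis
qed

text \<open>The right-hand side is linear in \<open>z\<close> and the metric is positive definite, so the description that
  defines \<open>christoffel\<close> has exactly one solution.\<close>

lemma koszul:
  assumes c: "c \<in> atlas M" "x \<in> snd c ` fst c"
  shows "2 * metric_coord M c x (christoffel M c x u v) z =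
         metric_deriv c x u v z + metric_deriv c x v u z - metric_deriv c x z u v"
proof -
  have dbl: "linear (\<lambda>w. 2 * f w)" if "linear f" for f :: "'e \<Rightarrow> real"
    using that by (intro linearI) (simp_all add: linear_add linear_scale distrib_left)
  have "\<exists>!w. \<forall>z. 2 * metric_coord M c x w z =
      metric_deriv c x u v z + metric_deriv c x v u z - metric_deriv c x z u v"
    using metric_coord_pos[OF c]
    by (intro ex1_representing_vector) (auto intro!: linear_compose_add linear_compose_sub metric_deriv_linear[OF c]
        dbl metric_coord_linear_left[OF c] metric_coord_linear_right[OF c])
  from theI'[OF this] show ?thesis
    by (simp add: christoffel_def metric_deriv_def Let_def)
qed

lemma metric_coord_eqI:
  assumes c: "c \<in> atlas M" "x \<in> snd c ` fst c"
    and "\<And>z. metric_coord M c x u z = metric_coord M c x v z"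
  shows "u = v"
proof (rule ccontr)
  assume "u \<noteq> v"
  then have "metric_coord M c x (u - v) (u - v) > 0" using c by (intro metric_coord_pos) auto
  then show False using assms(3) linear_diff[OF metric_coord_linear_left[OF c]] by simp
qed

lemma christoffel_linear:
  assumes c: "c \<in> atlas M" "x \<in> snd c ` fst c"
  shows "linear (\<lambda>u. christoffel M c x u v)" "linear (\<lambda>v. christoffel M c x u v)"
proof -
  note lin = linear_add[OF metric_deriv_linear(1)[OF c]] linear_add[OF metric_deriv_linear(2)[OF c]]
    linear_add[OF metric_deriv_linear(3)[OF c]] linear_scale[OF metric_deriv_linear(1)[OF c]]
    linear_scale[OF metric_deriv_linear(2)[OF c]] linear_scale[OF metric_deriv_linear(3)[OF c]]
    linear_add[OF metric_coord_linear_left[OF c]] linear_scale[OF metric_coord_linear_left[OF c]]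
  have dbl: "a = b" if "2 * a = 2 * b" for a b :: real using that by simp
  show "linear (\<lambda>u. christoffel M c x u v)"
    by (intro linearI metric_coord_eqI[OF c]; rule dbl)
       (simp_all add: koszul[OF c] lin distrib_left mult.left_commute[of 2] right_diff_distrib)
  show "linear (\<lambda>v. christoffel M c x u v)"
    by (intro linearI metric_coord_eqI[OF c]; rule dbl)
       (simp_all add: koszul[OF c] lin distrib_left mult.left_commute[of 2] right_diff_distrib)
qed

text \<open>The sum of the Koszul formulas for \<open>(u, v, w)\<close> and \<open>(u, w, v)\<close>.\<close>

lemma metric_compatible:
  assumes c: "c \<in> atlas M" "x \<in> snd c ` fst c"
  shows "metric_deriv c x u v w = metric_coord M c x (christoffel M c x u v) w + metric_coord M c x v (christoffel M c x u w)"
  using koszul[OF c, of u v w] koszul[OF c, of u w v] metric_coord_symmetric[OF c, of v]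
    metric_deriv_symmetric[OF c, of u v w] metric_deriv_symmetric[OF c, of v u w] metric_deriv_symmetric[OF c, of w u v]
  by simp

section \<open>Local bounds for the Christoffel symbols\<close>

text \<open>The minimum of the positive continuous function \<open>(x, w) \<mapsto> g\<^sub>x(w, w)\<close> on the compact product of \<open>K\<close> and
  the unit sphere, extended to all \<open>w\<close> by homogeneity.\<close>

lemma metric_coord_coercive:
  assumes c: "c \<in> atlas M" and K: "compact K" "K \<subseteq> snd c ` fst c"
  shows "\<exists>l>0. \<forall>x\<in>K. \<forall>w. l * (norm w)\<^sup>2 \<le> metric_coord M c x w w"
proof -
  have ex: "\<exists>l>0. \<forall>x\<in>K. \<forall>w\<in>sphere 0 1. l \<le> metric_coord M c x w w"
  proof (cases "K \<times> sphere (0::'e) 1 = {}")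
    case True
    then show ?thesis by (intro exI[of _ 1]) auto
  next
    case False
    have "sphere (0::'e) 1 = cball 0 1 - ball 0 1" by auto
    then have "compact (sphere (0::'e) 1)" by (simp add: compact_diff)
    then have "compact (K \<times> sphere (0::'e) 1)" using K by (intro compact_Times)
    moreover have "continuous_on (K \<times> sphere (0::'e) 1) (\<lambda>q. metric_coord M c (fst q) (snd q) (snd q))"
    proof -
      have "continuous_on (K \<times> sphere (0::'e) 1)
          (\<lambda>q. \<Sum>b\<in>onb. (snd q \<bullet> b) *\<^sub>R (\<Sum>b'\<in>onb. (snd q \<bullet> b') *\<^sub>R metric_coord M c (fst q) b b'))"
        using K(2) by (intro continuous_intros continuous_on_compose2[OF
              smooth_on_imp_continuous_on[OF smooth_metric_coord[OF c]]]) auto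
      then show ?thesis
      proof (rule continuous_on_eq)
        fix q assume "q \<in> K \<times> sphere (0::'e) 1"
        then have x: "fst q \<in> snd c ` fst c" using K(2) by auto
        show "(\<Sum>b\<in>onb. (snd q \<bullet> b) *\<^sub>R (\<Sum>b'\<in>onb. (snd q \<bullet> b') *\<^sub>R metric_coord M c (fst q) b b')) =
            metric_coord M c (fst q) (snd q) (snd q)"
          unfolding linear_onb_expansion[OF metric_coord_linear_right[OF c x], symmetric]
          by (rule linear_onb_expansion[OF metric_coord_linear_left[OF c x], symmetric])
      qed
    qed
    ultimately have "\<exists>q0\<in>K \<times> sphere (0::'e) 1. \<forall>q\<in>K \<times> sphere 0 1.
        metric_coord M c (fst q0) (snd q0) (snd q0) \<le> metric_coord M c (fst q) (snd q) (snd q)"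
      by (rule continuous_attains_inf[OF _ False])
    then obtain q0 where q0: "q0 \<in> K \<times> sphere (0::'e) 1"
      "\<And>q. q \<in> K \<times> sphere (0::'e) 1 \<Longrightarrow> metric_coord M c (fst q0) (snd q0) (snd q0) \<le> metric_coord M c (fst q) (snd q) (snd q)"
      by blast
    have "metric_coord M c (fst q0) (snd q0) (snd q0) > 0"
      using q0(1) K(2) by (intro metric_coord_pos[OF c]) auto
    then show ?thesis using q0(2) by (intro exI[of _ "metric_coord M c (fst q0) (snd q0) (snd q0)"]) force
  qed
  then obtain l where l: "l > 0" "\<And>x w. x \<in> K \<Longrightarrow> norm w = 1 \<Longrightarrow> l \<le> metric_coord M c x w w" by auto
  have "l * (norm w)\<^sup>2 \<le> metric_coord M c x w w" if x: "x \<in> K" for x w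
  proof (cases "w = 0")
    case True
    have "x \<in> snd c ` fst c" using x K by auto
    then have "metric_coord M c x w w = 0" unfolding True using linear_0[OF metric_coord_linear_right[OF c]] by blast
    then show ?thesis by (simp add: True)
  next
    case False
    have x': "x \<in> snd c ` fst c" using x K by auto
    define e where "e = w /\<^sub>R norm w"
    have w: "w = norm w *\<^sub>R e" using False by (simp add: e_def)
    have "l \<le> metric_coord M c x e e" using False by (intro l x) (simp add: e_def)
    then have "l * (norm w)\<^sup>2 \<le> metric_coord M c x e e * (norm w)\<^sup>2" by (intro mult_right_mono) auto
    also have "\<dots> = metric_coord M c x (norm w *\<^sub>R e) (norm w *\<^sub>R e)"
      by (simp add: linear_scale[OF metric_coord_linear_left[OF c x']]
          linear_scale[OF metric_coord_linear_right[OF c x']] power2_eq_square)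
    finally show ?thesis using w by simp
  qed
  then show ?thesis using l(1) by blast
qed

text \<open>For basis vectors this is boundedness and Lipschitz continuity of smooth functions on a compact
  convex set; multilinearity turns the bounds on the basis into bounds for all arguments.\<close>

lemma metric_deriv_bounds:
  assumes c: "c \<in> atlas M" and K: "compact K" "convex K" "K \<subseteq> snd c ` fst c"
  shows "\<exists>L\<ge>0. \<forall>x\<in>K. \<forall>y\<in>K. \<forall>u v w.
    \<bar>metric_deriv c x u v w\<bar> \<le> L * norm u * norm v * norm w \<and>
    \<bar>metric_deriv c x u v w - metric_deriv c y u v w\<bar> \<le> L * norm (x - y) * norm u * norm v * norm w \<and>
    \<bar>metric_coord M c x u v - metric_coord M c y u v\<bar> \<le> L * norm (x - y) * norm u * norm v"
proof -
  have xU: "x \<in> snd c ` fst c" if "x \<in> K" for x using that K by auto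
  have "\<exists>B\<ge>0. \<forall>x\<in>K. norm (metric_deriv c x u v w) \<le> B" for u v w
    using K by (intro continuous_on_compact_bound continuous_on_subset[OF smooth_on_imp_continuous_on[OF smooth_metric_deriv[OF c]]]) auto
  then obtain B where B: "\<And>x u v w. x \<in> K \<Longrightarrow> \<bar>metric_deriv c x u v w\<bar> \<le> B u v w" "\<And>u v w. B u v w \<ge> 0"
    by (metis real_norm_def)
  have "\<exists>L\<ge>0. \<forall>x\<in>K. \<forall>y\<in>K. norm (metric_deriv c x u v w - metric_deriv c y u v w) \<le> L * norm (x - y)" for u v w
    by (rule smooth_on_lipschitz[OF smooth_metric_deriv[OF c] K])
  then obtain L where L: "\<And>x y u v w. x \<in> K \<Longrightarrow> y \<in> K \<Longrightarrow>
      \<bar>metric_deriv c x u v w - metric_deriv c y u v w\<bar> \<le> L u v w * norm (x - y)" "\<And>u v w. L u v w \<ge> 0"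
    by (metis real_norm_def)
  have "\<exists>L\<ge>0. \<forall>x\<in>K. \<forall>y\<in>K. norm (metric_coord M c x u v - metric_coord M c y u v) \<le> L * norm (x - y)" for u v
    by (rule smooth_on_lipschitz[OF smooth_metric_coord[OF c] K])
  then obtain N where N: "\<And>x y u v. x \<in> K \<Longrightarrow> y \<in> K \<Longrightarrow>
      \<bar>metric_coord M c x u v - metric_coord M c y u v\<bar> \<le> N u v * norm (x - y)" "\<And>u v. N u v \<ge> 0"
    by (metis real_norm_def)
  have tri: "\<bar>T u v w\<bar> \<le> (\<Sum>b\<in>onb. \<Sum>b'\<in>onb. \<Sum>b''\<in>onb. k b b' b'') * norm u * norm v * norm w"
    if lin: "\<And>v w. linear (\<lambda>u. T u v w)" "\<And>u w. linear (\<lambda>v. T u v w)" "\<And>u v. linear (\<lambda>w. T u v w)"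
      and k: "\<And>u v w. \<bar>T u v w\<bar> \<le> k u v w" for T :: "'e \<Rightarrow> 'e \<Rightarrow> 'e \<Rightarrow> real" and k u v w
  proof -
    have 1: "\<bar>T u v w\<bar> \<le> (\<Sum>b''\<in>onb. k u v b'') * norm w" for u v w
      using linear_onb_bound[OF lin(3), of u v "\<lambda>w. k u v w" w] k by simp
    have 2: "\<bar>T u v w\<bar> \<le> (\<Sum>b'\<in>onb. (\<Sum>b''\<in>onb. k u b' b'') * norm w) * norm v" for u v w
      using linear_onb_bound[OF lin(2), of u w "\<lambda>v. (\<Sum>b''\<in>onb. k u v b'') * norm w" v] 1 by simp
    have "\<bar>T u v w\<bar> \<le> (\<Sum>b\<in>onb. (\<Sum>b'\<in>onb. (\<Sum>b''\<in>onb. k b b' b'') * norm w) * norm v) * norm u"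
      using linear_onb_bound[OF lin(1), of v w "\<lambda>u. (\<Sum>b'\<in>onb. (\<Sum>b''\<in>onb. k u b' b'') * norm w) * norm v" u] 2 by simp
    then show ?thesis unfolding sum_distrib_right[symmetric] by (simp only: ac_simps)
  qed
  have bi: "\<bar>T u v\<bar> \<le> (\<Sum>b\<in>onb. \<Sum>b'\<in>onb. k b b') * norm u * norm v"
    if lin: "\<And>v. linear (\<lambda>u. T u v)" "\<And>u. linear (\<lambda>v. T u v)"
      and k: "\<And>u v. \<bar>T u v\<bar> \<le> k u v" for T :: "'e \<Rightarrow> 'e \<Rightarrow> real" and k u v
  proof -
    have 1: "\<bar>T u v\<bar> \<le> (\<Sum>b'\<in>onb. k u b') * norm v" for u v
      using linear_onb_bound[OF lin(2), of u "\<lambda>v. k u v" v] k by simp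
    have "\<bar>T u v\<bar> \<le> (\<Sum>b\<in>onb. (\<Sum>b'\<in>onb. k b b') * norm v) * norm u"
      using linear_onb_bound[OF lin(1), of v "\<lambda>u. (\<Sum>b'\<in>onb. k u b') * norm v" u] 1 by simp
    then show ?thesis unfolding sum_distrib_right[symmetric] by (simp only: ac_simps)
  qed
  define b1 where "b1 = (\<Sum>b\<in>onb. \<Sum>b'\<in>onb. \<Sum>b''\<in>onb. B b b' b'')"
  define b2 where "b2 = (\<Sum>b\<in>onb. \<Sum>b'\<in>onb. \<Sum>b''\<in>onb. L b b' b'')"
  define b3 where "b3 = (\<Sum>b\<in>onb. \<Sum>b'\<in>onb. N b b')"
  have pos: "b1 \<ge> 0" "b2 \<ge> 0" "b3 \<ge> 0" by (auto simp: b1_def b2_def b3_def intro!: sum_nonneg B L N)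
  have 1: "\<bar>metric_deriv c x u v w\<bar> \<le> b1 * norm u * norm v * norm w" if x: "x \<in> K" for x u v w
    unfolding b1_def by (rule tri) (intro metric_deriv_linear[OF c xU[OF x]] B x)+
  have 2: "\<bar>metric_deriv c x u v w - metric_deriv c y u v w\<bar> \<le> b2 * norm (x - y) * norm u * norm v * norm w"
    if x: "x \<in> K" "y \<in> K" for x y u v w
  proof -
    have "\<bar>metric_deriv c x u v w - metric_deriv c y u v w\<bar> \<le>
        (\<Sum>b\<in>onb. \<Sum>b'\<in>onb. \<Sum>b''\<in>onb. L b b' b'' * norm (x - y)) * norm u * norm v * norm w"
      by (rule tri) (intro linear_compose_sub metric_deriv_linear[OF c xU[OF x(1)]]
          metric_deriv_linear[OF c xU[OF x(2)]] L x)+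
    then show ?thesis by (simp add: b2_def sum_distrib_right[symmetric])
  qed
  have 3: "\<bar>metric_coord M c x u v - metric_coord M c y u v\<bar> \<le> b3 * norm (x - y) * norm u * norm v"
    if x: "x \<in> K" "y \<in> K" for x y u v
  proof -
    have "\<bar>metric_coord M c x u v - metric_coord M c y u v\<bar> \<le>
        (\<Sum>b\<in>onb. \<Sum>b'\<in>onb. N b b' * norm (x - y)) * norm u * norm v"
      by (rule bi) (intro linear_compose_sub metric_coord_linear_left[OF c xU[OF x(1)]]
          metric_coord_linear_left[OF c xU[OF x(2)]] metric_coord_linear_right[OF c xU[OF x(1)]]
          metric_coord_linear_right[OF c xU[OF x(2)]] N x)+
    then show ?thesis by (simp add: b3_def sum_distrib_right[symmetric])
  qed
  define m where "m = b1 + b2 + b3"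
  have m: "b1 \<le> m" "b2 \<le> m" "b3 \<le> m" using pos by (auto simp: m_def)
  have "m \<ge> 0" using pos by (simp add: m_def)
  moreover have "b1 * norm u * norm v * norm w \<le> m * norm u * norm v * norm w" for u v w :: 'e
    by (intro mult_right_mono m) auto
  moreover have "b2 * norm z * norm u * norm v * norm w \<le> m * norm z * norm u * norm v * norm w" for u v w z :: 'e
    by (intro mult_right_mono m) auto
  moreover have "b3 * norm z * norm u * norm v \<le> m * norm z * norm u * norm v" for u v z :: 'e
    by (intro mult_right_mono m) auto
  ultimately show ?thesis using 1 2 3 by (intro exI[of _ m]) (meson order_trans)
qed

text \<open>The bounds avoid inverting the metric. By coercivity, \<open>\<parallel>w\<parallel>\<^sup>2\<close> is bounded by a multiple of
  \<open>g\<^sub>x(w, w)\<close>. For \<open>w = \<Gamma>\<^sub>x(u, v)\<close> and for \<open>w = \<Gamma>\<^sub>x(u, v) - \<Gamma>\<^sub>y(u, v)\<close> the Koszul formula expresses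
  \<open>g\<^sub>x(w, w)\<close> by derivatives of the metric and is linear in the last \<open>w\<close>, so that one factor
  \<open>\<parallel>w\<parallel>\<close> cancels.\<close>

lemma christoffel_bounds:
  assumes c: "c \<in> atlas M" and K: "compact K" "convex K" "K \<subseteq> snd c ` fst c"
  shows "\<exists>L\<ge>0. \<forall>x\<in>K. \<forall>y\<in>K. \<forall>u v. norm (christoffel M c x u v) \<le> L * norm u * norm v \<and>
    norm (christoffel M c x u v - christoffel M c y u v) \<le> L * norm (x - y) * norm u * norm v"
proof -
  obtain l where l: "l > 0" "\<And>x w. x \<in> K \<Longrightarrow> l * (norm w)\<^sup>2 \<le> metric_coord M c x w w"
    using metric_coord_coercive[OF c K(1,3)] by blast
  obtain L where L: "L \<ge> 0" "\<And>x u v w. x \<in> K \<Longrightarrow> \<bar>metric_deriv c x u v w\<bar> \<le> L * norm u * norm v * norm w"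
    "\<And>x y u v w. x \<in> K \<Longrightarrow> y \<in> K \<Longrightarrow>
      \<bar>metric_deriv c x u v w - metric_deriv c y u v w\<bar> \<le> L * norm (x - y) * norm u * norm v * norm w"
    "\<And>x y u v. x \<in> K \<Longrightarrow> y \<in> K \<Longrightarrow>
      \<bar>metric_coord M c x u v - metric_coord M c y u v\<bar> \<le> L * norm (x - y) * norm u * norm v"
    using metric_deriv_bounds[OF c K] by (metis (no_types, lifting))
  have xU: "x \<in> snd c ` fst c" if "x \<in> K" for x using that K by auto
  \<comment> \<open>The cancellation of one factor \<open>norm w\<close>.\<close>
  have div: "norm w \<le> a / l" if "l * (norm w)\<^sup>2 \<le> a * norm w" "0 \<le> a" for w :: 'e and a
    using that l(1) by (cases "w = 0") (auto simp: power2_eq_square pos_le_divide_eq mult.commute)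
  define A where "A = 3 / 2 * L / l"
  have A0: "A \<ge> 0" using L l by (simp add: A_def)
  have bd: "norm (christoffel M c x u v) \<le> A * norm u * norm v" if x: "x \<in> K" for x u v
  proof -
    define w where "w = christoffel M c x u v"
    have "2 * metric_coord M c x w w \<le> 3 * (L * norm u * norm v * norm w)"
      using L(2)[OF x, of u v w] L(2)[OF x, of v u w] L(2)[OF x, of w u v]
      unfolding w_def koszul[OF c xU[OF x]] by (simp add: ac_simps)
    then have "l * (norm w)\<^sup>2 \<le> (3 / 2 * (L * norm u * norm v)) * norm w" using l(2)[OF x, of w] by simp
    then have "norm w \<le> (3 / 2 * (L * norm u * norm v)) / l" by (rule div) (use L in simp)
    then show ?thesis by (simp add: w_def A_def ac_simps)
  qed
  define B where "B = (3 / 2 * L + L * A) / l"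
  have B0: "B \<ge> 0" using L l A0 by (simp add: B_def)
  have lip: "norm (christoffel M c x u v - christoffel M c y u v) \<le> B * norm (x - y) * norm u * norm v"
    if x: "x \<in> K" "y \<in> K" for x y u v
  proof -
    define \<Gamma> where "\<Gamma> = christoffel M c y u v"
    define w where "w = christoffel M c x u v - \<Gamma>"
    have "2 * metric_coord M c x w w = 2 * metric_coord M c x (christoffel M c x u v) w - 2 * metric_coord M c y \<Gamma> w
        - 2 * (metric_coord M c x \<Gamma> w - metric_coord M c y \<Gamma> w)"
      by (subst (1) w_def) (simp add: linear_diff[OF metric_coord_linear_left[OF c xU[OF x(1)]]])
    also have "\<dots> = (metric_deriv c x u v w - metric_deriv c y u v w) + (metric_deriv c x v u w - metric_deriv c y v u w)
        - (metric_deriv c x w u v - metric_deriv c y w u v) - 2 * (metric_coord M c x \<Gamma> w - metric_coord M c y \<Gamma> w)"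
      unfolding \<Gamma>_def koszul[OF c xU[OF x(1)]] koszul[OF c xU[OF x(2)]] by simp
    also have "\<dots> \<le> 3 * (L * norm (x - y) * norm u * norm v * norm w) + 2 * (L * norm (x - y) * norm \<Gamma> * norm w)"
      using L(3)[OF x, of u v w] L(3)[OF x, of v u w] L(3)[OF x, of w u v] L(4)[OF x, of \<Gamma> w]
      by (simp add: ac_simps)
    also have "\<dots> \<le> 3 * (L * norm (x - y) * norm u * norm v * norm w)
        + 2 * (L * norm (x - y) * (A * norm u * norm v) * norm w)"
      using bd[OF x(2), of u v] L(1) unfolding \<Gamma>_def[symmetric]
      by (intro add_left_mono mult_left_mono mult_right_mono) auto
    finally have "l * (norm w)\<^sup>2 \<le> ((3 / 2 * L + L * A) * (norm (x - y) * norm u * norm v)) * norm w"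
      using l(2)[OF x(1), of w] by (simp add: algebra_simps)
    then have "norm w \<le> ((3 / 2 * L + L * A) * (norm (x - y) * norm u * norm v)) / l"
      by (rule div) (use L A0 in simp)
    then show ?thesis by (simp add: w_def \<Gamma>_def B_def ac_simps)
  qed
  define m where "m = A + B"
  have m: "A \<le> m" "B \<le> m" "m \<ge> 0" using A0 B0 by (auto simp: m_def)
  have "A * norm u * norm v \<le> m * norm u * norm v" for u v :: 'e
    by (intro mult_right_mono m) auto
  moreover have "B * norm z * norm u * norm v \<le> m * norm z * norm u * norm v" for u v z :: 'e
    by (intro mult_right_mono m) auto
  ultimately show ?thesis using bd lip m(3) by (intro exI[of _ m]) (meson order_trans)
qed

section \<open>Change of charts for the Levi-Civita connection\<close>

lemma has_derivative_metric:
  assumes c: "c \<in> atlas M" "f z \<in> snd c ` fst c" and z: "z \<in> Z"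
    and f: "(f has_derivative f') (at z within Z)" and g: "(g has_derivative g') (at z within Z)"
    and h: "(h has_derivative h') (at z within Z)"
  shows "((\<lambda>y. metric_coord M c (f y) (g y) (h y)) has_derivative
     (\<lambda>k. metric_deriv c (f z) (f' k) (g z) (h z) + metric_coord M c (f z) (g' k) (h z)
        + metric_coord M c (f z) (g z) (h' k))) (at z within Z)"
proof -
  let ?A = "\<lambda>q v. metric_coord M c (fst q) (snd q) v"
  let ?U = "snd c ` fst c"
  have "((\<lambda>q. metric_coord M c (fst q) (snd q) v) has_derivative
      (\<lambda>k. metric_deriv c (f z) (fst k) (g z) v + metric_coord M c (f z) (snd k) v)) (at (f z, g z))" for v
    using has_derivative_linear_family[where A = "\<lambda>x u. metric_coord M c x u v" and f = fst and g = snd and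
        z = "(f z, g z)" and Z = UNIV and S = ?U and D = "\<lambda>u w. metric_deriv c (f z) w u v" and f' = fst and g' = snd]
      open_chart_image[OF c(1)] c(2) metric_coord_linear_left[OF c(1)] has_derivative_metric_coord[OF c]
    by (simp add: has_derivative_fst has_derivative_snd)
  moreover have "open (?U \<times> (UNIV :: 'e set))" by (intro open_Times open_chart_image c) simp
  ultimately show ?thesis
    using has_derivative_linear_family[where A = ?A and f = "\<lambda>y. (f y, g y)" and g = h and z = z and Z = Z and
        S = "?U \<times> UNIV" and D = "\<lambda>v k. metric_deriv c (f z) (fst k) (g z) v + metric_coord M c (f z) (snd k) v"
        and f' = "\<lambda>k. (f' k, g' k)" and g' = h']
      z c metric_coord_linear_right[OF c(1)] has_derivative_Pair[OF f g] h by (simp add: mem_Times_iff)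
qed

lemma smooth_dtrans:
  "c \<in> atlas M \<Longrightarrow> d \<in> atlas M \<Longrightarrow> smooth_on (\<lambda>x. dtrans c d x u) (snd c ` (fst c \<inter> fst d))"
  unfolding dtrans_def by (rule smooth_on_frechet_derivative[OF smooth_transition])

definition dtrans_deriv :: "('a, 'e) chart \<Rightarrow> ('a, 'e) chart \<Rightarrow> 'e \<Rightarrow> 'e \<Rightarrow> 'e \<Rightarrow> 'e" where
  "dtrans_deriv c d x w u = frechet_derivative (\<lambda>x. dtrans c d x u) (at x) w"

lemma in_overlap_image: "c \<in> charts_at M p \<Longrightarrow> d \<in> charts_at M p \<Longrightarrow> snd c p \<in> snd c ` (fst c \<inter> fst d)"
  by (auto simp: charts_at_def)

lemma has_derivative_dtrans:
  assumes "c \<in> charts_at M p" "d \<in> charts_at M p"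
  shows "((\<lambda>x. dtrans c d x u) has_derivative (\<lambda>w. dtrans_deriv c d (snd c p) w u)) (at (snd c p))"
  unfolding dtrans_deriv_def using assms
  by (intro smooth_on_has_derivative[OF smooth_dtrans[of c d]]) (auto simp: charts_at_def)

text \<open>These are second derivatives of the transition map.\<close>

lemma dtrans_deriv_symmetric:
  assumes "c \<in> charts_at M p" "d \<in> charts_at M p"
  shows "dtrans_deriv c d (snd c p) w u = dtrans_deriv c d (snd c p) u w"
  unfolding dtrans_deriv_def dtrans_def
  by (rule second_derivative_symmetric[OF smooth_transition open_overlap_image in_overlap_image[OF assms]])
     (use assms in \<open>auto simp: charts_at_def\<close>)

text \<open>The derivative of the identity \<open>metric_coord_change\<close> with respect to the base point.\<close>

lemma metric_deriv_change:
  assumes c: "c \<in> charts_at M p" and d: "d \<in> charts_at M p"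
  defines "T \<equiv> dtrans c d (snd c p)" and "H \<equiv> dtrans_deriv c d (snd c p)"
  shows "metric_deriv c (snd c p) w u v = metric_deriv d (snd d p) (T w) (T u) (T v)
    + metric_coord M d (snd d p) (H w u) (T v) + metric_coord M d (snd d p) (T u) (H w v)"
proof -
  have a: "c \<in> atlas M" "d \<in> atlas M" "p \<in> fst c" "p \<in> fst d" using c d by (auto simp: charts_at_def)
  have eq: "(snd d \<circ> chart_inv c) (snd c p) = snd d p" using a by simp
  have im: "(snd d \<circ> chart_inv c) (snd c p) \<in> snd d ` fst d" unfolding eq using a by blast
  have "((\<lambda>x. metric_coord M d ((snd d \<circ> chart_inv c) x) (dtrans c d x u) (dtrans c d x v)) has_derivative
      (\<lambda>w. metric_deriv d (snd d p) (T w) (T u) (T v) + metric_coord M d (snd d p) (H w u) (T v)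
        + metric_coord M d (snd d p) (T u) (H w v))) (at (snd c p))"
    using has_derivative_metric[OF a(2) im UNIV_I has_derivative_transition[OF c d]
        has_derivative_dtrans[OF c d, of u] has_derivative_dtrans[OF c d, of v]]
    unfolding eq T_def H_def .
  then have "((\<lambda>x. metric_coord M c x u v) has_derivative
      (\<lambda>w. metric_deriv d (snd d p) (T w) (T u) (T v) + metric_coord M d (snd d p) (H w u) (T v)
        + metric_coord M d (snd d p) (T u) (H w v))) (at (snd c p))"
  proof (rule has_derivative_transform_within_open[OF _ open_overlap_image[OF a(1,2)] in_overlap_image[OF c d]])
    fix x assume "x \<in> snd c ` (fst c \<inter> fst d)"
    then obtain q where q: "q \<in> fst c" "q \<in> fst d" "x = snd c q" by blast
    have "metric_coord M c (snd c q) u v = metric_coord M d (snd d q) (dtrans c d (snd c q) u) (dtrans c d (snd c q) v)"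
      using q a by (intro metric_coord_change) (auto simp: charts_at_def)
    then show "metric_coord M d ((snd d \<circ> chart_inv c) x) (dtrans c d x u) (dtrans c d x v) = metric_coord M c x u v"
      using q a by simp
  qed
  then show ?thesis
    using has_derivative_unique[OF has_derivative_metric_coord[OF a(1), of "snd c p" u v]] a(3)
    by (metis (no_types, lifting) imageI)
qed

text \<open>Insert \<open>metric_deriv_change\<close> into the Koszul formula: of the six terms with second derivatives of
  the transition map, four cancel by their symmetry, and two combine to \<open>2 g(H u v, T z)\<close>.\<close>

lemma christoffel_change:
  assumes c: "c \<in> charts_at M p" and d: "d \<in> charts_at M p"
  defines "T \<equiv> dtrans c d (snd c p)"
  shows "christoffel M d (snd d p) (T u) (T v) =
    T (christoffel M c (snd c p) u v) - dtrans_deriv c d (snd c p) u v"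
proof -
  let ?H = "dtrans_deriv c d (snd c p)"
  have a: "c \<in> atlas M" "snd c p \<in> snd c ` fst c" "d \<in> atlas M" "snd d p \<in> snd d ` fst d"
    using c d by (auto simp: charts_at_def)
  show ?thesis
  proof (rule metric_coord_eqI[OF a(3,4)])
    fix z'
    \<comment> \<open>The differential of the transition map is onto, so it suffices to test against \<open>T z\<close>.\<close>
    define z where "z = dtrans d c (snd d p) z'"
    have z: "z' = T z" unfolding T_def z_def by (simp add: dtrans_cocycle[OF d c d] dtrans_self[OF d])
    have "2 * metric_coord M d (snd d p) (christoffel M d (snd d p) (T u) (T v)) (T z) =
        2 * metric_coord M c (snd c p) (christoffel M c (snd c p) u v) z
        - 2 * metric_coord M d (snd d p) (?H u v) (T z)"
      unfolding koszul[OF a(3,4)] koszul[OF a(1,2)] metric_deriv_change[OF c d] T_def[symmetric]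
      using metric_coord_symmetric[OF a(3,4), of "?H u z" "T v"] dtrans_deriv_symmetric[OF c d, of v u]
        dtrans_deriv_symmetric[OF c d, of z u] dtrans_deriv_symmetric[OF c d, of z v]
      by simp
    also have "metric_coord M c (snd c p) (christoffel M c (snd c p) u v) z =
        metric_coord M d (snd d p) (T (christoffel M c (snd c p) u v)) (T z)"
      unfolding T_def by (rule metric_coord_change[OF c d])
    finally show "metric_coord M d (snd d p) (christoffel M d (snd d p) (T u) (T v)) z' =
        metric_coord M d (snd d p) (T (christoffel M c (snd c p) u v) - ?H u v) z'"
      by (simp add: z linear_diff[OF metric_coord_linear_left[OF a(3,4)]])
  qed
qed

section \<open>Parallel fields along geodesics\<close>

lemma curve_nhd:
  assumes \<gamma>: "continuous_curve M \<gamma>" and t: "t \<in> {0..1}" and W: "openin (mtop M) W" "\<gamma> t \<in> W"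
  shows "\<exists>\<delta>>0. \<forall>s\<in>{0..1}. \<bar>s - t\<bar> < \<delta> \<longrightarrow> \<gamma> s \<in> W"
proof -
  have "openin (top_of_set {0..1}) {s \<in> {0..1}. \<gamma> s \<in> W}"
    using openin_continuous_map_preimage[OF \<gamma>[unfolded continuous_curve_def] W(1)] by simp
  then obtain \<delta> where "\<delta> > 0" "\<forall>s\<in>{0..1}. dist s t < \<delta> \<longrightarrow> s \<in> {s \<in> {0..1}. \<gamma> s \<in> W}"
    using t W(2) unfolding openin_euclidean_subtopology_iff by blast
  then show ?thesis by (auto simp: dist_real_def)
qed

lemma curve_topspace: "continuous_curve M \<gamma> \<Longrightarrow> t \<in> {0..1} \<Longrightarrow> \<gamma> t \<in> topspace (mtop M)"
  using continuous_map_image_subset_topspace[of "top_of_set {0..1}" "mtop M" \<gamma>]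
  by (auto simp: continuous_curve_def)

lemma curve_chart_nhd:
  assumes \<gamma>: "continuous_curve M \<gamma>" and t: "t \<in> {0..1}" and c: "c \<in> charts_at M (\<gamma> t)"
  shows "\<exists>\<delta>>0. \<forall>s\<in>{0..1}. \<bar>s - t\<bar> < \<delta> \<longrightarrow> c \<in> charts_at M (\<gamma> s)"
  using curve_nhd[OF \<gamma> t chart_domain(1)] c by (auto simp: charts_at_def)

lemma has_vector_derivative_chart_change:
  assumes \<gamma>: "continuous_curve M \<gamma>" and I: "I \<subseteq> {0..1}" and t: "t \<in> I"
    and c: "c \<in> charts_at M (\<gamma> t)" and d: "d \<in> charts_at M (\<gamma> t)"
    and x: "((snd c \<circ> \<gamma>) has_vector_derivative x') (at t within I)"
  shows "((snd d \<circ> \<gamma>) has_vector_derivative dtrans c d (snd c (\<gamma> t)) x') (at t within I)"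
proof -
  have t': "t \<in> {0..1}" using t I by blast
  obtain \<delta> where \<delta>: "\<delta> > 0" "\<And>s. s \<in> {0..1} \<Longrightarrow> \<bar>s - t\<bar> < \<delta> \<Longrightarrow> c \<in> charts_at M (\<gamma> s)"
    using curve_chart_nhd[OF \<gamma> t' c] by blast
  have "((\<lambda>s. (snd d \<circ> chart_inv c) ((snd c \<circ> \<gamma>) s)) has_derivative
      (\<lambda>k. dtrans c d (snd c (\<gamma> t)) (k *\<^sub>R x'))) (at t within I)"
    using has_derivative_transition[OF c d]
    by (intro has_derivative_compose[OF x[unfolded has_vector_derivative_def]])
       (simp only: comp_apply[of "snd c" \<gamma>])
  then have "((snd d \<circ> \<gamma>) has_derivative (\<lambda>k. dtrans c d (snd c (\<gamma> t)) (k *\<^sub>R x'))) (at t within I)"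
    by (rule has_derivative_transform_within[OF _ \<delta>(1) t])
       (use \<delta> I in \<open>auto simp: dist_real_def charts_at_def subset_iff\<close>)
  then show ?thesis
    by (simp add: has_vector_derivative_def linear_scale[OF linear_dtrans[OF c d]])
qed

text \<open>The derivative of \<open>V d = T (V c)\<close> along the curve, where \<open>T\<close> is the differential of the transition
  map, contains the second derivative of the transition map applied to the velocity and \<open>V c\<close>. This is
  exactly the correction term in \<open>christoffel_change\<close>.\<close>

lemma parallel_chart_change:
  assumes \<gamma>: "continuous_curve M \<gamma>" and I: "I \<subseteq> {0..1}" and t: "t \<in> I"
    and c: "c \<in> charts_at M (\<gamma> t)" and d: "d \<in> charts_at M (\<gamma> t)"
    and x: "((snd c \<circ> \<gamma>) has_vector_derivative x') (at t within I)"
    and V: "\<And>s. s \<in> I \<Longrightarrow> V s \<in> tangent_space M (\<gamma> s)"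
    and par: "((\<lambda>s. V s c) has_vector_derivative - christoffel M c (snd c (\<gamma> t)) x' (V t c)) (at t within I)"
  shows "((\<lambda>s. V s d) has_vector_derivative
     - christoffel M d (snd d (\<gamma> t)) (dtrans c d (snd c (\<gamma> t)) x') (V t d)) (at t within I)"
proof -
  have t': "t \<in> {0..1}" using t I by blast
  have a: "c \<in> atlas M" "d \<in> atlas M" using c d by (auto simp: charts_at_def)
  obtain \<delta>1 where \<delta>1: "\<delta>1 > 0" "\<And>s. s \<in> {0..1} \<Longrightarrow> \<bar>s - t\<bar> < \<delta>1 \<Longrightarrow> c \<in> charts_at M (\<gamma> s)"
    using curve_chart_nhd[OF \<gamma> t' c] by blast
  obtain \<delta>2 where \<delta>2: "\<delta>2 > 0" "\<And>s. s \<in> {0..1} \<Longrightarrow> \<bar>s - t\<bar> < \<delta>2 \<Longrightarrow> d \<in> charts_at M (\<gamma> s)"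
    using curve_chart_nhd[OF \<gamma> t' d] by blast
  let ?x = "snd c (\<gamma> t)"
  let ?O = "snd c ` (fst c \<inter> fst d)"
  have lin: "linear (dtrans c d y)" if "y \<in> ?O" for y
  proof -
    obtain q where "y = snd c q" "q \<in> fst c" "q \<in> fst d" using \<open>y \<in> ?O\<close> by blast
    then show ?thesis using linear_dtrans[of c q d] a by (simp add: charts_at_def)
  qed
  have "((\<lambda>s. dtrans c d ((snd c \<circ> \<gamma>) s) (V s c)) has_derivative
      (\<lambda>k. dtrans_deriv c d ?x (k *\<^sub>R x') (V t c) + dtrans c d ?x (k *\<^sub>R (- christoffel M c ?x x' (V t c))))) (at t within I)"
    using has_derivative_linear_family[where A = "dtrans c d" and f = "snd c \<circ> \<gamma>" and z = t and S = ?O and Z = I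
        and D = "\<lambda>u w. dtrans_deriv c d ?x w u" and g = "\<lambda>s. V s c", OF open_overlap_image[OF a] _ t lin _
        x[unfolded has_vector_derivative_def] par[unfolded has_vector_derivative_def]]
      has_derivative_dtrans[OF c d] in_overlap_image[OF c d] by simp
  then have "((\<lambda>s. V s d) has_derivative
      (\<lambda>k. dtrans_deriv c d ?x (k *\<^sub>R x') (V t c) + dtrans c d ?x (k *\<^sub>R (- christoffel M c ?x x' (V t c))))) (at t within I)"
  proof (rule has_derivative_transform_within[OF _ _ t])
    show "0 < min \<delta>1 \<delta>2" using \<delta>1 \<delta>2 by simp
    fix s assume s: "s \<in> I" "dist s t < min \<delta>1 \<delta>2"
    then have cd: "c \<in> charts_at M (\<gamma> s)" "d \<in> charts_at M (\<gamma> s)" using \<delta>1 \<delta>2 I by (auto simp: dist_real_def)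
    show "dtrans c d ((snd c \<circ> \<gamma>) s) (V s c) = V s d"
      unfolding comp_apply by (rule tangent_transform[OF V[OF s(1)] cd, symmetric])
  qed
  then show ?thesis
    unfolding has_vector_derivative_def
  proof (rule has_derivative_eq_rhs)
    have 1: "dtrans_deriv c d ?x (k *\<^sub>R x') u = k *\<^sub>R dtrans_deriv c d ?x x' u" for k u
      by (rule linear_scale[OF has_derivative_linear[OF has_derivative_dtrans[OF c d]]])
    have 2: "V t d = dtrans c d ?x (V t c)" by (rule tangent_transform[OF V[OF t] c d])
    show "(\<lambda>k. dtrans_deriv c d ?x (k *\<^sub>R x') (V t c) + dtrans c d ?x (k *\<^sub>R (- christoffel M c ?x x' (V t c)))) =
      (\<lambda>k. k *\<^sub>R - christoffel M d (snd d (\<gamma> t)) (dtrans c d ?x x') (V t d))"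
      unfolding 2 christoffel_change[OF c d] 1 linear_scale[OF linear_dtrans[OF c d]] linear_neg[OF linear_dtrans[OF c d]]
      by (simp add: algebra_simps)
  qed
qed

lemma geodesicD:
  assumes "geodesic M \<gamma>"
  shows "continuous_curve M \<gamma>" "parallel_field M \<gamma> (velocity M \<gamma>)"
    and "\<And>t. t \<in> {0..1} \<Longrightarrow> velocity M \<gamma> t \<in> tangent_space M (\<gamma> t)"
    and "\<And>t c. t \<in> {0..1} \<Longrightarrow> c \<in> charts_at M (\<gamma> t) \<Longrightarrow>
      ((snd c \<circ> \<gamma>) has_vector_derivative velocity M \<gamma> t c) (at t within {0..1})"
    and "\<And>t c. t \<in> {0..1} \<Longrightarrow> c \<in> charts_at M (\<gamma> t) \<Longrightarrow>
      ((\<lambda>s. velocity M \<gamma> s c) has_vector_derivative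
        - christoffel M c (snd c (\<gamma> t)) (velocity M \<gamma> t c) (velocity M \<gamma> t c)) (at t within {0..1})"
  using assms by (auto simp: geodesic_def parallel_field_def velocity_def vector_derivative_works)

text \<open>By metric compatibility the derivative vanishes. With \<open>V = W\<close> the velocity, this is the constant
  speed of geodesics; with \<open>V = W\<close> a difference of parallel fields, it is the uniqueness of parallel
  transport.\<close>

lemma parallel_inner_constant:
  assumes \<gamma>: "geodesic M \<gamma>" and V: "parallel_field M \<gamma> V" and W: "parallel_field M \<gamma> W" and t: "t \<in> {0..1}"
  shows "metric M (\<gamma> t) (V t) (W t) = metric M (\<gamma> 0) (V 0) (W 0)"
proof -
  have "((\<lambda>t. metric M (\<gamma> t) (V t) (W t)) has_derivative (\<lambda>k. 0)) (at t within {0..1})" if t: "t \<in> {0..1}" for t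
  proof -
    obtain c where c: "c \<in> charts_at M (\<gamma> t)" using charts_nonempty curve_topspace geodesicD(1)[OF \<gamma>] t by blast
    have a: "c \<in> atlas M" "snd c (\<gamma> t) \<in> snd c ` fst c" using c by (auto simp: charts_at_def)
    obtain \<delta> where \<delta>: "\<delta> > 0" "\<And>s. s \<in> {0..1} \<Longrightarrow> \<bar>s - t\<bar> < \<delta> \<Longrightarrow> c \<in> charts_at M (\<gamma> s)"
      using curve_chart_nhd[OF geodesicD(1)[OF \<gamma>] t c] by blast
    let ?v = "velocity M \<gamma> t c" and ?x = "snd c (\<gamma> t)"
    have dV: "((\<lambda>s. V s c) has_derivative (\<lambda>k. k *\<^sub>R - christoffel M c ?x ?v (V t c))) (at t within {0..1})"
      using V t c by (simp add: parallel_field_def has_vector_derivative_def)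
    have dW: "((\<lambda>s. W s c) has_derivative (\<lambda>k. k *\<^sub>R - christoffel M c ?x ?v (W t c))) (at t within {0..1})"
      using W t c by (simp add: parallel_field_def has_vector_derivative_def)
    have im: "(snd c \<circ> \<gamma>) t \<in> snd c ` fst c" using a by simp
    note lin = linear_scale[OF metric_deriv_linear(1)[OF a]] linear_scale[OF christoffel_linear(1)[OF a]] linear_neg[OF metric_coord_linear_left[OF a]]
      linear_scale[OF metric_coord_linear_left[OF a]] linear_neg[OF metric_coord_linear_right[OF a]]
      linear_scale[OF metric_coord_linear_right[OF a]]
    have "((\<lambda>s. metric_coord M c ((snd c \<circ> \<gamma>) s) (V s c) (W s c)) has_derivative (\<lambda>k. 0)) (at t within {0..1})"
      by (rule has_derivative_eq_rhs[OF has_derivative_metric[OF a(1) im t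
            geodesicD(4)[OF \<gamma> t c, unfolded has_vector_derivative_def] dV dW]])
         (simp add: lin metric_compatible[OF a] fun_eq_iff algebra_simps)
    then show ?thesis
    proof (rule has_derivative_transform_within[OF _ \<delta>(1) t])
      fix s assume s: "s \<in> {0..1}" "dist s t < \<delta>"
      then have "c \<in> charts_at M (\<gamma> s)" using \<delta> by (simp add: dist_real_def)
      then show "metric_coord M c ((snd c \<circ> \<gamma>) s) (V s c) (W s c) = metric M (\<gamma> s) (V s) (W s)"
        using V W s by (simp add: metric_eq_coord parallel_field_def)
    qed
  qed
  then obtain k where "\<And>t. t \<in> {0..1} \<Longrightarrow> metric M (\<gamma> t) (V t) (W t) = k"
    using has_derivative_zero_constant[of "{0..1::real}" "\<lambda>t. metric M (\<gamma> t) (V t) (W t)"] by auto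
  then show ?thesis using t by simp
qed

lemma metric_zero: "p \<in> topspace (mtop M) \<Longrightarrow> X \<in> tangent_space M p \<Longrightarrow> metric M p 0 X = 0"
  using metric_linear_left[of p X X X 0 0] by simp

lemma parallel_diff:
  assumes "parallel_field M \<gamma> V" "parallel_field M \<gamma> W"
  shows "parallel_field M \<gamma> (\<lambda>t. V t - W t)"
  unfolding parallel_field_def
proof (intro ballI conjI)
  fix t :: real assume t: "t \<in> {0..1}"
  show "V t - W t \<in> tangent_space M (\<gamma> t)" using assms t by (simp add: parallel_field_def tangent_diff)
  fix c assume c: "c \<in> charts_at M (\<gamma> t)"
  then have a: "c \<in> atlas M" "snd c (\<gamma> t) \<in> snd c ` fst c" by (auto simp: charts_at_def)
  let ?\<Gamma> = "christoffel M c (snd c (\<gamma> t)) (velocity M \<gamma> t c)"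
  have "((\<lambda>s. V s c - W s c) has_vector_derivative - ?\<Gamma> (V t c) - (- ?\<Gamma> (W t c))) (at t within {0..1})"
    using assms t c by (intro has_vector_derivative_diff) (auto simp: parallel_field_def)
  then show "((\<lambda>s. (V s - W s) c) has_vector_derivative - ?\<Gamma> ((V t - W t) c)) (at t within {0..1})"
    by (simp add: linear_diff[OF christoffel_linear(2)[OF a]])
qed

lemma parallel_unique:
  assumes \<gamma>: "geodesic M \<gamma>" and V: "parallel_field M \<gamma> V" and W: "parallel_field M \<gamma> W"
    and init: "V 0 = W 0" and t: "t \<in> {0..1}"
  shows "V t = W t"
proof (rule ccontr)
  assume "V t \<noteq> W t"
  note D = parallel_diff[OF V W]
  have top: "\<gamma> s \<in> topspace (mtop M)" if "s \<in> {0..1}" for s using curve_topspace[OF geodesicD(1)[OF \<gamma>] that] .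
  have tan: "V s - W s \<in> tangent_space M (\<gamma> s)" if "s \<in> {0..1}" for s using D that by (simp add: parallel_field_def)
  have "metric M (\<gamma> t) (V t - W t) (V t - W t) > 0"
    using \<open>V t \<noteq> W t\<close> by (intro metric_pos top tan t) simp
  moreover have "metric M (\<gamma> t) (V t - W t) (V t - W t) = 0"
    using parallel_inner_constant[OF \<gamma> D D t] metric_zero[OF top tan, of 0] by (simp add: init)
  ultimately show False by simp
qed

section \<open>Existence of parallel transport\<close>

lemma christoffel_continuous_on:
  assumes c: "c \<in> atlas M" and K: "compact K" "convex K" "K \<subseteq> snd c ` fst c"
    and f: "continuous_on S f" "f ` S \<subseteq> K" and g: "continuous_on S g"
  shows "continuous_on S (\<lambda>s. christoffel M c (f s) (g s) u)"
proof -
  obtain L where L: "L \<ge> 0" "\<And>x y u v. x \<in> K \<Longrightarrow> y \<in> K \<Longrightarrow>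
      norm (christoffel M c x u v - christoffel M c y u v) \<le> L * norm (x - y) * norm u * norm v"
    using christoffel_bounds[OF c K] by blast
  have "continuous_on K (\<lambda>x. christoffel M c x v u)" for v
  proof (rule lipschitz_on_continuous_on[OF lipschitz_onI])
    fix x y assume "x \<in> K" "y \<in> K"
    from L(2)[OF this, of v u]
    show "dist (christoffel M c x v u) (christoffel M c y v u) \<le> (L * norm v * norm u) * dist x y"
      by (simp add: dist_norm ac_simps)
  qed (use L in simp)
  then have cont: "continuous_on S (\<lambda>s. christoffel M c (f s) v u)" for v
    using continuous_on_compose2[OF _ f] by blast
  have "continuous_on S (\<lambda>s. \<Sum>b\<in>onb. (g s \<bullet> b) *\<^sub>R christoffel M c (f s) b u)"
    by (intro continuous_intros g cont)
  then show ?thesis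
  proof (rule continuous_on_eq)
    fix s assume "s \<in> S"
    then have "f s \<in> snd c ` fst c" using f K by auto
    from linear_onb_expansion[OF christoffel_linear(1)[OF c this, of u], of "g s"]
    show "(\<Sum>b\<in>onb. (g s \<bullet> b) *\<^sub>R christoffel M c (f s) b u) = christoffel M c (f s) (g s) u" by simp
  qed
qed

text \<open>The velocity is always that of the whole curve, with derivatives within \<open>{0..1}\<close>; only the
  derivative of \<open>V\<close> is taken within \<open>{a..b}\<close>. Hence \<open>parallel_on \<gamma> 0 1\<close> is \<open>parallel_field M \<gamma>\<close>.\<close>

definition parallel_on :: "(real \<Rightarrow> 'a) \<Rightarrow> real \<Rightarrow> real \<Rightarrow> (real \<Rightarrow> ('a, 'e) tvec) \<Rightarrow> bool" where
  "parallel_on \<gamma> a b V \<longleftrightarrow>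
     (\<forall>t\<in>{a..b}. V t \<in> tangent_space M (\<gamma> t) \<and>
        (\<forall>c\<in>charts_at M (\<gamma> t).
           ((\<lambda>s. V s c) has_vector_derivative
              - christoffel M c (snd c (\<gamma> t)) (velocity M \<gamma> t c) (V t c)) (at t within {a..b})))"

lemma parallel_on_join:
  assumes V: "parallel_on \<gamma> a b V" and W: "parallel_on \<gamma> b c W" and ab: "a \<le> b" "b \<le> c" and eq: "V b = W b"
  shows "parallel_on \<gamma> a c (\<lambda>t. if t \<le> b then V t else W t)" (is "parallel_on \<gamma> a c ?U")
  unfolding parallel_on_def
proof (intro ballI conjI)
  fix t assume t: "t \<in> {a..c}"
  show "?U t \<in> tangent_space M (\<gamma> t)" using V W t by (auto simp: parallel_on_def)
  fix d assume d: "d \<in> charts_at M (\<gamma> t)"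
  let ?D = "- christoffel M d (snd d (\<gamma> t)) (velocity M \<gamma> t d) (?U t d)"
  have VU: "?U s = V s" if "s \<in> {a..b}" for s using that by auto
  have WU: "?U s = W s" if "s \<in> {b..c}" for s using that eq by auto
  have bl: "bounded_linear (\<lambda>k. k *\<^sub>R ?D)" by (rule bounded_linear_scaleR_left)
  have 1: "((\<lambda>s. ?U s d) has_derivative (\<lambda>k. k *\<^sub>R ?D)) (at t within {a..b})"
  proof (cases "t \<in> {a..b}")
    case True
    then have "((\<lambda>s. V s d) has_derivative (\<lambda>k. k *\<^sub>R ?D)) (at t within {a..b})"
      using V d by (auto simp: parallel_on_def has_vector_derivative_def)
    then show ?thesis by (rule has_derivative_transform_within[OF _ zero_less_one True]) (simp add: VU)
  next
    case False
    then have "at t within {a..b} = bot" by (simp add: at_within_eq_bot_iff)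
    then show ?thesis using bl by (simp only: has_derivative_def tendsto_bot simp_thms)
  qed
  have 2: "((\<lambda>s. ?U s d) has_derivative (\<lambda>k. k *\<^sub>R ?D)) (at t within {b..c})"
  proof (cases "t \<in> {b..c}")
    case True
    then have "((\<lambda>s. W s d) has_derivative (\<lambda>k. k *\<^sub>R ?D)) (at t within {b..c})"
      using W d WU[OF True] by (auto simp: parallel_on_def has_vector_derivative_def)
    then show ?thesis
      by (rule has_derivative_transform_within[OF _ zero_less_one True]) (simp add: WU[symmetric])
  next
    case False
    then have "at t within {b..c} = bot" by (simp add: at_within_eq_bot_iff)
    then show ?thesis using bl by (simp only: has_derivative_def tendsto_bot simp_thms)
  qed
  have "{a..c} = {a..b} \<union> {b..c}" using ab by auto
  then show "((\<lambda>s. ?U s d) has_vector_derivative ?D) (at t within {a..c})"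
    unfolding has_vector_derivative_def using has_derivative_within_Un[OF 1 2] by simp
qed

lemma geodesic_local_bounds:
  assumes \<gamma>: "geodesic M \<gamma>" and t: "t \<in> {0..1}" and c: "c \<in> charts_at M (\<gamma> t)" and r: "r > 0"
  shows "\<exists>R\<ge>0. \<exists>\<delta>>0. \<forall>s\<in>{0..1}. \<bar>s - t\<bar> < \<delta> \<longrightarrow> c \<in> charts_at M (\<gamma> s) \<and>
    snd c (\<gamma> s) \<in> cball (snd c (\<gamma> t)) r \<and> norm (velocity M \<gamma> s c) \<le> R"
proof -
  obtain \<delta>1 where \<delta>1: "\<delta>1 > 0" "\<And>s. s \<in> {0..1} \<Longrightarrow> \<bar>s - t\<bar> < \<delta>1 \<Longrightarrow> c \<in> charts_at M (\<gamma> s)"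
    using curve_chart_nhd[OF geodesicD(1)[OF \<gamma>] t c] by blast
  have "continuous (at t within {0..1}) (snd c \<circ> \<gamma>)"
    using geodesicD(4)[OF \<gamma> t c] by (rule has_vector_derivative_continuous)
  then obtain \<delta>2 where \<delta>2: "\<delta>2 > 0" "\<And>s. s \<in> {0..1} \<Longrightarrow> dist s t < \<delta>2 \<Longrightarrow> dist ((snd c \<circ> \<gamma>) s) ((snd c \<circ> \<gamma>) t) < r"
    using r unfolding continuous_within_eps_delta by meson
  have "continuous (at t within {0..1}) (\<lambda>s. velocity M \<gamma> s c)"
    using geodesicD(5)[OF \<gamma> t c] by (rule has_vector_derivative_continuous)
  then obtain \<delta>3 where \<delta>3: "\<delta>3 > 0" "\<And>s. s \<in> {0..1} \<Longrightarrow> dist s t < \<delta>3 \<Longrightarrow> dist (velocity M \<gamma> s c) (velocity M \<gamma> t c) < 1"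
    unfolding continuous_within_eps_delta by (meson zero_less_one)
  have "norm (velocity M \<gamma> s c) \<le> norm (velocity M \<gamma> t c) + 1" if "s \<in> {0..1}" "\<bar>s - t\<bar> < \<delta>3" for s
    using \<delta>3(2)[of s] that norm_triangle_sub[of "velocity M \<gamma> s c" "velocity M \<gamma> t c"]
    by (simp add: dist_norm)
  then have "\<forall>s\<in>{0..1}. \<bar>s - t\<bar> < min \<delta>1 (min \<delta>2 \<delta>3) \<longrightarrow> c \<in> charts_at M (\<gamma> s) \<and>
    snd c (\<gamma> s) \<in> cball (snd c (\<gamma> t)) r \<and> norm (velocity M \<gamma> s c) \<le> norm (velocity M \<gamma> t c) + 1"
    using \<delta>1 \<delta>2 by (force simp: dist_real_def dist_commute)
  moreover have "min \<delta>1 (min \<delta>2 \<delta>3) > 0" "norm (velocity M \<gamma> t c) + 1 \<ge> 0" using \<delta>1 \<delta>2 \<delta>3 by auto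
  ultimately show ?thesis by blast
qed

text \<open>Near \<open>t\<close> the curve stays in one chart, where the transport equation is a linear equation with
  continuous bounded coefficients. The length \<open>\<delta>\<close> does not depend on the initial value, which is what
  allows solutions to be joined.\<close>

lemma parallel_local_existence:
  assumes \<gamma>: "geodesic M \<gamma>" and t: "t \<in> {0..1}"
  shows "\<exists>\<delta>>0. \<forall>a b. 0 \<le> a \<and> b \<le> 1 \<and> a \<le> t \<and> t \<le> b \<and> b - a < \<delta> \<longrightarrow>
    (\<forall>X\<in>tangent_space M (\<gamma> a). \<exists>V. parallel_on \<gamma> a b V \<and> V a = X)"
proof -
  obtain c where c: "c \<in> charts_at M (\<gamma> t)" using charts_nonempty curve_topspace geodesicD(1)[OF \<gamma>] t by blast
  have a: "c \<in> atlas M" "snd c (\<gamma> t) \<in> snd c ` fst c" using c by (auto simp: charts_at_def)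
  obtain r where r: "r > 0" "cball (snd c (\<gamma> t)) r \<subseteq> snd c ` fst c"
    using open_chart_image[OF a(1)] a(2) open_contains_cball by blast
  let ?K = "cball (snd c (\<gamma> t)) r"
  have K: "compact ?K" "convex ?K" "?K \<subseteq> snd c ` fst c" using r by auto
  obtain R \<delta>1 where R: "R \<ge> 0" "\<delta>1 > 0" "\<And>s. s \<in> {0..1} \<Longrightarrow> \<bar>s - t\<bar> < \<delta>1 \<Longrightarrow> c \<in> charts_at M (\<gamma> s) \<and>
      snd c (\<gamma> s) \<in> ?K \<and> norm (velocity M \<gamma> s c) \<le> R"
    using geodesic_local_bounds[OF \<gamma> t c r(1)] by blast
  obtain L where L: "L \<ge> 0" "\<And>x u v. x \<in> ?K \<Longrightarrow> norm (christoffel M c x u v) \<le> L * norm u * norm v"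
    using christoffel_bounds[OF a(1) K] by blast
  \<comment> \<open>The coefficients of the equation are bounded by \<open>L * R\<close>, so intervals shorter than
      \<open>1 / (2 * N)\<close> are short enough for \<open>linear_ode_local_existence\<close>.\<close>
  define N where "N = real (card (onb :: 'e set)) * (L * R) + 1"
  have N: "N \<ge> 1" using L R by (simp add: N_def)
  define \<delta> where "\<delta> = min \<delta>1 (1 / (2 * N))"
  have "\<delta> > 0" using R N by (simp add: \<delta>_def)
  moreover have "\<exists>V. parallel_on \<gamma> a b V \<and> V a = X"
    if ab: "0 \<le> a" "b \<le> 1" "a \<le> t" "t \<le> b" "b - a < \<delta>" and X: "X \<in> tangent_space M (\<gamma> a)" for a b X
  proof -
    have sub: "{a..b} \<subseteq> {0..1}" using ab by auto
    have near: "c \<in> charts_at M (\<gamma> s)" "snd c (\<gamma> s) \<in> ?K" "norm (velocity M \<gamma> s c) \<le> R" if "s \<in> {a..b}" for s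
      using R(3)[of s] that ab sub by (auto simp: \<delta>_def)
    have aa: "snd c (\<gamma> s) \<in> snd c ` fst c" if "s \<in> {a..b}" for s using near[OF that] K by blast
    define A where "A s u = - christoffel M c (snd c (\<gamma> s)) (velocity M \<gamma> s c) u" for s u
    have der: "((snd c \<circ> \<gamma>) has_vector_derivative velocity M \<gamma> s c) (at s within {a..b})" if "s \<in> {a..b}" for s
      using geodesicD(4)[OF \<gamma> _ near(1)[OF that]] that sub has_vector_derivative_within_subset by blast
    have derv: "\<exists>D. ((\<lambda>s. velocity M \<gamma> s c) has_vector_derivative D) (at s within {a..b})" if "s \<in> {a..b}" for s
      using geodesicD(5)[OF \<gamma> _ near(1)[OF that]] that sub has_vector_derivative_within_subset by blast
    have "\<exists>U. U a = X c \<and> (\<forall>s\<in>{a..b}. (U has_vector_derivative A s (U s)) (at s within {a..b}))"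
    proof (rule linear_ode_local_existence[where K = "L * R"])
      fix s u assume s: "s \<in> {a..b}"
      show "linear (A s)" unfolding A_def by (intro linear_compose_neg christoffel_linear a aa s)
      have "norm (A s u) \<le> L * norm (velocity M \<gamma> s c) * norm u" unfolding A_def using L(2) near[OF s] by simp
      also have "\<dots> \<le> L * R * norm u" using near[OF s] L by (intro mult_right_mono mult_left_mono) auto
      finally show "norm (A s u) \<le> L * R * norm u" .
    next
      fix u
      have "continuous_on {a..b} (\<lambda>s. velocity M \<gamma> s c)"
        using derv unfolding continuous_on_eq_continuous_within by (meson has_vector_derivative_continuous)
      moreover have "continuous_on {a..b} (\<lambda>s. snd c (\<gamma> s))"
        using continuous_on_vector_derivative[OF der] by (simp add: o_def)
      ultimately show "continuous_on {a..b} (\<lambda>s. A s u)" unfolding A_def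
        using near by (intro continuous_intros christoffel_continuous_on[OF a(1) K]) auto
    next
      have "real (card (onb :: 'e set)) * (L * R * (b - a)) \<le> N * (b - a)"
        using ab by (simp add: N_def mult.assoc[symmetric] distrib_right)
      also have "\<dots> \<le> N * (1 / (2 * N))" using ab N by (intro mult_left_mono) (auto simp: \<delta>_def)
      also have "\<dots> = 1 / 2" using N by simp
      finally show "real (card (onb :: 'e set)) * (L * R * (b - a)) \<le> 1 / 2" .
    qed (use ab in simp)
    then obtain U where U: "U a = X c" "\<And>s. s \<in> {a..b} \<Longrightarrow> (U has_vector_derivative A s (U s)) (at s within {a..b})"
      by blast
    define V where "V s = coord_vec M c (\<gamma> s) (U s)" for s
    have Vc: "V s c = U s" if "s \<in> {a..b}" for s using near[OF that] by (simp add: V_def)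
    have Vt: "V s \<in> tangent_space M (\<gamma> s)" if "s \<in> {a..b}" for s
      using near[OF that] by (simp add: V_def coord_vec_tangent)
    have Vd: "((\<lambda>s. V s c) has_vector_derivative - christoffel M c (snd c (\<gamma> s)) (velocity M \<gamma> s c) (V s c)) (at s within {a..b})"
      if s: "s \<in> {a..b}" for s
      unfolding Vc[OF s] by (rule has_vector_derivative_transform[OF s Vc U(2)[OF s, unfolded A_def]])
    have "((\<lambda>s. V s d) has_vector_derivative - christoffel M d (snd d (\<gamma> s)) (velocity M \<gamma> s d) (V s d)) (at s within {a..b})"
      if s: "s \<in> {a..b}" and d: "d \<in> charts_at M (\<gamma> s)" for s d
    proof -
      have "velocity M \<gamma> s d = dtrans c d (snd c (\<gamma> s)) (velocity M \<gamma> s c)"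
        using tangent_transform[OF geodesicD(3)[OF \<gamma>] near(1)[OF s] d] s sub by blast
      then show ?thesis
        using parallel_chart_change[OF geodesicD(1)[OF \<gamma>] sub s near(1)[OF s] d der[OF s] Vt Vd[OF s]] by simp
    qed
    then have "parallel_on \<gamma> a b V" using Vt by (simp add: parallel_on_def)
    moreover have "V a = X"
      using tangent_eqI[OF Vt X near(1)] Vc U(1) ab by simp
    ultimately show ?thesis by blast
  qed
  ultimately show ?thesis by blast
qed

text \<open>Solvability on \<open>{a..b}\<close> for all initial values passes to adjacent intervals, by joining, and holds
  locally. By compactness of the unit interval it holds on \<open>{0..1}\<close>.\<close>

lemma parallel_existence:
  assumes \<gamma>: "geodesic M \<gamma>" and X: "X \<in> tangent_space M (\<gamma> 0)"
  shows "\<exists>V. parallel_field M \<gamma> V \<and> V 0 = X"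
proof -
  define P where "P a b \<longleftrightarrow> (0 \<le> a \<and> b \<le> 1 \<longrightarrow>
    (\<forall>X\<in>tangent_space M (\<gamma> a). \<exists>V. parallel_on \<gamma> a b V \<and> V a = X))" for a b
  have "P 0 1"
  proof (rule Bolzano)
    fix a b c :: real assume P: "P a b" "P b c" and le: "a \<le> b" "b \<le> c"
    show "P a c" unfolding P_def
    proof (intro impI ballI)
      fix X assume ac: "0 \<le> a \<and> c \<le> 1" and X: "X \<in> tangent_space M (\<gamma> a)"
      obtain V where V: "parallel_on \<gamma> a b V" "V a = X" using P(1) ac le X by (auto simp: P_def)
      have "V b \<in> tangent_space M (\<gamma> b)" using V(1) le by (auto simp: parallel_on_def)
      then obtain W where W: "parallel_on \<gamma> b c W" "W b = V b" using P(2) ac le by (auto simp: P_def)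
      show "\<exists>V. parallel_on \<gamma> a c V \<and> V a = X"
        using parallel_on_join[OF V(1) W(1) le W(2)[symmetric]] V(2) le
        by (intro exI[of _ "\<lambda>t. if t \<le> b then V t else W t"]) simp
    qed
  next
    fix x :: real assume "0 \<le> x" "x \<le> 1"
    then obtain \<delta> where "\<delta> > 0" "\<forall>a b. 0 \<le> a \<and> b \<le> 1 \<and> a \<le> x \<and> x \<le> b \<and> b - a < \<delta> \<longrightarrow>
        (\<forall>X\<in>tangent_space M (\<gamma> a). \<exists>V. parallel_on \<gamma> a b V \<and> V a = X)"
      using parallel_local_existence[OF \<gamma>, of x] by auto
    then show "\<exists>d>0. \<forall>a b. a \<le> x \<and> x \<le> b \<and> b - a < d \<longrightarrow> P a b"
      unfolding P_def by (intro exI[of _ \<delta>]) blast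
  qed simp
  then show ?thesis using X by (auto simp: P_def parallel_on_def parallel_field_def)
qed

lemma transport_along_tangent:
  assumes \<gamma>: "geodesic M \<gamma>" and X: "X \<in> tangent_space M (\<gamma> 0)"
  shows "transport_along M \<gamma> X \<in> tangent_space M (\<gamma> 1)"
proof -
  obtain V where V: "parallel_field M \<gamma> V" "V 0 = X" using parallel_existence[OF assms] by blast
  have "transport_along M \<gamma> X = V 1"
    unfolding transport_along_def
  proof (rule the_equality)
    show "\<exists>W. parallel_field M \<gamma> W \<and> W 0 = X \<and> W 1 = V 1" using V by blast
    fix Y assume "\<exists>W. parallel_field M \<gamma> W \<and> W 0 = X \<and> W 1 = Y"
    then obtain W where W: "parallel_field M \<gamma> W" "W 0 = X" "W 1 = Y" by blast
    then show "Y = V 1" using parallel_unique[OF \<gamma> W(1) V(1), of 1] V(2) by simp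
  qed
  then show ?thesis using V(1) by (simp add: parallel_field_def)
qed

section \<open>Geodesics are determined by their initial velocity\<close>

text \<open>Agreement of position and velocity at \<open>a\<close> implies agreement at \<open>b\<close>: this property of \<open>(a, b)\<close> is
  transitive, so by compactness of the interval it only has to be shown for short intervals around a
  point \<open>x\<close>. If the curves differ at \<open>x\<close>, they differ nearby and the hypothesis is never satisfied.
  If they meet at \<open>x\<close>, both solve in a common chart the first-order system for position and velocity,
  whose right-hand side is Lipschitz for bounded velocities.\<close>

lemma geodesic_unique:
  assumes \<gamma>: "geodesic M \<gamma>" and \<sigma>: "geodesic M \<sigma>" and init: "\<gamma> 0 = \<sigma> 0" "velocity M \<gamma> 0 = velocity M \<sigma> 0"
    and t: "t \<in> {0..1}"
  shows "\<gamma> t = \<sigma> t"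
proof -
  define P where "P a b \<longleftrightarrow> (0 \<le> a \<and> b \<le> 1 \<and> \<gamma> a = \<sigma> a \<and> velocity M \<gamma> a = velocity M \<sigma> a \<longrightarrow>
    \<gamma> b = \<sigma> b \<and> velocity M \<gamma> b = velocity M \<sigma> b)" for a b
  have "P 0 t"
  proof (rule Bolzano)
    show "0 \<le> t" using t by simp
    fix a b c :: real assume "P a b" "P b c" "a \<le> b" "b \<le> c"
    then show "P a c" by (auto simp: P_def)
  next
    fix x :: real assume "0 \<le> x" "x \<le> t"
    then have x: "x \<in> {0..1}" using t by simp
    note top = curve_topspace[OF geodesicD(1)[OF \<gamma>] x] curve_topspace[OF geodesicD(1)[OF \<sigma>] x]
    show "\<exists>d>0. \<forall>a b. a \<le> x \<and> x \<le> b \<and> b - a < d \<longrightarrow> P a b"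
    proof (cases "\<gamma> x = \<sigma> x")
      case False
      have "Hausdorff_space (mtop M)" using smooth_manifold by (simp add: smooth_manifold_def)
      then obtain W1 W2 where W: "openin (mtop M) W1" "openin (mtop M) W2" "\<gamma> x \<in> W1" "\<sigma> x \<in> W2" "disjnt W1 W2"
        using top False unfolding Hausdorff_space_def by meson
      obtain \<delta>1 where \<delta>1: "\<delta>1 > 0" "\<forall>s\<in>{0..1}. \<bar>s - x\<bar> < \<delta>1 \<longrightarrow> \<gamma> s \<in> W1"
        using curve_nhd[OF geodesicD(1)[OF \<gamma>] x W(1,3)] by blast
      obtain \<delta>2 where \<delta>2: "\<delta>2 > 0" "\<forall>s\<in>{0..1}. \<bar>s - x\<bar> < \<delta>2 \<longrightarrow> \<sigma> s \<in> W2"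
        using curve_nhd[OF geodesicD(1)[OF \<sigma>] x W(2,4)] by blast
      have "P a b" if "a \<le> x" "x \<le> b" "b - a < min \<delta>1 \<delta>2" for a b
      proof -
        have "\<gamma> a \<noteq> \<sigma> a" if "0 \<le> a"
        proof -
          have "\<gamma> a \<in> W1" "\<sigma> a \<in> W2"
            using \<delta>1(2)[rule_format, of a] \<delta>2(2)[rule_format, of a] that \<open>a \<le> x\<close> \<open>x \<le> b\<close> \<open>b - a < min \<delta>1 \<delta>2\<close> x
            by auto
          then show ?thesis using W(5) by (auto simp: disjnt_def)
        qed
        then show ?thesis by (auto simp: P_def)
      qed
      then show ?thesis using \<delta>1(1) \<delta>2(1) by (intro exI[of _ "min \<delta>1 \<delta>2"]) auto
    next
      case True
      obtain c where c: "c \<in> charts_at M (\<gamma> x)" using charts_nonempty top by blast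
      have c': "c \<in> charts_at M (\<sigma> x)" using c True by simp
      have a: "c \<in> atlas M" "snd c (\<gamma> x) \<in> snd c ` fst c" using c by (auto simp: charts_at_def)
      obtain r where r: "r > 0" "cball (snd c (\<gamma> x)) r \<subseteq> snd c ` fst c"
        using open_chart_image[OF a(1)] a(2) open_contains_cball by blast
      let ?K = "cball (snd c (\<gamma> x)) r"
      have K: "compact ?K" "convex ?K" "?K \<subseteq> snd c ` fst c" using r by auto
      obtain R1 \<delta>1 where R1: "R1 \<ge> 0" "\<delta>1 > 0" "\<And>s. s \<in> {0..1} \<Longrightarrow> \<bar>s - x\<bar> < \<delta>1 \<Longrightarrow> c \<in> charts_at M (\<gamma> s) \<and>
          snd c (\<gamma> s) \<in> ?K \<and> norm (velocity M \<gamma> s c) \<le> R1"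
        using geodesic_local_bounds[OF \<gamma> x c r(1)] by blast
      obtain R2 \<delta>2 where R2: "R2 \<ge> 0" "\<delta>2 > 0" "\<And>s. s \<in> {0..1} \<Longrightarrow> \<bar>s - x\<bar> < \<delta>2 \<Longrightarrow> c \<in> charts_at M (\<sigma> s) \<and>
          snd c (\<sigma> s) \<in> ?K \<and> norm (velocity M \<sigma> s c) \<le> R2"
        using geodesic_local_bounds[OF \<sigma> x c' r(1)] unfolding True by blast
      define R where "R = max R1 R2"
      have R: "R \<ge> 0" "R1 \<le> R" "R2 \<le> R" using R1(1) by (auto simp: R_def)
      obtain L where L: "L \<ge> 0" "\<And>x u v. x \<in> ?K \<Longrightarrow> norm (christoffel M c x u v) \<le> L * norm u * norm v"
        "\<And>x y u v. x \<in> ?K \<Longrightarrow> y \<in> ?K \<Longrightarrow>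
          norm (christoffel M c x u v - christoffel M c y u v) \<le> L * norm (x - y) * norm u * norm v"
        using christoffel_bounds[OF a(1) K] by blast
      have "P a b" if ab: "a \<le> x" "x \<le> b" "b - a < min \<delta>1 \<delta>2" for a b
        unfolding P_def
      proof
        assume as: "0 \<le> a \<and> b \<le> 1 \<and> \<gamma> a = \<sigma> a \<and> velocity M \<gamma> a = velocity M \<sigma> a"
        have sub: "{a..b} \<subseteq> {0..1}" using as by auto
        have n1: "c \<in> charts_at M (\<gamma> s)" "snd c (\<gamma> s) \<in> ?K" "norm (velocity M \<gamma> s c) \<le> R" if "s \<in> {a..b}" for s
        proof -
          have "s \<in> {0..1}" "\<bar>s - x\<bar> < \<delta>1" using that ab sub by auto
          from R1(3)[OF this] R(2)
          show "c \<in> charts_at M (\<gamma> s)" "snd c (\<gamma> s) \<in> ?K" "norm (velocity M \<gamma> s c) \<le> R" by auto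
        qed
        have n2: "c \<in> charts_at M (\<sigma> s)" "snd c (\<sigma> s) \<in> ?K" "norm (velocity M \<sigma> s c) \<le> R" if "s \<in> {a..b}" for s
        proof -
          have "s \<in> {0..1}" "\<bar>s - x\<bar> < \<delta>2" using that ab sub by auto
          from R2(3)[OF this] R(3)
          show "c \<in> charts_at M (\<sigma> s)" "snd c (\<sigma> s) \<in> ?K" "norm (velocity M \<sigma> s c) \<le> R" by auto
        qed
        define z where "z \<tau> s = (snd c (\<tau> s), velocity M \<tau> s c)" for \<tau> s
        define z' where "z' \<tau> s = (velocity M \<tau> s c,
            - christoffel M c (snd c (\<tau> s)) (velocity M \<tau> s c) (velocity M \<tau> s c))" for \<tau> s
        have der: "(z \<tau> has_vector_derivative z' \<tau> s) (at s within {a..b})"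
          if "geodesic M \<tau>" "s \<in> {a..b}" "c \<in> charts_at M (\<tau> s)" for \<tau> s
        proof -
          have s: "s \<in> {0..1}" using that(2) sub by blast
          have "(z \<tau> has_vector_derivative z' \<tau> s) (at s within {0..1})"
            unfolding z_def z'_def
            using has_vector_derivative_Pair[OF geodesicD(4)[OF that(1) s that(3)] geodesicD(5)[OF that(1) s that(3)]]
            by (simp add: o_def)
          then show ?thesis using sub by (rule has_vector_derivative_within_subset)
        qed
        have bound: "norm (z' \<gamma> s - z' \<sigma> s) \<le> (1 + L * R * R + 2 * (L * R)) * norm (z \<gamma> s - z \<sigma> s)" if s: "s \<in> {a..b}" for s
        proof -
          let ?x = "snd c (\<gamma> s)" and ?y = "snd c (\<sigma> s)" and ?u = "velocity M \<gamma> s c" and ?v = "velocity M \<sigma> s c"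
          let ?n = "norm (z \<gamma> s - z \<sigma> s)"
          have y: "?y \<in> snd c ` fst c" using n2[OF s] K by blast
          have nx: "norm (?x - ?y) \<le> ?n" "norm (?u - ?v) \<le> ?n"
            using norm_fst_le[of "?x - ?y" "?u - ?v"] norm_snd_le[of "?u - ?v" "?x - ?y"] by (simp_all add: z_def)
          have "christoffel M c ?x ?u ?u - christoffel M c ?y ?v ?v =
              (christoffel M c ?x ?u ?u - christoffel M c ?y ?u ?u) +
              (christoffel M c ?y ?u (?u - ?v) + christoffel M c ?y (?u - ?v) ?v)"
            by (simp add: linear_diff[OF christoffel_linear(1)[OF a(1) y]] linear_diff[OF christoffel_linear(2)[OF a(1) y]])
          then have "norm (christoffel M c ?x ?u ?u - christoffel M c ?y ?v ?v) \<le>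
              norm (christoffel M c ?x ?u ?u - christoffel M c ?y ?u ?u) +
              (norm (christoffel M c ?y ?u (?u - ?v)) + norm (christoffel M c ?y (?u - ?v) ?v))"
            by (metis norm_triangle_le norm_triangle_ineq add_left_mono)
          also have "\<dots> \<le> L * norm (?x - ?y) * norm ?u * norm ?u +
              (L * norm ?u * norm (?u - ?v) + L * norm (?u - ?v) * norm ?v)"
            by (intro add_mono L n1 n2 s)
          also have "\<dots> \<le> L * ?n * R * R + (L * R * ?n + L * ?n * R)"
            using nx n1(3)[OF s] n2(3)[OF s] L(1) R(1)
            by (intro add_mono mult_mono) auto
          finally have 1: "norm (christoffel M c ?x ?u ?u - christoffel M c ?y ?v ?v) \<le> \<dots>" .
          have "norm (z' \<gamma> s - z' \<sigma> s) \<le> norm (?u - ?v) + norm (christoffel M c ?x ?u ?u - christoffel M c ?y ?v ?v)"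
            using norm_Pair_le[of "?u - ?v" "christoffel M c ?y ?v ?v - christoffel M c ?x ?u ?u"]
            by (simp add: z'_def norm_minus_commute)
          also have "\<dots> \<le> ?n + (L * ?n * R * R + (L * R * ?n + L * ?n * R))" using nx 1 by (intro add_mono)
          also have "\<dots> = (1 + L * R * R + 2 * (L * R)) * ?n" by (simp add: algebra_simps)
          finally show ?thesis .
        qed
        have "z \<gamma> b = z \<sigma> b"
          by (rule gronwall_unique[of a b "z \<gamma>" "z' \<gamma>" "z \<sigma>" "z' \<sigma>", OF der[OF \<gamma>] der[OF \<sigma>] bound])
             (use n1 n2 as ab in \<open>auto simp: z_def\<close>)
        then have eq: "snd c (\<gamma> b) = snd c (\<sigma> b)" "velocity M \<gamma> b c = velocity M \<sigma> b c" by (auto simp: z_def)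
        have b: "b \<in> {a..b}" "b \<in> {0..1}" using ab x as by auto
        have \<gamma>b: "\<gamma> b = \<sigma> b"
          using eq(1) n1(1)[OF b(1)] n2(1)[OF b(1)] inj_on_chart[OF a(1)] by (auto simp: charts_at_def inj_on_def)
        moreover have "velocity M \<gamma> b = velocity M \<sigma> b"
          using tangent_eqI[of "velocity M \<gamma> b" "\<gamma> b" "velocity M \<sigma> b" c]
            geodesicD(3)[OF \<gamma> b(2)] geodesicD(3)[OF \<sigma> b(2)] n1(1)[OF b(1)] eq(2) \<gamma>b by simp
        ultimately show "\<gamma> b = \<sigma> b \<and> velocity M \<gamma> b = velocity M \<sigma> b" by blast
      qed
      then show ?thesis using R1(2) R2(2) by (intro exI[of _ "min \<delta>1 \<delta>2"]) auto
    qed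
  qed
  then show ?thesis using init t by (simp add: P_def)
qed

section \<open>The distance function\<close>

lemma tnorm_minus: "p \<in> topspace (mtop M) \<Longrightarrow> X \<in> tangent_space M p \<Longrightarrow> tnorm M p (- X) = tnorm M p X"
proof -
  assume p: "p \<in> topspace (mtop M)" and X: "X \<in> tangent_space M p"
  have X': "- X \<in> tangent_space M p" using tangent_scaleR[OF X, of "-1"] by simp
  have "metric M p (- X) (- X) = - metric M p X (- X)"
    using metric_linear_left[OF p X X X', of "-1" 0] by simp
  also have "\<dots> = - metric M p (- X) X" using metric_symmetric[OF p X X'] by simp
  also have "\<dots> = metric M p X X" using metric_linear_left[OF p X X X, of "-1" 0] by simp
  finally show ?thesis by (simp add: tnorm_def)
qed

lemma metric_nonneg: "p \<in> topspace (mtop M) \<Longrightarrow> X \<in> tangent_space M p \<Longrightarrow> metric M p X X \<ge> 0"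
  using metric_pos[of p X] metric_zero[of p X] by (cases "X = 0") auto

lemma velocity_tangent:
  assumes \<gamma>: "continuous_curve M \<gamma>" and t: "t \<in> {0..1}"
    and d: "\<And>c. c \<in> charts_at M (\<gamma> t) \<Longrightarrow> (snd c \<circ> \<gamma>) differentiable (at t within {0..1})"
  shows "velocity M \<gamma> t \<in> tangent_space M (\<gamma> t)"
  unfolding tangent_space_def mem_Collect_eq
proof (intro conjI ballI allI impI)
  fix c e assume c: "c \<in> charts_at M (\<gamma> t)" and e: "e \<in> charts_at M (\<gamma> t)"
  have v: "((snd c' \<circ> \<gamma>) has_vector_derivative velocity M \<gamma> t c') (at t within {0..1})"
    if "c' \<in> charts_at M (\<gamma> t)" for c'
    using d[OF that] that by (simp add: velocity_def vector_derivative_works)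
  show "velocity M \<gamma> t e = dtrans c e (snd c (\<gamma> t)) (velocity M \<gamma> t c)"
    by (rule has_vector_derivative_unique_Icc[OF v[OF e]
          has_vector_derivative_chart_change[OF \<gamma> order_refl t c e v[OF c]] zero_less_one t])
qed (simp add: velocity_def)

text \<open>Between break points the velocity is a tangent vector. At break points it may be anything, but they
  form a null set. The lemma makes the infimum that defines the distance a lower bound.\<close>

lemma curve_length_nonneg:
  assumes "piecewise_C1_curve M \<gamma>" shows "curve_length M \<gamma> \<ge> 0"
proof -
  obtain S where \<gamma>: "continuous_curve M \<gamma>" and S: "finite S" "{0, 1} \<subseteq> S" "S \<subseteq> {0..1}"
    "\<forall>a\<in>S. \<forall>b\<in>S. a < b \<and> S \<inter> {a<..<b} = {} \<longrightarrow> C1_piece M \<gamma> a b"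
    using assms unfolding piecewise_C1_curve_def by (elim conjE exE) (rule that)
  let ?f = "\<lambda>t. tnorm M (\<gamma> t) (velocity M \<gamma> t)"
  define g where "g t = (if t \<in> S then 0 else ?f t)" for t
  have "?f t \<ge> 0" if t: "t \<in> {0..1}" "t \<notin> S" for t
  proof -
    have t01: "0 < t" "t < 1" using t S(2) by (auto simp: order_less_le)
    define a where "a = Max {s \<in> S. s < t}"
    define b where "b = Min {s \<in> S. t < s}"
    have fin: "finite {s \<in> S. s < t}" "finite {s \<in> S. t < s}" using S(1) by auto
    have "0 \<in> {s \<in> S. s < t}" "1 \<in> {s \<in> S. t < s}" using S(2) t01 by auto
    then have ne: "{s \<in> S. s < t} \<noteq> {}" "{s \<in> S. t < s} \<noteq> {}" by blast+
    have ab: "a \<in> S" "a < t" "b \<in> S" "t < b"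
      using Max_in[OF fin(1) ne(1)] Min_in[OF fin(2) ne(2)] by (auto simp: a_def b_def)
    have "S \<inter> {a<..<b} = {}"
    proof (rule ccontr)
      assume "S \<inter> {a<..<b} \<noteq> {}"
      then obtain s where s: "s \<in> S" "a < s" "s < b" by auto
      have "s \<noteq> t" using s(1) t(2) by blast
      then consider "s < t" | "t < s" by linarith
      then show False
      proof cases
        case 1
        then have "s \<le> a" unfolding a_def using s by (intro Max_ge fin) auto
        then show False using s by simp
      next
        case 2
        then have "b \<le> s" unfolding b_def using s by (intro Min_le fin) auto
        then show False using s by simp
      qed
    qed
    then have piece: "C1_piece M \<gamma> a b" using S(4) ab by simp
    have "(snd c \<circ> \<gamma>) differentiable (at t within {0..1})" if "c \<in> charts_at M (\<gamma> t)" for c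
    proof -
      have "(snd c \<circ> \<gamma>) differentiable (at t within {a..b})"
        using piece that ab by (auto simp: C1_piece_def charts_at_def Let_def)
      then show ?thesis using ab t01 by (simp add: at_within_Icc_at)
    qed
    then have "velocity M \<gamma> t \<in> tangent_space M (\<gamma> t)" by (rule velocity_tangent[OF \<gamma> t(1)])
    then show ?thesis using metric_nonneg[OF curve_topspace[OF \<gamma> t(1)]] by (simp add: tnorm_def)
  qed
  then have g: "g t \<ge> 0" if "t \<in> {0..1}" for t using that by (simp add: g_def)
  have "curve_length M \<gamma> = integral {0..1} g"
    unfolding curve_length_def by (rule integral_spike[of S]) (use S(1) in \<open>auto simp: g_def negligible_finite\<close>)
  also have "\<dots> \<ge> 0"
    using g by (cases "g integrable_on {0..1}") (auto intro: integral_nonneg simp: not_integrable_integral)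
  finally show ?thesis .
qed

lemma riem_dist_le:
  assumes "piecewise_C1_curve M \<gamma>" shows "riem_dist M (\<gamma> 0) (\<gamma> 1) \<le> curve_length M \<gamma>"
  unfolding riem_dist_def
  by (rule cInf_lower) (use assms curve_length_nonneg in \<open>auto intro!: bdd_belowI[of _ 0]\<close>)

lemma geodesic_length:
  assumes "geodesic M \<gamma>" shows "curve_length M \<gamma> = tnorm M (\<gamma> 0) (velocity M \<gamma> 0)"
proof -
  have "curve_length M \<gamma> = integral {0..1::real} (\<lambda>t. tnorm M (\<gamma> 0) (velocity M \<gamma> 0))"
    unfolding curve_length_def tnorm_def
    by (rule integral_cong, rule arg_cong[where f = sqrt],
        rule parallel_inner_constant[OF assms geodesicD(2)[OF assms] geodesicD(2)[OF assms]])
  then show ?thesis by simp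
qed

text \<open>The velocity of the reversed curve is minus the velocity of the geodesic at the mirrored time, which
  is continuous in every chart and of constant norm.\<close>

lemma reversed_geodesic:
  assumes \<gamma>: "geodesic M \<gamma>"
  defines "\<sigma> \<equiv> \<lambda>t. \<gamma> (1 - t)"
  shows "piecewise_C1_curve M \<sigma>" "curve_length M \<sigma> = curve_length M \<gamma>"
proof -
  have refl: "(\<lambda>t. 1 - t) ` {0..1} = {0..1::real}"
    by (auto simp: image_iff intro!: bexI[of _ "1 - _"])
  have cont: "continuous_curve M \<sigma>"
  proof -
    have "continuous_map (top_of_set {0..1}) (top_of_set {0..1}) (\<lambda>t::real. 1 - t)"
      by (auto intro!: continuous_intros)
    then have "continuous_map (top_of_set {0..1}) (mtop M) (\<gamma> \<circ> (\<lambda>t. 1 - t))"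
      using geodesicD(1)[OF \<gamma>] by (intro continuous_map_compose) (auto simp: continuous_curve_def)
    then show ?thesis by (simp add: continuous_curve_def \<sigma>_def o_def)
  qed
  have der: "((snd c \<circ> \<sigma>) has_vector_derivative - velocity M \<gamma> (1 - t) c) (at t within {0..1})"
    if t: "t \<in> {0..1}" and c: "c \<in> charts_at M (\<sigma> t)" for t c
  proof -
    have "((\<lambda>t::real. 1 - t) has_vector_derivative - 1) (at t within {0..1})"
      by (auto intro!: derivative_eq_intros)
    moreover have "((snd c \<circ> \<gamma>) has_vector_derivative velocity M \<gamma> (1 - t) c) (at (1 - t) within (\<lambda>t. 1 - t) ` {0..1})"
      unfolding refl using t c by (intro geodesicD(4)[OF \<gamma>]) (auto simp: \<sigma>_def)
    ultimately have "(((snd c \<circ> \<gamma>) \<circ> (\<lambda>t. 1 - t)) has_vector_derivative (- 1) *\<^sub>R velocity M \<gamma> (1 - t) c) (at t within {0..1})"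
      by (rule vector_diff_chain_within)
    then show ?thesis by (simp add: \<sigma>_def o_def)
  qed
  have vd: "vector_derivative (snd c \<circ> \<sigma>) (at t within {0..1}) = - velocity M \<gamma> (1 - t) c"
    if "t \<in> {0..1}" "c \<in> charts_at M (\<sigma> t)" for t c
    using vector_derivative_within_cbox[of 0 1 t, OF _ _ der[OF that, folded cbox_interval]] that by auto
  have vel: "velocity M \<sigma> t = - velocity M \<gamma> (1 - t)" if t: "t \<in> {0..1}" for t
  proof
    fix c
    have "velocity M \<gamma> (1 - t) c = 0" if "c \<notin> charts_at M (\<gamma> (1 - t))" using that by (simp add: velocity_def)
    then show "velocity M \<sigma> t c = (- velocity M \<gamma> (1 - t)) c"
      using vd[OF t, of c] by (auto simp: velocity_def \<sigma>_def)
  qed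
  have piece: "C1_piece M \<sigma> 0 1"
    unfolding C1_piece_def Let_def
  proof (intro ballI conjI)
    fix c assume c: "c \<in> atlas M"
    let ?J = "{t \<in> {0..1}. \<sigma> t \<in> fst c}"
    have J: "t \<in> {0..1}" "c \<in> charts_at M (\<sigma> t)" if "t \<in> ?J" for t using that c by (auto simp: charts_at_def)
    show "(snd c \<circ> \<sigma>) differentiable (at t within {0..1})" if "t \<in> ?J" for t
      using der[OF J[OF that]] by (rule differentiableI_vector)
    have "continuous_on ?J (\<lambda>t. - velocity M \<gamma> (1 - t) c)"
    proof (intro continuous_on_minus)
      show "continuous_on ?J (\<lambda>t. velocity M \<gamma> (1 - t) c)"
      proof (rule continuous_on_compose2[where g = "\<lambda>s. velocity M \<gamma> s c" and t = "{s \<in> {0..1}. \<gamma> s \<in> fst c}"])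
        show "continuous_on {s \<in> {0..1}. \<gamma> s \<in> fst c} (\<lambda>s. velocity M \<gamma> s c)"
          unfolding continuous_on_eq_continuous_within
        proof
          fix s assume s: "s \<in> {s \<in> {0..1}. \<gamma> s \<in> fst c}"
          have "continuous (at s within {0..1}) (\<lambda>s. velocity M \<gamma> s c)"
            using geodesicD(5)[OF \<gamma>, of s c] s c by (auto simp: charts_at_def intro: has_vector_derivative_continuous)
          then show "continuous (at s within {s \<in> {0..1}. \<gamma> s \<in> fst c}) (\<lambda>s. velocity M \<gamma> s c)"
            by (rule continuous_within_subset) auto
        qed
      qed (auto simp: \<sigma>_def intro!: continuous_intros)
    qed
    then show "continuous_on ?J (\<lambda>t. vector_derivative (snd c \<circ> \<sigma>) (at t within {0..1}))"
      by (rule continuous_on_eq) (metis vd J)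
  qed
  show "piecewise_C1_curve M \<sigma>"
    unfolding piecewise_C1_curve_def
  proof (intro conjI cont exI[of _ "{0, 1}"] ballI impI)
    fix a b :: real assume "a \<in> {0, 1}" "b \<in> {0, 1}" "a < b \<and> {0, 1} \<inter> {a<..<b} = {}"
    then have "a = 0" "b = 1" by auto
    then show "C1_piece M \<sigma> a b" using piece by simp
  qed auto
  have "curve_length M \<sigma> = integral {0..1::real} (\<lambda>t. tnorm M (\<gamma> 0) (velocity M \<gamma> 0))"
    unfolding curve_length_def
  proof (rule integral_cong)
    fix t :: real assume t: "t \<in> {0..1}"
    then have t': "1 - t \<in> {0..1}" by auto
    have "tnorm M (\<sigma> t) (velocity M \<sigma> t) = tnorm M (\<gamma> (1 - t)) (velocity M \<gamma> (1 - t))"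
      unfolding vel[OF t] unfolding \<sigma>_def
      by (rule tnorm_minus[OF curve_topspace[OF geodesicD(1)[OF \<gamma>] t'] geodesicD(3)[OF \<gamma> t']])
    also have "\<dots> = tnorm M (\<gamma> 0) (velocity M \<gamma> 0)"
      unfolding tnorm_def by (simp only: parallel_inner_constant[OF \<gamma> geodesicD(2)[OF \<gamma>] geodesicD(2)[OF \<gamma>] t'])
    finally show "tnorm M (\<sigma> t) (velocity M \<sigma> t) = tnorm M (\<gamma> 0) (velocity M \<gamma> 0)" .
  qed
  then show "curve_length M \<sigma> = curve_length M \<gamma>" by (simp add: geodesic_length[OF \<gamma>])
qed

lemma ex1_shortest_geodesic:
  "strongly_convex M C \<Longrightarrow> p \<in> C \<Longrightarrow> q \<in> C \<Longrightarrow> \<exists>!\<gamma>. shortest_geodesic M p q \<gamma>"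
proof -
  assume C: "strongly_convex M C" and pq: "p \<in> C" "q \<in> C"
  note conv = conjunct2[OF C[unfolded strongly_convex_def]]
  show ?thesis by (rule conjunct1[OF bspec[OF bspec[OF conv pq(1)] pq(2)]])
qed

text \<open>Reversing a shortest geodesic bounds the distance in the other direction. This gives symmetry for
  points joined by shortest geodesics only, which is enough on a strongly convex set.\<close>

lemma riem_dist_symmetric:
  assumes C: "strongly_convex M C" and pq: "p \<in> C" "q \<in> C"
  shows "riem_dist M p q = riem_dist M q p"
proof -
  have "riem_dist M q p \<le> riem_dist M p q" if pq: "p \<in> C" "q \<in> C" for p q
  proof -
    obtain \<gamma> where "shortest_geodesic M p q \<gamma>" using ex1_shortest_geodesic[OF C pq] by blast
    then have \<gamma>: "geodesic M \<gamma>" "\<gamma> 0 = p" "\<gamma> 1 = q" "curve_length M \<gamma> = riem_dist M p q"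
      by (auto simp: shortest_geodesic_def)
    show ?thesis using riem_dist_le[OF reversed_geodesic(1)[OF \<gamma>(1)]] reversed_geodesic(2)[OF \<gamma>(1)] \<gamma>(2-4) by simp
  qed
  from this[OF pq] this[OF pq(2,1)] show ?thesis by simp
qed

section \<open>The exponential map\<close>

text \<open>By \<open>geodesic_unique\<close> the description that defines \<open>exp_map\<close> has exactly one solution.\<close>

lemma exp_map_eq:
  assumes "geodesic M \<gamma>" shows "exp_map M (\<gamma> 0) (velocity M \<gamma> 0) = \<gamma> 1"
  unfolding exp_map_def
proof (rule the_equality)
  show "\<exists>\<sigma>. geodesic M \<sigma> \<and> \<sigma> 0 = \<gamma> 0 \<and> velocity M \<sigma> 0 = velocity M \<gamma> 0 \<and> \<sigma> 1 = \<gamma> 1" using assms by blast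
  fix q assume "\<exists>\<sigma>. geodesic M \<sigma> \<and> \<sigma> 0 = \<gamma> 0 \<and> velocity M \<sigma> 0 = velocity M \<gamma> 0 \<and> \<sigma> 1 = q"
  then show "q = \<gamma> 1" using geodesic_unique[OF _ assms, of _ 1] by auto
qed

text \<open>Shortest geodesics are normalized to be extensional, while the exponential map refers to arbitrary
  functions on the reals; all notions involved depend on the values on \<open>{0..1}\<close> only.\<close>

lemma geodesic_restrict:
  assumes \<gamma>: "geodesic M \<gamma>"
  shows "geodesic M (restrict \<gamma> {0..1})" "\<And>t. t \<in> {0..1} \<Longrightarrow> velocity M (restrict \<gamma> {0..1}) t = velocity M \<gamma> t"
proof -
  let ?\<gamma> = "restrict \<gamma> {0..1::real}"
  have eq: "((snd c \<circ> ?\<gamma>) has_vector_derivative D) (at t within {0..1}) \<longleftrightarrow>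
      ((snd c \<circ> \<gamma>) has_vector_derivative D) (at t within {0..1})" if t: "t \<in> {0..1}" for t c D
    unfolding has_vector_derivative_def
    by (auto elim!: has_derivative_transform_within[OF _ zero_less_one t])
  then show vel: "velocity M ?\<gamma> t = velocity M \<gamma> t" if "t \<in> {0..1}" for t
    unfolding velocity_def vector_derivative_def eq[OF that] using that by simp
  show "geodesic M ?\<gamma>"
    unfolding geodesic_def parallel_field_def continuous_curve_def
  proof (intro conjI ballI)
    show "continuous_map (top_of_set {0..1}) (mtop M) ?\<gamma>"
      using geodesicD(1)[OF \<gamma>] unfolding continuous_curve_def
      by (rule continuous_map_eq) simp
    fix t :: real assume t: "t \<in> {0..1}"
    show "velocity M ?\<gamma> t \<in> tangent_space M (?\<gamma> t)" using geodesicD(3)[OF \<gamma> t] vel[OF t] t by simp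
    fix c assume "c \<in> charts_at M (?\<gamma> t)"
    then have c: "c \<in> charts_at M (\<gamma> t)" using t by simp
    show "(snd c \<circ> ?\<gamma>) differentiable (at t within {0..1})"
      using eq[OF t] geodesicD(4)[OF \<gamma> t c] by (blast intro: differentiableI_vector)
    have "((\<lambda>s. velocity M ?\<gamma> s c) has_vector_derivative
        - christoffel M c (snd c (\<gamma> t)) (velocity M \<gamma> t c) (velocity M \<gamma> t c)) (at t within {0..1})"
      by (rule has_vector_derivative_transform[OF t _ geodesicD(5)[OF \<gamma> t c]]) (simp add: vel)
    then show "((\<lambda>s. velocity M ?\<gamma> s c) has_vector_derivative
        - christoffel M c (snd c (?\<gamma> t)) (velocity M ?\<gamma> t c) (velocity M ?\<gamma> t c)) (at t within {0..1})"
      using t vel[OF t] by simp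
  qed
qed

text \<open>A vector \<open>X\<close> in \<open>\<L>\<^sub>C\<^sub>,\<^sub>m\<close> with \<open>exp\<^sub>m X = q\<close> is the initial velocity of a geodesic from \<open>m\<close> to \<open>q\<close> of
  length \<open>\<parallel>X\<parallel> = d(q, m) = d(m, q)\<close>, hence of the unique shortest one. So \<open>q\<close> determines \<open>X\<close>, and
  conversely the initial velocity of the shortest geodesic from \<open>m\<close> to \<open>q\<close> is such a vector.\<close>

lemma exp_map_bij_betw:
  assumes C: "strongly_convex M C" and m: "m \<in> C"
  shows "bij_betw (exp_map M m) (log_dom M C m) C"
proof (rule bij_betw_imageI)
  show "inj_on (exp_map M m) (log_dom M C m)"
  proof (rule inj_onI)
    fix X Y assume X: "X \<in> log_dom M C m" and Y: "Y \<in> log_dom M C m" and eq: "exp_map M m X = exp_map M m Y"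
    define q where "q = exp_map M m X"
    have q: "q \<in> C" using X by (simp add: log_dom_def q_def)
    have "\<exists>\<gamma>. shortest_geodesic M m q \<gamma> \<and> velocity M \<gamma> 0 = Z" if Z: "Z \<in> log_dom M C m" "exp_map M m Z = q" for Z
    proof -
      obtain \<gamma> where \<gamma>: "geodesic M \<gamma>" "\<gamma> 0 = m" "velocity M \<gamma> 0 = Z" using Z by (auto simp: log_dom_def exp_dom_def)
      let ?\<gamma> = "restrict \<gamma> {0..1}"
      note r = geodesic_restrict[OF \<gamma>(1)]
      have v: "velocity M ?\<gamma> 0 = Z" using r(2)[of 0] \<gamma>(3) by simp
      have "\<gamma> 1 = q" using exp_map_eq[OF \<gamma>(1)] \<gamma>(2,3) Z(2) by simp
      moreover have "curve_length M ?\<gamma> = riem_dist M m q"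
        using geodesic_length[OF r(1)] v \<gamma>(2) Z riem_dist_symmetric[OF C m q] by (simp add: log_dom_def)
      ultimately have "shortest_geodesic M m q ?\<gamma>" using r(1) \<gamma>(2) by (simp add: shortest_geodesic_def)
      then show ?thesis using v by blast
    qed
    moreover have "\<exists>!\<gamma>. shortest_geodesic M m q \<gamma>" by (rule ex1_shortest_geodesic[OF C m q])
    ultimately show "X = Y" using X Y eq unfolding q_def by metis
  qed
  show "exp_map M m ` log_dom M C m = C"
  proof
    show "exp_map M m ` log_dom M C m \<subseteq> C" by (auto simp: log_dom_def)
    show "C \<subseteq> exp_map M m ` log_dom M C m"
    proof
      fix q assume q: "q \<in> C"
      obtain \<gamma> where "shortest_geodesic M m q \<gamma>" using ex1_shortest_geodesic[OF C m q] by blast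
      then have \<gamma>: "geodesic M \<gamma>" "\<gamma> 0 = m" "\<gamma> 1 = q" "curve_length M \<gamma> = riem_dist M m q"
        by (auto simp: shortest_geodesic_def)
      have e: "exp_map M m (velocity M \<gamma> 0) = q" using exp_map_eq[OF \<gamma>(1)] \<gamma> by simp
      have "velocity M \<gamma> 0 \<in> log_dom M C m"
        using \<gamma> geodesicD(3)[OF \<gamma>(1), of 0] e q geodesic_length[OF \<gamma>(1)] riem_dist_symmetric[OF C m q]
        by (auto simp: log_dom_def exp_dom_def)
      then show "q \<in> exp_map M m ` log_dom M C m" using e by blast
    qed
  qed
qed

lemma log_dom_tangent: "X \<in> log_dom M C m \<Longrightarrow> X \<in> tangent_space M m"
  by (simp add: log_dom_def exp_dom_def)

lemma log_map_in_log_dom: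
  assumes "strongly_convex M C" "m \<in> C" "p \<in> C" shows "log_map M C m p \<in> log_dom M C m"
  unfolding log_map_def
  using exp_map_bij_betw[OF assms(1,2)] assms(3)
  by (intro the_inv_into_into) (auto simp: bij_betw_def)

section \<open>Musical isomorphisms and transport of covectors\<close>

lemma flat_in_cotangent:
  assumes "p \<in> topspace (mtop M)" "X \<in> tangent_space M p" shows "flat M p X \<in> cotangent_space M p"
proof -
  have "metric M p X (a *\<^sub>R Y + b *\<^sub>R Z) = a * metric M p X Y + b * metric M p X Z"
    if "Y \<in> tangent_space M p" "Z \<in> tangent_space M p" for a b Y Z
    using metric_linear_left[OF assms(1) that assms(2), of a b] that
    by (simp add: metric_symmetric[OF assms(1,2)] tangent_linear)
  then show ?thesis by (auto simp: cotangent_space_def flat_def tangent_linear)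
qed

lemma cotangent_coord_linear:
  assumes "c \<in> charts_at M p" "\<xi> \<in> cotangent_space M p" shows "linear (\<lambda>u. \<xi> (coord_vec M c p u))"
proof -
  have *: "\<xi> (coord_vec M c p (a *\<^sub>R u + b *\<^sub>R v)) = a * \<xi> (coord_vec M c p u) + b * \<xi> (coord_vec M c p v)" for a b u v
    using assms coord_vec_tangent[OF assms(1)] by (simp add: coord_vec_linear cotangent_space_def)
  show ?thesis using *[of 1 _ 1] *[of _ _ 0 0] by (intro linearI) auto
qed

text \<open>Definiteness gives injectivity; in a chart, surjectivity is the representation of linear forms by
  the metric.\<close>

lemma flat_bij_betw:
  assumes p: "p \<in> topspace (mtop M)"
  shows "bij_betw (flat M p) (tangent_space M p) (cotangent_space M p)"
proof (rule bij_betw_imageI)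
  obtain c where c: "c \<in> charts_at M p" using charts_nonempty[OF p] by blast
  have a: "c \<in> atlas M" "snd c p \<in> snd c ` fst c" using c by (auto simp: charts_at_def)
  show "inj_on (flat M p) (tangent_space M p)"
  proof (rule inj_onI, rule ccontr)
    fix X Y assume X: "X \<in> tangent_space M p" and Y: "Y \<in> tangent_space M p" and eq: "flat M p X = flat M p Y" and ne: "X \<noteq> Y"
    have D: "X - Y \<in> tangent_space M p" by (rule tangent_diff[OF X Y])
    have "metric M p X (X - Y) = metric M p Y (X - Y)" using fun_cong[OF eq, of "X - Y"] D by (simp add: flat_def)
    then have "metric M p (X - Y) (X - Y) = 0" using metric_linear_left[OF p X Y D, of 1 "-1"] by simp
    then show False using metric_pos[OF p D] ne by simp
  qed
  show "flat M p ` tangent_space M p = cotangent_space M p"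
  proof
    show "flat M p ` tangent_space M p \<subseteq> cotangent_space M p" using flat_in_cotangent[OF p] by blast
    show "cotangent_space M p \<subseteq> flat M p ` tangent_space M p"
    proof
      fix \<xi> assume \<xi>: "\<xi> \<in> cotangent_space M p"
      obtain w where w: "\<And>z. metric_coord M c (snd c p) w z = \<xi> (coord_vec M c p z)"
        using ex1_representing_vector[OF metric_coord_linear_left[OF a] metric_coord_linear_right[OF a]
            metric_coord_pos[OF a] cotangent_coord_linear[OF c \<xi>]] by blast
      have "flat M p (coord_vec M c p w) = \<xi>"
      proof
        fix Y show "flat M p (coord_vec M c p w) Y = \<xi> Y"
          using w[of "Y c"] \<xi> c coord_vec_tangent[OF c]
          by (auto simp: flat_def metric_eq_coord[OF c] coord_vec_tangent_eq cotangent_space_def)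
      qed
      then show "\<xi> \<in> flat M p ` tangent_space M p" using coord_vec_tangent[OF c] by blast
    qed
  qed
qed

lemma sharp_tangent: "p \<in> topspace (mtop M) \<Longrightarrow> \<xi> \<in> cotangent_space M p \<Longrightarrow> sharp M p \<xi> \<in> tangent_space M p"
  unfolding sharp_def using flat_bij_betw[of p]
  by (intro the_inv_into_into) (auto simp: bij_betw_def)

lemma cotransport_in_cotangent:
  assumes C: "strongly_convex M C" and pm: "p \<in> C" "m \<in> C" and \<xi>: "\<xi> \<in> cotangent_space M p"
  shows "cotransport M p m \<xi> \<in> cotangent_space M m"
proof -
  have top: "p \<in> topspace (mtop M)" "m \<in> topspace (mtop M)" using C pm by (auto simp: strongly_convex_def)
  define \<gamma> where "\<gamma> = (THE \<gamma>. shortest_geodesic M p m \<gamma>)"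
  have "shortest_geodesic M p m \<gamma>"
    unfolding \<gamma>_def by (rule theI'[OF ex1_shortest_geodesic[OF C pm]])
  then have \<gamma>: "geodesic M \<gamma>" "\<gamma> 0 = p" "\<gamma> 1 = m" by (auto simp: shortest_geodesic_def)
  have "transport M p m (sharp M p \<xi>) \<in> tangent_space M m"
    unfolding transport_def \<gamma>_def[symmetric]
    using transport_along_tangent[OF \<gamma>(1)] sharp_tangent[OF top(1) \<xi>] \<gamma>(2,3) by simp
  then show ?thesis unfolding cotransport_def by (rule flat_in_cotangent[OF top(2)])
qed

lemma ex_cotangent_coord:
  assumes c: "c \<in> charts_at M m" and \<xi>: "\<xi> \<in> cotangent_space M m"
  shows "\<exists>z. \<forall>X\<in>tangent_space M m. \<xi> X = z \<bullet> X c"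
proof -
  obtain z where "\<And>u. z \<bullet> u = \<xi> (coord_vec M c m u)"
    using ex1_representing_vector[of "(\<bullet>)", OF _ _ _ cotangent_coord_linear[OF c \<xi>]]
    by (auto simp: linear_iff inner_add_left inner_add_right)
  then have "\<xi> X = z \<bullet> X c" if "X \<in> tangent_space M m" for X
    using coord_vec_tangent_eq[OF that c] by simp
  then show ?thesis by blast
qed

section \<open>Duality on the tangent space\<close>

text \<open>The subgradient inequality says that the supremum in \<open>F\<^sub>m\<^sup>* \<xi>\<close> is attained at \<open>X0\<close>, while for any other
  \<open>\<eta>\<close> the value at \<open>X0\<close> is a lower bound of \<open>F\<^sub>m\<^sup>* \<eta>\<close>. Subtracting requires \<open>f\<^sub>m X0\<close> to be finite, which
  holds because a subgradient exists and \<open>f\<^sub>m\<close> is proper.\<close>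

lemma subdiff_imp_subdiff_dual:
  assumes F: "proper_on C F" and C: "strongly_convex M C" and m: "m \<in> C"
    and X0: "X0 \<in> log_dom M C m" and \<xi>: "\<xi> \<in> subdiff M m (pullback M C m F) X0"
  shows "X0 \<in> subdiff_dual M m (fenchel_conj M C m F) \<xi>"
proof -
  let ?f = "pullback M C m F"
  have \<xi>c: "\<xi> \<in> cotangent_space M m" and sub: "\<And>Y. Y \<in> tangent_space M m \<Longrightarrow> ?f Y \<ge> ?f X0 + ereal (\<xi> (Y - X0))"
    using \<xi> by (auto simp: subdiff_def)
  have X0t: "X0 \<in> tangent_space M m" by (rule log_dom_tangent[OF X0])
  have fin: "?f X \<noteq> -\<infinity>" for X using F by (auto simp: pullback_def proper_on_def log_dom_def)
  obtain x where x: "x \<in> C" "F x \<noteq> \<infinity>" using F by (auto simp: proper_on_def)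
  then have "x \<in> exp_map M m ` log_dom M C m" by (simp add: bij_betw_imp_surj_on[OF exp_map_bij_betw[OF C m]])
  then obtain X1 where X1: "X1 \<in> log_dom M C m" "exp_map M m X1 = x" by (rule imageE) (rule that, simp_all)
  have "?f X0 \<noteq> \<infinity>" using sub[OF log_dom_tangent[OF X1(1)]] x(2) X0 X1 by (auto simp: pullback_def)
  then obtain r where r: "?f X0 = ereal r" using fin[of X0] by (cases "?f X0") auto
  have "fenchel_conj M C m F \<xi> \<le> ereal (\<xi> X0 - r)"
    unfolding fenchel_conj_def
  proof (rule SUP_least)
    fix X assume X: "X \<in> log_dom M C m"
    have f: "F (exp_map M m X) = ?f X" using X by (simp add: pullback_def)
    have Xt: "X \<in> tangent_space M m" by (rule log_dom_tangent[OF X])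
    have "\<xi> (1 *\<^sub>R X + (-1) *\<^sub>R X0) = 1 * \<xi> X + (-1) * \<xi> X0" using \<xi>c Xt X0t unfolding cotangent_space_def by blast
    then have "\<xi> (X - X0) = \<xi> X - \<xi> X0" by simp
    then show "ereal (\<xi> X) - F (exp_map M m X) \<le> ereal (\<xi> X0 - r)"
      unfolding f using sub[OF Xt] r by (cases "?f X") auto
  qed
  then have le: "fenchel_conj M C m F \<xi> + ereal ((\<eta> - \<xi>) X0) \<le> ereal (\<eta> X0 - r)" for \<eta>
    by (cases "fenchel_conj M C m F \<xi>") auto
  have "ereal (\<eta> X0 - r) \<le> fenchel_conj M C m F \<eta>" for \<eta>
    unfolding fenchel_conj_def
    by (rule SUP_upper2[OF X0]) (use r X0 in \<open>simp add: pullback_def\<close>)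
  then show ?thesis using X0t order_trans[OF le] by (simp add: subdiff_dual_def)
qed

text \<open>A chart at \<open>m\<close> identifies \<open>T\<^sub>mM\<close> with the model space and covectors with vectors of the model space,
  by representing them with its inner product; then \<open>conjugate_minimum_imp_subgradient\<close> applies.
  Lower semicontinuity carries over because the Riemannian norm is bounded by a multiple of the norm
  of the model space.\<close>

lemma subdiff_dual_imp_subdiff:
  assumes F: "proper_on C F" and C: "strongly_convex M C" and m: "m \<in> C"
    and conv: "convex_tan M m (pullback M C m F)" and lsc: "lsc_tan M m (pullback M C m F)"
    and \<xi>: "\<xi> \<in> cotangent_space M m" and X0: "X0 \<in> subdiff_dual M m (fenchel_conj M C m F) \<xi>"
  shows "\<xi> \<in> subdiff M m (pullback M C m F) X0"
proof -
  let ?f = "pullback M C m F"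
  have top: "m \<in> topspace (mtop M)" using C m by (auto simp: strongly_convex_def)
  obtain c where c: "c \<in> charts_at M m" using charts_nonempty[OF top] by blast
  have a: "c \<in> atlas M" "snd c m \<in> snd c ` fst c" using c by (auto simp: charts_at_def)
  have X0t: "X0 \<in> tangent_space M m"
    and min: "\<And>\<eta>. \<eta> \<in> cotangent_space M m \<Longrightarrow>
      fenchel_conj M C m F \<eta> \<ge> fenchel_conj M C m F \<xi> + ereal ((\<eta> - \<xi>) X0)"
    using X0 by (auto simp: subdiff_dual_def)
  define v where "v u = coord_vec M c m u" for u
  have v: "v u \<in> tangent_space M m" "v u c = u" for u using c by (simp_all add: v_def coord_vec_tangent)
  have vX: "v (X c) = X" if "X \<in> tangent_space M m" for X using coord_vec_tangent_eq[OF that c] by (simp add: v_def)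
  define cov where "cov z X = (if X \<in> tangent_space M m then z \<bullet> X c else 0)" for z and X :: "('a, 'e) tvec"
  have cov: "cov z \<in> cotangent_space M m" for z
    unfolding cotangent_space_def cov_def
    by (simp add: tangent_linear inner_add_right, simp add: scaleR_fun_def)
  obtain y where y: "\<xi> = cov y"
  proof -
    obtain y where "\<forall>X\<in>tangent_space M m. \<xi> X = y \<bullet> X c" using ex_cotangent_coord[OF c \<xi>] by blast
    then have "\<xi> = cov y" using \<xi> by (auto simp: cov_def fun_eq_iff cotangent_space_def)
    then show thesis by (rule that)
  qed
  have fin: "?f X \<noteq> -\<infinity>" for X using F by (auto simp: pullback_def proper_on_def log_dom_def)
  obtain x where x: "x \<in> C" "F x \<noteq> \<infinity>" using F by (auto simp: proper_on_def)
  then have "x \<in> exp_map M m ` log_dom M C m" by (simp add: bij_betw_imp_surj_on[OF exp_map_bij_betw[OF C m]])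
  then obtain X1 where X1: "X1 \<in> log_dom M C m" "exp_map M m X1 = x" by (rule imageE) (rule that, simp_all)
  have f1: "?f (v (X1 c)) \<noteq> \<infinity>" using X1 x vX[OF log_dom_tangent[OF X1(1)]] by (simp add: pullback_def)
  have conj: "fenchel_conj M C m F (cov z) = (SUP u. ereal (z \<bullet> u) - ?f (v u))" for z
    unfolding fenchel_conj_def
  proof (rule antisym; rule SUP_least)
    fix X assume X: "X \<in> log_dom M C m"
    note Xt = log_dom_tangent[OF X]
    show "ereal (cov z X) - F (exp_map M m X) \<le> (SUP u. ereal (z \<bullet> u) - ?f (v u))"
      by (rule SUP_upper2[of "X c"]) (use X Xt vX[OF Xt] in \<open>simp_all add: cov_def pullback_def\<close>)
  next
    fix u
    show "ereal (z \<bullet> u) - ?f (v u) \<le> (SUP X\<in>log_dom M C m. ereal (cov z X) - F (exp_map M m X))"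
    proof (cases "v u \<in> log_dom M C m")
      case True
      then show ?thesis by (intro SUP_upper2[OF True]) (simp add: cov_def v pullback_def)
    qed (simp add: pullback_def)
  qed
  obtain K where K: "K \<ge> 0" "\<And>u. tnorm M m (v u) \<le> K * norm u"
  proof -
    define G where "G b b' = \<bar>metric_coord M c (snd c m) b b'\<bar>" for b b'
    define B where "B = (\<Sum>b\<in>onb. \<Sum>b'\<in>onb. G b b')"
    have B: "B \<ge> 0" by (auto simp: B_def G_def intro!: sum_nonneg)
    have "metric_coord M c (snd c m) u u \<le> B * (norm u)\<^sup>2" for u
    proof -
      have 1: "\<bar>metric_coord M c (snd c m) b u\<bar> \<le> (\<Sum>b'\<in>onb. G b b') * norm u" for b
        using linear_onb_bound[OF metric_coord_linear_right[OF a], of b "G b" u] by (simp add: G_def)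
      have "\<bar>metric_coord M c (snd c m) u u\<bar> \<le> (\<Sum>b\<in>onb. (\<Sum>b'\<in>onb. G b b') * norm u) * norm u"
        using linear_onb_bound[OF metric_coord_linear_left[OF a], of u "\<lambda>b. (\<Sum>b'\<in>onb. G b b') * norm u" u] 1 by simp
      then show ?thesis by (simp add: B_def sum_distrib_right[symmetric] power2_eq_square mult.assoc)
    qed
    then have "metric M m (v u) (v u) \<le> B * (norm u)\<^sup>2" for u
      by (simp add: v_def metric_coord_eq[OF c, symmetric])
    then have "tnorm M m (v u) \<le> sqrt B * norm u" for u
      unfolding tnorm_def using real_sqrt_le_mono[of _ "B * (norm u)\<^sup>2"] by (simp add: real_sqrt_mult)
    then show thesis using B by (intro that[of "sqrt B"]) auto
  qed
  have vlin: "v (s *\<^sub>R u + t *\<^sub>R w) = s *\<^sub>R v u + t *\<^sub>R v w" for s t u w unfolding v_def by (rule coord_vec_linear[OF c])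
  have key: "?f (v u) \<ge> ?f (v (X0 c)) + ereal (y \<bullet> (u - X0 c))" for u
  proof (rule conjugate_minimum_imp_subgradient[where f = "\<lambda>u. ?f (v u)" and fc = "\<lambda>z. fenchel_conj M C m F (cov z)"])
    show "?f (v ((1 - t) *\<^sub>R u + t *\<^sub>R w)) \<le> ereal (1 - t) * ?f (v u) + ereal t * ?f (v w)" if "0 < t" "t < 1" for u w t
      using conv that v(1) unfolding vlin convex_tan_def by blast
    show "\<exists>\<delta>>0. \<forall>w. norm (w - u) < \<delta> \<longrightarrow> b < ?f (v w)" if b: "b < ?f (v u)" for u b
    proof -
      obtain \<delta> where \<delta>: "\<delta> > 0" "\<And>Y. Y \<in> tangent_space M m \<Longrightarrow> tnorm M m (Y - v u) < \<delta> \<Longrightarrow> b < ?f Y"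
        using lsc b v(1) unfolding lsc_tan_def by blast
      have "b < ?f (v w)" if w: "norm (w - u) < \<delta> / (K + 1)" for w
      proof (rule \<delta>(2)[OF v(1)])
        have "v w - v u = v (w - u)" using vlin[of 1 w "-1" u] by simp
        then have "tnorm M m (v w - v u) \<le> K * norm (w - u)" using K(2) by simp
        also have "\<dots> \<le> (K + 1) * norm (w - u)" by (simp add: distrib_right)
        also have "\<dots> < \<delta>" using w K(1) by (simp add: pos_less_divide_eq mult.commute)
        finally show "tnorm M m (v w - v u) < \<delta>" .
      qed
      then show ?thesis using \<delta>(1) K(1) by (intro exI[of _ "\<delta> / (K + 1)"]) auto
    qed
    show "fenchel_conj M C m F (cov z) \<ge> fenchel_conj M C m F (cov y) + ereal ((z - y) \<bullet> X0 c)" for z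
      using min[OF cov[of z]] X0t by (simp add: y cov_def inner_diff_left)
  qed (use f1 fin conj in auto)
  have "?f Y \<ge> ?f X0 + ereal (\<xi> (Y - X0))" if Y: "Y \<in> tangent_space M m" for Y
    using key[of "Y c"] vX[OF Y] vX[OF X0t] tangent_diff[OF Y X0t] by (simp add: y cov_def)
  then show ?thesis using \<xi> by (simp add: subdiff_def)
qed

end

theorem corollary3p17:
  fixes M :: "('a, 'e::{real_inner,heine_borel}) rmfd"
    and C :: "'a set" and F :: "'a \<Rightarrow> ereal" and m p :: 'a
  assumes "riemannian_manifold M"
    and "strongly_convex M C"
    and "proper_on C F"
    and "m \<in> C" and "p \<in> C"
    and "convex_tan M m (pullback M C m F)"
    and "lsc_tan M m (pullback M C m F)"
  shows "\<forall>\<xi>\<in>cotangent_space M p.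
           cotransport M p m \<xi> \<in> subdiff M m (pullback M C m F) (log_map M C m p) \<longleftrightarrow>
           log_map M C m p \<in> subdiff_dual M m (fenchel_conj M C m F) (cotransport M p m \<xi>)"
proof
  interpret riemannian M by unfold_locales fact
  fix \<xi> assume "\<xi> \<in> cotangent_space M p"
  then have "cotransport M p m \<xi> \<in> cotangent_space M m"
    by (rule cotransport_in_cotangent[OF assms(2,5,4)])
  then show "cotransport M p m \<xi> \<in> subdiff M m (pullback M C m F) (log_map M C m p) \<longleftrightarrow>
           log_map M C m p \<in> subdiff_dual M m (fenchel_conj M C m F) (cotransport M p m \<xi>)"
    using subdiff_imp_subdiff_dual[OF assms(3,2,4) log_map_in_log_dom[OF assms(2,4,5)]]
      subdiff_dual_imp_subdiff[OF assms(3,2,4,6,7)] by blast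
qed

end
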